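(* Let $\Delta$ be a reflexive polytope with height function $h$, $\nu$ a positive measure on $B$ of total mass $\mu_M(A)$, and $\Psi$ its Kantorovich potential, solving the Monge-Ampère equation on $B\setminus\Sigma_\Psi$. Assume $\Sigma_\Psi$ is minimal, i.e. there is no closed proper subset $\Sigma''\subsetneq\Sigma_\Psi$ such that the tropical affine structure on $B\setminus\Sigma_\Psi$ extends to $B\setminus\Sigma''$ and the Monge-Ampère equation holds on $B\setminus\Sigma''$. Let $\{U'_\sigma\}_{\sigma\in A_d}$ be a collection of charts with singular set $\Sigma'$ such that $\Sigma_\Psi$ is not a subset of $\Sigma'$. Then there are a facet $\sigma$ of $\Delta$ and a point $n\in U'_\sigma$ such that $(\Psi-m_0)|_{U'_\sigma}\circ\beta_\sigma^{-1}$ is not differentiable at $\beta_\sigma(n)$ for $m_0\in\sigma$.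
   Context: Let $d\ge 1$, $M\cong\mathbb Z^{d+1}$ a lattice, $N=\mathrm{Hom}(M,\mathbb Z)$, $M_{\mathbb R},N_{\mathbb R}$ the real vector spaces with pairing $\langle\cdot,\cdot\rangle$. A reflexive polytope $\Delta\subset M_{\mathbb R}$ is a lattice polytope with $0$ in its interior whose dual is a lattice polytope. A height function is $h:\Delta\cap M\to\mathbb Z$ with $h(0)=0<h(m)$ for $m\ne0$. $\Delta_h^\vee=\{n:\langle m,n\rangle\le h(m)\ \forall m\in\Delta\cap M\}$, $A=\partial\Delta$, $B=\partial\Delta_h^\vee$; $B^\circ$ is the union of the relative interiors $\tau^\circ$ of the facets $\tau$ of $\Delta_h^\vee$, $B_{d-1}=B\setminus B^\circ$. $A_d$ is the set of facets of $\Delta$; for $\sigma\in A_d$, $n_\sigma\in N$ is its primitive outward normal and $\sigma^\circ$ its relative interior; for a facet $\tau$ of $\Delta_h^\vee$, $m_\tau\in A\cap M$ is its primitive outward normal. $\tau_m=\{n\in\Delta_h^\vee:\langle m,n\rangle=h(m)\}$ for $m\in A\cap M$. $\mu_M$ is the measure on $A$ equal on each facet $\sigma$ to Lebesgue measure normalized by the lattice $n_\sigma^\perp\cap M$. $\mathcal P(\Delta)$ is the set of convex $\Psi:N_{\mathbb R}\to\mathbb R$ with $\sup|\Psi(n)-\sup_{m\in\Delta\cap M}\langle m,n\rangle|<\infty$. For $\Psi$ continuous on $B$, $\Psi^c(m)=\sup_{n\in B}\langle m,n\rangle-\Psi(n)$ ($m\in A$), similarly $\Phi^c(n)=\sup_{m\in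 A}\langle m,n\rangle-\Phi(m)$; $c$-convex functions are the $c$-transforms of continuous functions. The Kantorovich potential of $\nu$ is the maximizer (unique up to constants) of $-\int_A\Psi^c\mu_M-\int_B\Psi\nu$ over $c$-convex $\Psi$ on $B$, extended to an element of $\mathcal P(\Delta)$ by $\Psi(n)=\sup_{m\in A}\langle m,n\rangle-\Psi^c(m)$. $\partial^c\Psi^c(m)=\{n\in B:\Psi^c(m')\ge\Psi^c(m)+\langle m'-m,n\rangle\ \forall m'\in A\}$. For $\sigma\in A_d$, $\beta_\sigma(n)=(\langle m_1,n\rangle,\dots,\langle m_d,n\rangle)$ for a $\mathbb Z$-basis $m_1,\dots,m_d$ of $n_\sigma^\perp\cap M$; $\beta_\sigma$ is injective on $\bigcup_{m\in\sigma\cap M}\tau_m$, with inverse $\beta_\sigma^{-1}$. A collection of charts is a family $\{U_\sigma\}_{\sigma\in A_d}$ of pairwise disjoint (possibly empty) open subsets of $B$ with $U_\sigma\subset\bigcup_{m\in\sigma\cap M}\tau_m$; its singular set is $\Sigma=B_{d-1}\setminus\bigcup_\sigma U_\sigma$. It defines a tropical affine structure on $B\setminus\Sigma=B^\circ\cup\bigcup_\sigma U_\sigma$ with coordinates $\beta_\sigma$ on $U_\sigma$ and $\beta_\sigma|_{\tau^\circ}$ ($m_\tau\in\sigma$) on $\tau^\circ$. All tropical affine structures considered are of this form, and the structure of charts $\{U''_\sigma\}$ with singular set $\Sigma''$ extends that of $\{U_\sigma\}$ if $\Sigma''\subset\Sigma$ and $U_\sigma\cap B_{d-1}\subset U''_\sigma$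 for all $\sigma$. The Monge-Ampère equation holds on $B\setminus\Sigma$ for $\Psi\in\mathcal P(\Delta)$ if $|\partial(\Psi\circ\beta_\sigma^{-1}|_{\beta_\sigma(\tau^\circ)})(\beta_\sigma(E))|=\nu(E)$ for all facets $\tau$ of $\Delta_h^\vee$, $\sigma\in A_d$ with $m_\tau\in\sigma$, $E\subset\tau^\circ$ measurable, and $|\partial((\Psi-m)\circ\beta_\sigma^{-1})(\beta_\sigma(E))|=\nu(E)$ for all $\sigma\in A_d$, $m\in\sigma$ (viewed as a linear function on $N_{\mathbb R}$), $E\subset U_\sigma$ measurable; $\partial$ is the subgradient of a convex function and $|\cdot|$ Lebesgue measure. $\Sigma_\Psi$ is the singular set of the charts $U_{\sigma,\Psi}=B\setminus\partial^c\Psi^c(A\setminus\sigma^\circ)$. *)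

theory Defs
  imports "HOL-Analysis.Analysis"
begin

text \<open>A basis of \<open>M\<close> is fixed once and for all: \<open>M\<close> and \<open>N\<close> are both the integer vectors of
  \<open>real ^ 'k\<close>, and the pairing of \<open>M_\<real>\<close> with \<open>N_\<real>\<close> is the inner product.
  The type \<open>'d\<close> indexes the coordinates of \<open>\<real>^d\<close>, where \<open>CARD('k) = d + 1\<close>.\<close>

definition int_lattice :: "(real ^ 'k) set" where
  "int_lattice = {x. \<forall>i. x $ i \<in> \<int>}"

definition lattice_polytope :: "(real ^ 'k::finite) set \<Rightarrow> bool" where
  "lattice_polytope P \<longleftrightarrow> (\<exists>V. finite V \<and> V \<subseteq> int_lattice \<and> P = convex hull V)"

definition polar_dual :: "(real ^ 'k::finite) set \<Rightarrow> (real ^ 'k) set" where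
  "polar_dual P = {n. \<forall>m\<in>P. m \<bullet> n \<le> 1}"

definition reflexive_polytope :: "(real ^ 'k::finite) set \<Rightarrow> bool" where
  "reflexive_polytope \<Delta> \<longleftrightarrow>
     lattice_polytope \<Delta> \<and> 0 \<in> interior \<Delta> \<and> lattice_polytope (polar_dual \<Delta>)"

definition height_function :: "(real ^ 'k::finite) set \<Rightarrow> (real ^ 'k \<Rightarrow> int) \<Rightarrow> bool" where
  "height_function \<Delta> h \<longleftrightarrow> h 0 = 0 \<and> (\<forall>m\<in>\<Delta> \<inter> int_lattice. m \<noteq> 0 \<longrightarrow> 0 < h m)"

text \<open>The polytope \<open>\<Delta>_h^\<or>\<close>.\<close>

definition height_dual :: "(real ^ 'k::finite) set \<Rightarrow> (real ^ 'k \<Rightarrow> int) \<Rightarrow> (real ^ 'k) set" where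
  "height_dual \<Delta> h = {n. \<forall>m\<in>\<Delta> \<inter> int_lattice. m \<bullet> n \<le> of_int (h m)}"

definition facets :: "(real ^ 'k::finite) set \<Rightarrow> (real ^ 'k) set set" where
  "facets P = {F. F facet_of P}"

definition primitive_vector :: "real ^ 'k \<Rightarrow> bool" where
  "primitive_vector v \<longleftrightarrow>
     v \<in> int_lattice \<and> v \<noteq> 0 \<and> (\<forall>w\<in>int_lattice. \<forall>j::nat. v = real j *\<^sub>R w \<longrightarrow> j = 1)"

text \<open>For a facet \<open>F\<close> of a full-dimensional polytope with rational facet normals there is exactly
  one such \<open>v\<close>. This gives \<open>n_\<sigma>\<close> for \<open>P = \<Delta>\<close> and \<open>m_\<tau>\<close> for \<open>P = \<Delta>_h^\<or>\<close>.\<close>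

definition outward_normal :: "(real ^ 'k::finite) set \<Rightarrow> (real ^ 'k) set \<Rightarrow> real ^ 'k" where
  "outward_normal P F =
     (THE v. primitive_vector v \<and> (\<exists>c. P \<subseteq> {x. v \<bullet> x \<le> c} \<and> F = P \<inter> {x. v \<bullet> x = c}))"

definition int_basis :: "(real ^ 'k) set \<Rightarrow> ('d::finite \<Rightarrow> real ^ 'k) \<Rightarrow> bool" where
  "int_basis L b \<longleftrightarrow>
     range b \<subseteq> L \<and> (\<forall>m\<in>L. \<exists>!c::'d \<Rightarrow> int. m = (\<Sum>i\<in>UNIV. of_int (c i) *\<^sub>R b i))"

text \<open>A choice of a \<open>\<int>\<close>-basis \<open>b \<sigma>\<close> of \<open>n_\<sigma>^\<bottom> \<inter> M\<close> for every facet \<open>\<sigma>\<close> of \<open>\<Delta>\<close>.\<close>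

definition facet_bases ::
  "(real ^ 'k::finite) set \<Rightarrow> ((real ^ 'k) set \<Rightarrow> 'd::finite \<Rightarrow> real ^ 'k) \<Rightarrow> bool" where
  "facet_bases \<Delta> b \<longleftrightarrow>
     (\<forall>\<sigma>\<in>facets \<Delta>. int_basis {m \<in> int_lattice. m \<bullet> outward_normal \<Delta> \<sigma> = 0} (b \<sigma>))"

text \<open>The part of \<open>\<mu>_M\<close> on \<open>\<sigma>\<close>: Lebesgue measure of \<open>\<real>^d\<close> carried to the affine span of \<open>\<sigma>\<close> by the
  basis \<open>b \<sigma>\<close>. It does not depend on the base point.\<close>

definition facet_param ::
  "((real ^ 'k::finite) set \<Rightarrow> 'd::finite \<Rightarrow> real ^ 'k) \<Rightarrow> (real ^ 'k) set \<Rightarrow> real ^ 'd \<Rightarrow> real ^ 'k"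
  where "facet_param b \<sigma> y = (SOME m. m \<in> \<sigma>) + (\<Sum>i\<in>UNIV. y $ i *\<^sub>R b \<sigma> i)"

definition mu_M ::
  "(real ^ 'k::finite) set \<Rightarrow> ((real ^ 'k) set \<Rightarrow> 'd::finite \<Rightarrow> real ^ 'k) \<Rightarrow> (real ^ 'k) measure" where
  "mu_M \<Delta> b = measure_of (frontier \<Delta>) (sets (restrict_space borel (frontier \<Delta>)))
     (\<lambda>E. \<Sum>\<sigma>\<in>facets \<Delta>. emeasure lborel (facet_param b \<sigma> -` (E \<inter> \<sigma>)))"

lemma space_mu_M [simp]: "space (mu_M \<Delta> b) = frontier \<Delta>"
  and sets_mu_M [simp]: "sets (mu_M \<Delta> b) = sets (restrict_space borel (frontier \<Delta>))"
proof -
  have sub: "sets (restrict_space borel (frontier \<Delta>)) \<subseteq> Pow (frontier \<Delta>)"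
    using sets.space_closed[of "restrict_space borel (frontier \<Delta>)"]
    by (simp add: space_restrict_space)
  show "space (mu_M \<Delta> b) = frontier \<Delta>"
    unfolding mu_M_def by (rule space_measure_of[OF sub])
  have "sigma_sets (frontier \<Delta>) (sets (restrict_space borel (frontier \<Delta>))) =
      sets (restrict_space borel (frontier \<Delta>))"
    using sets.sigma_sets_eq[of "restrict_space borel (frontier \<Delta>)"]
    by (simp add: space_restrict_space)
  then show "sets (mu_M \<Delta> b) = sets (restrict_space borel (frontier \<Delta>))"
    unfolding mu_M_def using sets_measure_of[OF sub] by simp
qed

lemma emeasure_mu_M:
  fixes \<Delta> :: "(real ^ 'k::finite) set" and b :: "(real ^ 'k) set \<Rightarrow> 'd::finite \<Rightarrow> real ^ 'k"
  assumes "polytope \<Delta>" and E: "E \<in> sets borel" "E \<subseteq> frontier \<Delta>"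
  shows "emeasure (mu_M \<Delta> b) E =
           (\<Sum>\<sigma>\<in>facets \<Delta>. emeasure lborel (facet_param b \<sigma> -` (E \<inter> \<sigma>)))"
proof -
  have meas: "facet_param b \<sigma> -` (X \<inter> \<sigma>) \<in> sets lborel"
    if X: "X \<in> sets borel" and \<sigma>: "\<sigma> \<in> facets \<Delta>" for X \<sigma>
  proof -
    have "continuous_on UNIV (facet_param b \<sigma>)"
      unfolding facet_param_def by (intro continuous_intros)
    then have "facet_param b \<sigma> \<in> borel_measurable borel"
      by (rule borel_measurable_continuous_onI)
    moreover have "closed \<sigma>"
      using \<sigma> assms(1) polytope_imp_closed face_of_polytope_polytope
      by (auto simp: facets_def facet_of_def)
    ultimately show ?thesis
      using X measurable_sets_borel[of "facet_param b \<sigma>" borel "X \<inter> \<sigma>"] by auto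
  qed
  have bor: "X \<in> sets borel" if "X \<in> sets (restrict_space borel (frontier \<Delta>))" for X
    using that by (subst (asm) sets_restrict_space_iff) auto
  show ?thesis
  proof (rule emeasure_measure_of[OF mu_M_def])
    show "sets (restrict_space borel (frontier \<Delta>)) \<subseteq> Pow (frontier \<Delta>)"
      using sets.space_closed[of "restrict_space borel (frontier \<Delta>)"]
      by (simp add: space_restrict_space)
    show "E \<in> sets (mu_M \<Delta> b)"
      using E by (simp add: sets_restrict_space_iff)
    show "positive (sets (mu_M \<Delta> b))
      (\<lambda>E. \<Sum>\<sigma>\<in>facets \<Delta>. emeasure lborel (facet_param b \<sigma> -` (E \<inter> \<sigma>)))"
      by (simp add: positive_def)
    show "countably_additive (sets (mu_M \<Delta> b))
      (\<lambda>E. \<Sum>\<sigma>\<in>facets \<Delta>. emeasure lborel (facet_param b \<sigma> -` (E \<inter> \<sigma>)))"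
    proof (rule countably_additiveI)
      fix X :: "nat \<Rightarrow> (real ^ 'k) set"
      assume X: "range X \<subseteq> sets (mu_M \<Delta> b)" "disjoint_family X"
      have "(\<Sum>i. \<Sum>\<sigma>\<in>facets \<Delta>. emeasure lborel (facet_param b \<sigma> -` (X i \<inter> \<sigma>))) =
        (\<Sum>\<sigma>\<in>facets \<Delta>. \<Sum>i. emeasure lborel (facet_param b \<sigma> -` (X i \<inter> \<sigma>)))"
        by (rule suminf_sum) simp
      also have "\<dots> = (\<Sum>\<sigma>\<in>facets \<Delta>. emeasure lborel (facet_param b \<sigma> -` ((\<Union>i. X i) \<inter> \<sigma>)))"
      proof (rule sum.cong[OF refl])
        fix \<sigma> assume \<sigma>: "\<sigma> \<in> facets \<Delta>"
        have "(\<Sum>i. emeasure lborel (facet_param b \<sigma> -` (X i \<inter> \<sigma>))) =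
          emeasure lborel (\<Union>i. facet_param b \<sigma> -` (X i \<inter> \<sigma>))"
        proof (rule suminf_emeasure)
          show "range (\<lambda>i. facet_param b \<sigma> -` (X i \<inter> \<sigma>)) \<subseteq> sets lborel"
            using meas[OF bor \<sigma>] X(1) by (auto simp: image_subset_iff)
          show "disjoint_family (\<lambda>i. facet_param b \<sigma> -` (X i \<inter> \<sigma>))"
            using X(2) by (auto simp: disjoint_family_on_def)
        qed
        also have "(\<Union>i. facet_param b \<sigma> -` (X i \<inter> \<sigma>)) = facet_param b \<sigma> -` ((\<Union>i. X i) \<inter> \<sigma>)"
          by auto
        finally show "(\<Sum>i. emeasure lborel (facet_param b \<sigma> -` (X i \<inter> \<sigma>))) =
          emeasure lborel (facet_param b \<sigma> -` ((\<Union>i. X i) \<inter> \<sigma>))" .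
      qed
      finally show "(\<Sum>i. \<Sum>\<sigma>\<in>facets \<Delta>. emeasure lborel (facet_param b \<sigma> -` (X i \<inter> \<sigma>))) =
        (\<Sum>\<sigma>\<in>facets \<Delta>. emeasure lborel (facet_param b \<sigma> -` ((\<Union>i. X i) \<inter> \<sigma>)))" .
    qed
  qed
qed

text \<open>\<open>\<P>(\<Delta>)\<close>.\<close>

definition P_class :: "(real ^ 'k::finite) set \<Rightarrow> (real ^ 'k \<Rightarrow> real) set" where
  "P_class \<Delta> = {\<Psi>. convex_on UNIV \<Psi> \<and>
     bdd_above (range (\<lambda>n. \<bar>\<Psi> n - (SUP m\<in>\<Delta> \<inter> int_lattice. m \<bullet> n)\<bar>))}"

text \<open>\<open>c_transform B\<close> maps functions on \<open>B\<close> to functions on \<open>A\<close>, and \<open>c_transform A\<close> conversely.\<close>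

definition c_transform :: "(real ^ 'k::finite) set \<Rightarrow> (real ^ 'k \<Rightarrow> real) \<Rightarrow> real ^ 'k \<Rightarrow> real" where
  "c_transform S f x = (SUP y\<in>S. x \<bullet> y - f y)"

definition c_convex_on ::
  "(real ^ 'k::finite) set \<Rightarrow> (real ^ 'k) set \<Rightarrow> (real ^ 'k \<Rightarrow> real) \<Rightarrow> bool" where
  "c_convex_on A B \<Psi> \<longleftrightarrow> (\<exists>\<Phi>. continuous_on A \<Phi> \<and> (\<forall>n\<in>B. \<Psi> n = c_transform A \<Phi> n))"

definition kantorovich_functional ::
  "(real ^ 'k::finite) set \<Rightarrow> (real ^ 'k \<Rightarrow> int) \<Rightarrow> ((real ^ 'k) set \<Rightarrow> 'd::finite \<Rightarrow> real ^ 'k) \<Rightarrow>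
   (real ^ 'k) measure \<Rightarrow> (real ^ 'k \<Rightarrow> real) \<Rightarrow> real" where
  "kantorovich_functional \<Delta> h b \<nu> \<Psi> =
     - (LINT m|mu_M \<Delta> b. c_transform (frontier (height_dual \<Delta> h)) \<Psi> m) - (LINT n|\<nu>. \<Psi> n)"

text \<open>The first two conditions only involve the values of \<open>\<Psi>\<close> on \<open>B\<close>; the third one says that \<open>\<Psi>\<close>
  is the extension of these values to \<open>N_\<real>\<close>.\<close>

definition kantorovich_potential ::
  "(real ^ 'k::finite) set \<Rightarrow> (real ^ 'k \<Rightarrow> int) \<Rightarrow> ((real ^ 'k) set \<Rightarrow> 'd::finite \<Rightarrow> real ^ 'k) \<Rightarrow>
   (real ^ 'k) measure \<Rightarrow> (real ^ 'k \<Rightarrow> real) \<Rightarrow> bool" where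
  "kantorovich_potential \<Delta> h b \<nu> \<Psi> \<longleftrightarrow>
     (let A = frontier \<Delta>; B = frontier (height_dual \<Delta> h) in
        c_convex_on A B \<Psi> \<and>
        (\<forall>\<Psi>'. c_convex_on A B \<Psi>' \<longrightarrow>
           kantorovich_functional \<Delta> h b \<nu> \<Psi>' \<le> kantorovich_functional \<Delta> h b \<nu> \<Psi>) \<and>
        (\<forall>n. \<Psi> n = (SUP m\<in>A. m \<bullet> n - c_transform B \<Psi> m)) \<and>
        \<Psi> \<in> P_class \<Delta>)"

text \<open>\<open>\<partial>^c\<Psi>^c(m)\<close>.\<close>

definition c_subgradient ::
  "(real ^ 'k::finite) set \<Rightarrow> (real ^ 'k \<Rightarrow> int) \<Rightarrow> (real ^ 'k \<Rightarrow> real) \<Rightarrow> real ^ 'k \<Rightarrow> (real ^ 'k) set"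
  where
  "c_subgradient \<Delta> h \<Psi> m =
     (let A = frontier \<Delta>; B = frontier (height_dual \<Delta> h) in
        {n\<in>B. \<forall>m'\<in>A. c_transform B \<Psi> m' \<ge> c_transform B \<Psi> m + (m' - m) \<bullet> n})"

text \<open>\<open>\<tau>_m\<close> and \<open>\<Union>\<^bsub>m \<in> \<sigma> \<inter> M\<^esub> \<tau>_m\<close>.\<close>

definition tau :: "(real ^ 'k::finite) set \<Rightarrow> (real ^ 'k \<Rightarrow> int) \<Rightarrow> real ^ 'k \<Rightarrow> (real ^ 'k) set" where
  "tau \<Delta> h m = {n \<in> height_dual \<Delta> h. m \<bullet> n = of_int (h m)}"

definition chart_domain ::
  "(real ^ 'k::finite) set \<Rightarrow> (real ^ 'k \<Rightarrow> int) \<Rightarrow> (real ^ 'k) set \<Rightarrow> (real ^ 'k) set" where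
  "chart_domain \<Delta> h \<sigma> = (\<Union>m\<in>\<sigma> \<inter> int_lattice. tau \<Delta> h m)"

definition beta ::
  "((real ^ 'k::finite) set \<Rightarrow> 'd::finite \<Rightarrow> real ^ 'k) \<Rightarrow> (real ^ 'k) set \<Rightarrow> real ^ 'k \<Rightarrow> real ^ 'd"
  where "beta b \<sigma> n = (\<chi> i. b \<sigma> i \<bullet> n)"

definition beta_inv ::
  "(real ^ 'k::finite) set \<Rightarrow> (real ^ 'k \<Rightarrow> int) \<Rightarrow> ((real ^ 'k) set \<Rightarrow> 'd::finite \<Rightarrow> real ^ 'k) \<Rightarrow>
   (real ^ 'k) set \<Rightarrow> real ^ 'd \<Rightarrow> real ^ 'k" where
  "beta_inv \<Delta> h b \<sigma> = inv_into (chart_domain \<Delta> h \<sigma>) (beta b \<sigma>)"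

text \<open>\<open>B_{d-1}\<close>.\<close>

definition lower_skeleton ::
  "(real ^ 'k::finite) set \<Rightarrow> (real ^ 'k \<Rightarrow> int) \<Rightarrow> (real ^ 'k) set" where
  "lower_skeleton \<Delta> h =
     frontier (height_dual \<Delta> h) - (\<Union>\<tau>\<in>facets (height_dual \<Delta> h). rel_interior \<tau>)"

definition chart_collection ::
  "(real ^ 'k::finite) set \<Rightarrow> (real ^ 'k \<Rightarrow> int) \<Rightarrow> ((real ^ 'k) set \<Rightarrow> (real ^ 'k) set) \<Rightarrow> bool" where
  "chart_collection \<Delta> h U \<longleftrightarrow>
     (\<forall>\<sigma>\<in>facets \<Delta>. openin (top_of_set (frontier (height_dual \<Delta> h))) (U \<sigma>) \<and>
        U \<sigma> \<subseteq> chart_domain \<Delta> h \<sigma>) \<and>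
     disjoint_family_on U (facets \<Delta>)"

definition singular_set ::
  "(real ^ 'k::finite) set \<Rightarrow> (real ^ 'k \<Rightarrow> int) \<Rightarrow> ((real ^ 'k) set \<Rightarrow> (real ^ 'k) set) \<Rightarrow>
   (real ^ 'k) set" where
  "singular_set \<Delta> h U = lower_skeleton \<Delta> h - (\<Union>\<sigma>\<in>facets \<Delta>. U \<sigma>)"

text \<open>The structure of the charts \<open>U''\<close> extends that of the charts \<open>U\<close>.\<close>

definition extends_charts ::
  "(real ^ 'k::finite) set \<Rightarrow> (real ^ 'k \<Rightarrow> int) \<Rightarrow> ((real ^ 'k) set \<Rightarrow> (real ^ 'k) set) \<Rightarrow>
   ((real ^ 'k) set \<Rightarrow> (real ^ 'k) set) \<Rightarrow> bool" where
  "extends_charts \<Delta> h U'' U \<longleftrightarrow> singular_set \<Delta> h U'' \<subseteq> singular_set \<Delta> h U \<and>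
     (\<forall>\<sigma>\<in>facets \<Delta>. U \<sigma> \<inter> lower_skeleton \<Delta> h \<subseteq> U'' \<sigma>)"

text \<open>Subgradient image of \<open>Y\<close> for a convex function \<open>f\<close> with domain \<open>D\<close>.\<close>

definition subgradient_image ::
  "(real ^ 'd::finite) set \<Rightarrow> (real ^ 'd \<Rightarrow> real) \<Rightarrow> (real ^ 'd) set \<Rightarrow> (real ^ 'd) set" where
  "subgradient_image D f Y = (\<Union>y\<in>Y. {p. \<forall>z\<in>D. f z \<ge> f y + p \<bullet> (z - y)})"

text \<open>The function \<open>(\<Psi> - m) \<circ> \<beta>_\<sigma>^{-1}\<close> is convex on its convex domain \<open>\<beta>_\<sigma>(chart_domain \<Delta> h \<sigma>)\<close>:
  along the fibres of \<open>\<beta>_\<sigma>\<close> the boundary \<open>B\<close> is the graph of a concave function, and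
  \<open>\<langle>m' - m, n_\<sigma>\<rangle> \<le> 0\<close> for \<open>m' \<in> \<Delta>\<close>. The set \<open>\<beta>_\<sigma>(U \<sigma>)\<close> is open, so on it the subgradient
  relative to the whole domain is the local one.\<close>

definition monge_ampere ::
  "(real ^ 'k::finite) set \<Rightarrow> (real ^ 'k \<Rightarrow> int) \<Rightarrow> ((real ^ 'k) set \<Rightarrow> 'd::finite \<Rightarrow> real ^ 'k) \<Rightarrow>
   (real ^ 'k) measure \<Rightarrow> (real ^ 'k \<Rightarrow> real) \<Rightarrow> ((real ^ 'k) set \<Rightarrow> (real ^ 'k) set) \<Rightarrow> bool" where
  "monge_ampere \<Delta> h b \<nu> \<Psi> U \<longleftrightarrow>
     (\<forall>\<tau>\<in>facets (height_dual \<Delta> h). \<forall>\<sigma>\<in>facets \<Delta>. outward_normal (height_dual \<Delta> h) \<tau> \<in> \<sigma> \<longrightarrow>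
        (\<forall>E\<in>sets \<nu>. E \<subseteq> rel_interior \<tau> \<longrightarrow>
           emeasure lebesgue (subgradient_image (beta b \<sigma> ` rel_interior \<tau>)
             (\<lambda>y. \<Psi> (beta_inv \<Delta> h b \<sigma> y)) (beta b \<sigma> ` E)) = emeasure \<nu> E)) \<and>
     (\<forall>\<sigma>\<in>facets \<Delta>. \<forall>m\<in>\<sigma>. \<forall>E\<in>sets \<nu>. E \<subseteq> U \<sigma> \<longrightarrow>
        emeasure lebesgue (subgradient_image (beta b \<sigma> ` chart_domain \<Delta> h \<sigma>)
          (\<lambda>y. \<Psi> (beta_inv \<Delta> h b \<sigma> y) - m \<bullet> beta_inv \<Delta> h b \<sigma> y) (beta b \<sigma> ` E)) = emeasure \<nu> E)"

text \<open>\<open>U\<^bsub>\<sigma>,\<Psi>\<^esub>\<close>.\<close>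

definition potential_charts ::
  "(real ^ 'k::finite) set \<Rightarrow> (real ^ 'k \<Rightarrow> int) \<Rightarrow> (real ^ 'k \<Rightarrow> real) \<Rightarrow> (real ^ 'k) set \<Rightarrow>
   (real ^ 'k) set" where
  "potential_charts \<Delta> h \<Psi> \<sigma> =
     frontier (height_dual \<Delta> h) - (\<Union>m\<in>frontier \<Delta> - rel_interior \<sigma>. c_subgradient \<Delta> h \<Psi> m)"

definition minimal_singular_set ::
  "(real ^ 'k::finite) set \<Rightarrow> (real ^ 'k \<Rightarrow> int) \<Rightarrow> ((real ^ 'k) set \<Rightarrow> 'd::finite \<Rightarrow> real ^ 'k) \<Rightarrow>
   (real ^ 'k) measure \<Rightarrow> (real ^ 'k \<Rightarrow> real) \<Rightarrow> ((real ^ 'k) set \<Rightarrow> (real ^ 'k) set) \<Rightarrow> bool" where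
  "minimal_singular_set \<Delta> h b \<nu> \<Psi> U \<longleftrightarrow>
     \<not> (\<exists>\<Sigma>'' U''. closed \<Sigma>'' \<and> \<Sigma>'' \<subset> singular_set \<Delta> h U \<and>
          chart_collection \<Delta> h U'' \<and> \<Sigma>'' = singular_set \<Delta> h U'' \<and>
          extends_charts \<Delta> h U'' U \<and> monge_ampere \<Delta> h b \<nu> \<Psi> U'')"

end

theory Submission
  imports Defs
begin

text \<open>
  The theorem holds because, if every chart of \<open>U'\<close> were smooth, it could be used to remove a point
  from the singular set of \<open>\<Psi>\<close>, against minimality.

  Write \<open>S(n)\<close> (\<open>contacts n\<close> below) for the set of \<open>m \<in> A\<close> with \<open>n \<in> \<partial>\<^sup>c\<Psi>\<^sup>c(m)\<close>. It is never empty, and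
  \<open>n\<close> lies in the chart of \<open>\<Psi>\<close> at \<open>\<sigma>\<close> exactly if \<open>S(n)\<close> is contained in the relative interior of \<open>\<sigma>\<close>.
  Let \<open>n \<in> U' \<sigma>\<close> be a point of the lower skeleton at which the chart function of \<open>\<Psi>\<close> is
  differentiable. At least two of the inequalities that define \<open>\<Delta>\<^sub>h\<^sup>\<or>\<close> are equalities at \<open>n\<close>, and all of
  these come from points of \<open>\<sigma>\<close>; so in the coordinates \<open>\<beta>\<^sub>\<sigma>\<close> the boundary \<open>B\<close> is the graph of a
  concave function with a kink at \<open>n\<close>. A point \<open>m \<in> S(n)\<close> outside \<open>\<sigma>\<close> would turn this kink into a
  convex kink of a function that touches the chart function from below, which differentiability
  excludes. Hence \<open>S(n)\<close> is a single point of \<open>\<sigma>\<close>, determined by the gradient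
  (\<open>differentiable_imp_unique_contact\<close>). Two consequences follow. No such \<open>n\<close> lies in a chart of \<open>\<Psi>\<close> at
  another facet. If moreover \<open>n\<close> is singular for \<open>\<Psi>\<close>, then \<open>S(n)\<close> lies in the relative boundary of \<open>\<sigma>\<close>,
  which is null.

  Now take a singular point \<open>x\<close> of \<open>\<Psi>\<close> in \<open>U' \<sigma>\<close>, add a small ball around \<open>x\<close> to the chart of \<open>\<Psi>\<close> at
  \<open>\<sigma>\<close>, and remove the closed ball from the other charts. By the first consequence no point of the
  lower skeleton is lost, so the new singular set is strictly smaller. It remains to see that the
  Monge-Ampere equation survives on the ball. On the relative interior of a facet of \<open>\<Delta>\<^sub>h\<^sup>\<or>\<close> it is the
  equation already known there: the chart function is convex, so its subgradients may be computed
  locally, and they differ from those of \<open>\<Psi>\<close> by a translation (\<open>chart_subgradient_on_facet\<close>). On the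
  singular points of \<open>\<Psi>\<close> both sides vanish. For the subgradient image this is the second
  consequence. For \<open>\<nu>\<close> it is the inequality \<open>\<nu>(K) \<le> \<mu>\<^sub>M(S(K))\<close>, obtained by lowering \<open>\<Psi>\<close> slightly
  near \<open>K\<close> and comparing with the maximiser (\<open>perturbation_bound\<close>, \<open>null_if_contacts_null\<close>). Finally
  the pieces are glued together, since the volume of subgradient images is additive
  (\<open>subgradient_image_distr\<close>, \<open>subgradient_mass_additive\<close>).
\<close>

section \<open>Volumes of subgradient images\<close>

text \<open>By translation invariance the mass of \<open>G\<close> is the average over \<open>t \<in> [0, 1]\<close> of the masses of
  the translates of \<open>G\<close> by \<open>- t *\<^sub>R e\<close>. In the other order of integration this average is zero,
  because every line in direction \<open>e\<close> spends no time in \<open>G\<close>.\<close>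

lemma null_of_countable_line_sections:
  fixes G :: "'a::euclidean_space set" and e :: 'a
  assumes G: "G \<in> sets borel" and cnt: "\<And>p. countable {t::real. p + t *\<^sub>R e \<in> G}"
  shows "emeasure lborel G = 0"
proof -
  define F where "F = (\<lambda>(t::real, p). indicator {0..1} t * indicator G (p + t *\<^sub>R e) :: ennreal)"
  have mF: "F \<in> borel_measurable (lborel \<Otimes>\<^sub>M lborel)"
    unfolding F_def using G by measurable
  have transl: "(\<integral>\<^sup>+ p. indicator G (p + w) \<partial>lborel) = emeasure lborel G" for w
  proof -
    have "emeasure lborel G = emeasure (distr lborel borel ((+) w)) G"
      by (simp add: lborel_distr_plus)
    also have "\<dots> = (\<integral>\<^sup>+ p. indicator G p \<partial>distr lborel borel ((+) w))"
      using G by simp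
    also have "\<dots> = (\<integral>\<^sup>+ p. indicator G (p + w) \<partial>lborel)"
      using G by (subst nn_integral_distr) (auto simp: add.commute)
    finally show ?thesis by simp
  qed
  have "emeasure lborel G = (\<integral>\<^sup>+ t. indicator {0..1} t * emeasure lborel G \<partial>(lborel :: real measure))"
    by (simp add: nn_integral_multc)
  also have "\<dots> = (\<integral>\<^sup>+ t. \<integral>\<^sup>+ p. F (t, p) \<partial>lborel \<partial>lborel)"
    unfolding F_def using G by (simp add: nn_integral_cmult transl)
  also have "\<dots> = (\<integral>\<^sup>+ p. \<integral>\<^sup>+ t. F (t, p) \<partial>lborel \<partial>lborel)"
    by (rule lborel_pair.Fubini[symmetric, OF mF])
  also have "\<dots> = (\<integral>\<^sup>+ p. 0 \<partial>(lborel :: 'a measure))"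
  proof (rule nn_integral_cong)
    fix p :: 'a
    have "AE t in lborel. p + t *\<^sub>R e \<notin> G"
      using AE_not_in[OF countable_imp_null_set_lborel[OF cnt[of p]]] by simp
    then have "(\<integral>\<^sup>+ t. F (t, p) \<partial>lborel) = (\<integral>\<^sup>+ t. 0 \<partial>(lborel :: real measure))"
      by (intro nn_integral_cong_AE) (auto simp: F_def)
    then show "(\<integral>\<^sup>+ t. F (t, p) \<partial>lborel) = 0" by simp
  qed
  finally show ?thesis by simp
qed

text \<open>The points at which \<open>p\<close> is a subgradient of \<open>f\<close> relative to \<open>D\<close>, that is, the maximisers of
  \<open>p \<bullet> y - f y\<close> over \<open>D\<close>. A subgradient image consists of the \<open>p\<close> whose contact set meets the given
  set.\<close>

definition contact_set :: "('a::real_inner) set \<Rightarrow> ('a \<Rightarrow> real) \<Rightarrow> 'a \<Rightarrow> 'a set" where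
  "contact_set D f p = {y \<in> D. \<forall>z\<in>D. f z \<ge> f y + p \<bullet> (z - y)}"

lemma subgradient_image_eq_contact:
  "Y \<subseteq> D \<Longrightarrow> subgradient_image D f Y = {p. contact_set D f p \<inter> Y \<noteq> {}}"
  by (auto simp: subgradient_image_def contact_set_def)

lemma contact_set_nonempty:
  fixes D :: "'a::euclidean_space set"
  assumes "compact D" "D \<noteq> {}" "continuous_on D f"
  shows "contact_set D f p \<noteq> {}"
proof -
  have "continuous_on D (\<lambda>y. f y - p \<bullet> y)"
    by (intro continuous_intros assms)
  from continuous_attains_inf[OF assms(1,2) this]
  obtain y where "y \<in> D" "\<forall>z\<in>D. f y - p \<bullet> y \<le> f z - p \<bullet> z" by auto
  then show ?thesis by (fastforce simp: contact_set_def inner_diff_right)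
qed

lemma contact_set_monotone:
  assumes "x \<in> contact_set D f p" "y \<in> contact_set D f q"
  shows "(q - p) \<bullet> (y - x) \<ge> 0"
proof -
  have "f y \<ge> f x + p \<bullet> (y - x)" "f x \<ge> f y + q \<bullet> (x - y)"
    using assms by (auto simp: contact_set_def)
  then show ?thesis by (simp add: inner_diff_left inner_diff_right)
qed

lemma closed_contact_graph:
  fixes D :: "'a::euclidean_space set"
  assumes "compact D" "continuous_on D f"
  shows "closed {(y, p). y \<in> contact_set D f p}"
proof -
  have eq: "{(y, p). y \<in> contact_set D f p} =
      D \<times> UNIV \<inter> (\<Inter>z\<in>D. {w \<in> D \<times> UNIV. f (fst w) + snd w \<bullet> (z - fst w) \<le> f z})"
    by (auto simp: contact_set_def)
  have cl: "closed (D \<times> (UNIV :: 'a set))"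
    using assms(1) by (intro closed_Times) (auto intro: compact_imp_closed)
  have cf: "continuous_on (D \<times> (UNIV :: 'a set)) (\<lambda>w. f (fst w))"
    by (rule continuous_on_compose2[OF assms(2)]) (auto intro: continuous_intros)
  have "closed {w \<in> D \<times> (UNIV :: 'a set). f (fst w) + snd w \<bullet> (z - fst w) \<le> f z}" for z
    using cl by (intro continuous_on_closed_Collect_le continuous_intros cf)
  then show ?thesis unfolding eq using cl by (intro closed_Int closed_INT) auto
qed

lemma closed_subgradient_image:
  fixes D :: "(real ^ 'd::finite) set"
  assumes "compact D" "continuous_on D f" "closed Y" "Y \<subseteq> D"
  shows "closed (subgradient_image D f Y)"
proof -
  have "subgradient_image D f Y = {p. \<exists>y. y \<in> Y \<and> (y, p) \<in> {(y, p). y \<in> contact_set D f p}}"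
    using assms(4) by (auto simp: subgradient_image_eq_contact)
  moreover have "compact Y"
    using assms(1,3,4) closed_Int_compact[of Y D] by (simp add: inf.absorb1)
  ultimately show ?thesis
    using closed_compact_projection[OF _ closed_contact_graph[OF assms(1,2)], of Y] by simp
qed

text \<open>Two distinct contact points differ in some coordinate \<open>e\<close>. As \<open>p\<close> moves in direction \<open>e\<close>, the
  \<open>e\<close>-coordinates of its contact points increase, so the open intervals between the coordinates of
  tied contact points are disjoint for different points of the line. There are thus only countably
  many ties in direction \<open>e\<close> on each line.\<close>

lemma contact_ties_null:
  fixes D :: "'a::euclidean_space set"
  assumes D: "compact D" and f: "continuous_on D f"
  shows "{p. \<exists>x\<in>contact_set D f p. \<exists>y\<in>contact_set D f p. x \<noteq> y} \<in> null_sets lborel"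
proof -
  define C where "C p = contact_set D f p" for p
  define G where "G e = {p. \<exists>x\<in>C p. \<exists>y\<in>C p. x \<bullet> e < y \<bullet> e}" for e
  have eq: "{p. \<exists>x\<in>C p. \<exists>y\<in>C p. x \<noteq> y} = (\<Union>e\<in>Basis. G e)"
  proof (intro set_eqI iffI)
    fix p assume "p \<in> {p. \<exists>x\<in>C p. \<exists>y\<in>C p. x \<noteq> y}"
    then obtain x y where xy: "x \<in> C p" "y \<in> C p" "x \<noteq> y" by auto
    then obtain e where "e \<in> Basis" "x \<bullet> e \<noteq> y \<bullet> e" using euclidean_eqI by blast
    then show "p \<in> (\<Union>e\<in>Basis. G e)"
      using xy unfolding G_def by (cases "x \<bullet> e < y \<bullet> e") force+
  next
    fix p assume "p \<in> (\<Union>e\<in>Basis. G e)"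
    then obtain e x y where "x \<in> C p" "y \<in> C p" "x \<bullet> e < y \<bullet> e" unfolding G_def by blast
    moreover from this have "x \<noteq> y" by auto
    ultimately show "p \<in> {p. \<exists>x\<in>C p. \<exists>y\<in>C p. x \<noteq> y}" by blast
  qed
  have "G e \<in> null_sets lborel" if "e \<in> Basis" for e
  proof -
    have "G e = (\<Union>k::nat. {p. \<exists>w. w \<in> D \<times> D \<and>
        (w, p) \<in> {(w, p). fst w \<in> C p \<and> snd w \<in> C p \<and> snd w \<bullet> e - fst w \<bullet> e \<ge> 1 / Suc k}})"
      (is "_ = (\<Union>k. ?H k)")
    proof (intro set_eqI iffI)
      fix p assume "p \<in> G e"
      then obtain x y where xy: "x \<in> C p" "y \<in> C p" "x \<bullet> e < y \<bullet> e" by (auto simp: G_def)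
      then obtain k where "inverse (real (Suc k)) < y \<bullet> e - x \<bullet> e"
        using reals_Archimedean[of "y \<bullet> e - x \<bullet> e"] by auto
      moreover have "x \<in> D" "y \<in> D" using xy by (auto simp: C_def contact_set_def)
      ultimately have "p \<in> ?H k"
        using xy by (intro CollectI exI[of _ "(x, y)"]) (auto simp: inverse_eq_divide)
      then show "p \<in> (\<Union>k. ?H k)" by blast
    next
      fix p assume "p \<in> (\<Union>k. ?H k)"
      then obtain k x y where "x \<in> C p" "y \<in> C p" "y \<bullet> e - x \<bullet> e \<ge> 1 / Suc k" by auto
      moreover have "1 / real (Suc k) > 0" by simp
      ultimately have "x \<bullet> e < y \<bullet> e" by linarith
      then show "p \<in> G e" using \<open>x \<in> C p\<close> \<open>y \<in> C p\<close> by (auto simp: G_def)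
    qed
    moreover have "closed (?H k)" for k :: nat
    proof (rule closed_compact_projection)
      have 1: "closed ((\<lambda>z. (fst (fst z), snd z)) -` {(y, p). y \<in> C p} :: (('a \<times> 'a) \<times> 'a) set)"
        unfolding C_def by (intro closed_vimage closed_contact_graph D f continuous_intros)
      have 2: "closed ((\<lambda>z. (snd (fst z), snd z)) -` {(y, p). y \<in> C p} :: (('a \<times> 'a) \<times> 'a) set)"
        unfolding C_def by (intro closed_vimage closed_contact_graph D f continuous_intros)
      have 3: "closed {z :: ('a \<times> 'a) \<times> 'a. 1 / Suc k \<le> snd (fst z) \<bullet> e - fst (fst z) \<bullet> e}"
        by (intro closed_Collect_le continuous_intros)
      have "{(w, p). fst w \<in> C p \<and> snd w \<in> C p \<and> snd w \<bullet> e - fst w \<bullet> e \<ge> 1 / Suc k} =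
        ((\<lambda>z. (fst (fst z), snd z)) -` {(y, p). y \<in> C p}) \<inter>
        ((\<lambda>z. (snd (fst z), snd z)) -` {(y, p). y \<in> C p}) \<inter>
        {z. 1 / Suc k \<le> snd (fst z) \<bullet> e - fst (fst z) \<bullet> e}"
        by auto
      then show "closed {(w, p). fst w \<in> C p \<and> snd w \<in> C p \<and>
          snd w \<bullet> e - fst w \<bullet> e \<ge> 1 / Suc k}"
        using 1 2 3 by (simp add: closed_Int)
    qed (intro compact_Times D)
    moreover have "(\<Union>k. ?H k) \<in> sets borel"
      using \<open>\<And>k. closed (?H k)\<close> by (intro sets.countable_UN) (auto intro: borel_closed)
    ultimately have meas: "G e \<in> sets borel" by simp
    have "countable {t::real. p + t *\<^sub>R e \<in> G e}" (is "countable ?T") for p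
    proof -
      have "\<forall>t\<in>?T. \<exists>q. q \<in> \<rat> \<and> (\<exists>x\<in>C (p + t *\<^sub>R e). \<exists>y\<in>C (p + t *\<^sub>R e). x \<bullet> e < q \<and> q < y \<bullet> e)"
        unfolding G_def using Rats_dense_in_real by blast
      then obtain q where q: "\<And>t. t \<in> ?T \<Longrightarrow> q t \<in> \<rat> \<and>
          (\<exists>x\<in>C (p + t *\<^sub>R e). \<exists>y\<in>C (p + t *\<^sub>R e). x \<bullet> e < q t \<and> q t < y \<bullet> e)"
        by metis
      have less: "q s < q t" if st: "s \<in> ?T" "t \<in> ?T" "s < t" for s t
      proof -
        obtain y where y: "y \<in> C (p + s *\<^sub>R e)" "q s < y \<bullet> e" using q[OF st(1)] by auto
        obtain x where x: "x \<in> C (p + t *\<^sub>R e)" "x \<bullet> e < q t" using q[OF st(2)] by auto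
        have "(t - s) * (e \<bullet> (x - y)) \<ge> 0"
          using contact_set_monotone[of y D f "p + s *\<^sub>R e" x "p + t *\<^sub>R e"] x y
          by (simp add: C_def algebra_simps)
        then have "e \<bullet> (x - y) \<ge> 0" using st(3) by (simp add: zero_le_mult_iff)
        then show ?thesis using x y by (simp add: inner_diff_right inner_commute)
      qed
      have "inj_on q ?T"
      proof (rule inj_onI)
        fix s t assume "s \<in> ?T" "t \<in> ?T" "q s = q t"
        then show "s = t" using less[of s t] less[of t s] by (cases s t rule: linorder_cases) auto
      qed
      moreover have "countable (q ` ?T)"
        using q by (intro countable_subset[OF _ countable_rat]) auto
      ultimately show ?thesis using countable_image_inj_on by blast
    qed
    then have "emeasure lborel (G e) = 0" by (rule null_of_countable_line_sections[OF meas])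
    then show ?thesis using meas by (simp add: null_sets_def)
  qed
  then have "(\<Union>e\<in>Basis. G e) \<in> null_sets lborel"
    by (intro null_sets.finite_UN) auto
  then show ?thesis using eq by (simp add: C_def)
qed

text \<open>Choose a contact point \<open>x p\<close> for every \<open>p\<close>. Up to the null set of ties, the subgradient image of \<open>Y\<close>
  is the preimage of \<open>Y\<close> under \<open>x\<close>. It is therefore measurable, and its volume is a measure as a
  function of \<open>Y\<close>, the Monge-Ampere measure of Aleksandrov.\<close>

lemma subgradient_image_distr:
  fixes D :: "(real ^ 'd::finite) set"
  assumes D: "compact D" "D \<noteq> {}" and f: "continuous_on D f"
  obtains x :: "real ^ 'd \<Rightarrow> real ^ 'd" where "x \<in> lebesgue \<rightarrow>\<^sub>M borel"
    "\<And>Y. Y \<in> sets borel \<Longrightarrow> Y \<subseteq> D \<Longrightarrow>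
      subgradient_image D f Y \<in> sets lebesgue \<and>
      emeasure lebesgue (subgradient_image D f Y) = emeasure (distr lebesgue borel x) Y"
proof -
  define x where "x p = (SOME y. y \<in> contact_set D f p)" for p
  have x: "x p \<in> contact_set D f p" for p
    unfolding x_def using contact_set_nonempty[OF D f] by (metis some_in_eq)
  define N where "N = {p. \<exists>x\<in>contact_set D f p. \<exists>y\<in>contact_set D f p. x \<noteq> y}"
  have N: "N \<in> null_sets lebesgue"
    using contact_ties_null[OF D(1) f] by (simp add: N_def null_sets_completionI)
  have le: "{p. x p \<in> Y} \<subseteq> subgradient_image D f Y" if "Y \<subseteq> D" for Y
    using x that by (auto simp: subgradient_image_eq_contact)
  have ge: "subgradient_image D f Y - {p. x p \<in> Y} \<in> null_sets lebesgue" if "Y \<subseteq> D" for Y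
  proof -
    note eq = subgradient_image_eq_contact[OF that, of f]
    have "subgradient_image D f Y - {p. x p \<in> Y} \<subseteq> N"
    proof
      fix p assume p: "p \<in> subgradient_image D f Y - {p. x p \<in> Y}"
      then obtain y where "y \<in> contact_set D f p" "y \<in> Y"
        unfolding eq by blast
      moreover from this p have "x p \<noteq> y" by auto
      ultimately show "p \<in> N" using x[of p] unfolding N_def by blast
    qed
    then show ?thesis using N null_sets_completion_subset by blast
  qed
  have meas: "x \<in> lebesgue \<rightarrow>\<^sub>M borel"
  proof -
    have "x \<in> measurable lebesgue (sigma UNIV (Collect closed))"
    proof (rule measurable_sigma_sets[OF sets_measure_of])
      show sub: "Collect closed \<subseteq> Pow (UNIV :: (real ^ 'd) set)" by auto
      show "Collect closed \<subseteq> Pow (UNIV :: (real ^ 'd) set)" by auto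
      show "x \<in> space lebesgue \<rightarrow> UNIV" by auto
      fix S :: "(real ^ 'd) set" assume "S \<in> Collect closed"
      then have S: "closed (S \<inter> D)" using D compact_imp_closed by auto
      let ?T = "subgradient_image D f (S \<inter> D)"
      have "{p. x p \<in> S \<inter> D} = ?T - (?T - {p. x p \<in> S \<inter> D})"
        using le[of "S \<inter> D"] by blast
      moreover have "?T \<in> sets lebesgue"
        using closed_subgradient_image[OF D(1) f S] by (auto intro: borel_closed)
      ultimately have "{p. x p \<in> S \<inter> D} \<in> sets lebesgue"
        using ge[of "S \<inter> D"] by (metis Int_lower2 null_setsD2 sets.Diff)
      moreover have "x -` S \<inter> space lebesgue = {p. x p \<in> S \<inter> D}"
        using x by (auto simp: contact_set_def)
      ultimately show "x -` S \<inter> space lebesgue \<in> sets lebesgue" by simp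
    qed
    then show ?thesis by (simp add: borel_eq_closed)
  qed
  show ?thesis
  proof (rule that[OF meas])
    fix Y :: "(real ^ 'd) set" assume Y: "Y \<in> sets borel" "Y \<subseteq> D"
    let ?X = "{p. x p \<in> Y}"
    have X: "?X \<in> sets lebesgue"
      using measurable_sets[OF meas Y(1)] by (simp add: vimage_def)
    have eq: "subgradient_image D f Y = ?X \<union> (subgradient_image D f Y - ?X)"
      using le[OF Y(2)] by blast
    have "emeasure (distr lebesgue borel x) Y = emeasure lebesgue ?X"
      using emeasure_distr[OF meas Y(1)] by (simp add: vimage_def)
    moreover have "emeasure lebesgue (subgradient_image D f Y) = emeasure lebesgue ?X"
      by (subst eq) (rule emeasure_Un_null_set[OF X ge[OF Y(2)]])
    moreover have "subgradient_image D f Y \<in> sets lebesgue"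
      by (subst eq) (rule sets.Un[OF X null_setsD2[OF ge[OF Y(2)]]])
    ultimately show "subgradient_image D f Y \<in> sets lebesgue \<and>
      emeasure lebesgue (subgradient_image D f Y) = emeasure (distr lebesgue borel x) Y"
      by simp
  qed
qed

section \<open>Lattice points and facet normals\<close>

lemma int_lattice_inner: "x \<in> int_lattice \<Longrightarrow> y \<in> int_lattice \<Longrightarrow> x \<bullet> y \<in> \<int>"
  for x y :: "real ^ 'k::finite"
  by (auto simp: int_lattice_def inner_vec_def intro!: Ints_sum Ints_mult)

lemma finite_bounded_int_lattice:
  fixes S :: "(real ^ 'k::finite) set"
  assumes "bounded S"
  shows "finite (S \<inter> int_lattice)"
proof -
  obtain K where K: "\<And>x. x \<in> S \<Longrightarrow> norm x \<le> K" using assms by (auto simp: bounded_iff)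
  have "(\<lambda>x. vec_nth x) ` (S \<inter> int_lattice) \<subseteq> (\<Pi>\<^sub>E i\<in>UNIV. real_of_int ` {- \<lceil>K\<rceil>..\<lceil>K\<rceil>})"
  proof (intro image_subsetI PiE_I)
    fix x i assume x: "x \<in> S \<inter> int_lattice"
    then obtain z where z: "x $ i = real_of_int z" by (auto simp: int_lattice_def elim: Ints_cases)
    have "\<bar>x $ i\<bar> \<le> K" using K x component_le_norm_cart[of x i] by fastforce
    then have "\<bar>z\<bar> \<le> \<lceil>K\<rceil>" unfolding z by linarith
    then show "x $ i \<in> real_of_int ` {- \<lceil>K\<rceil>..\<lceil>K\<rceil>}" unfolding z by (intro imageI) auto
  qed auto
  then have "finite ((\<lambda>x. vec_nth x) ` (S \<inter> int_lattice))"
    by (rule finite_subset) (intro finite_PiE; simp)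
  then show ?thesis
    by (rule finite_imageD) (simp add: inj_on_def vec_nth_inject)
qed

text \<open>If \<open>v = j w\<close>, then the integer \<open>j\<close> divides \<open>u \<bullet> v = 1\<close>.\<close>

lemma primitive_vector_if_unit_pairing:
  fixes u v :: "real ^ 'k::finite"
  assumes "v \<in> int_lattice" "u \<in> int_lattice" "u \<bullet> v = 1"
  shows "primitive_vector v"
  unfolding primitive_vector_def
proof (intro conjI ballI allI impI)
  show "v \<in> int_lattice" by fact
  show "v \<noteq> 0" using assms(3) by auto
next
  fix w :: "real ^ 'k" and j :: nat
  assume w: "w \<in> int_lattice" "v = real j *\<^sub>R w"
  obtain z where z: "u \<bullet> w = real_of_int z"
    using int_lattice_inner[OF assms(2) w(1)] by (auto elim: Ints_cases)
  have "real_of_int (int j * z) = 1" using assms(3) w(2) z by simp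
  then have "int j * z = 1" using of_int_eq_1_iff by blast
  then show "j = 1" by (auto simp: zmult_eq_1_iff)
qed

lemma hyperplane_level_pos:
  fixes Q :: "'a::euclidean_space set"
  assumes "0 \<in> interior Q" "v \<noteq> 0" "\<And>x. x \<in> Q \<Longrightarrow> v \<bullet> x \<le> c"
  shows "c > 0"
proof -
  obtain e where e: "e > 0" "ball 0 e \<subseteq> Q" using assms(1) mem_interior by blast
  define x where "x = (e / (2 * norm v)) *\<^sub>R v"
  have "norm x = e / 2" using assms(2) e(1) by (simp add: x_def)
  then have "x \<in> ball 0 e" using e(1) by simp
  then have "v \<bullet> x \<le> c" using e(2) assms(3) by blast
  moreover have "v \<bullet> x > 0" using assms(2) e(1) by (simp add: x_def)
  ultimately show ?thesis by simp
qed

text \<open>Both sides are affine of codimension one.\<close>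

lemma facet_affine_hull:
  fixes Q :: "'a::euclidean_space set"
  assumes "interior Q \<noteq> {}" "F facet_of Q" "v \<noteq> 0" "F \<subseteq> {x. v \<bullet> x = c}"
  shows "affine hull F = {x. v \<bullet> x = c}"
proof (rule affine_dim_equal)
  show "affine hull F \<noteq> {}" using assms(2) by (auto simp: facet_of_def)
  show "affine hull F \<subseteq> {x. v \<bullet> x = c}"
    by (rule hull_minimal[where S=affine]) (use assms affine_hyperplane in auto)
  have "aff_dim Q = DIM('a)" using assms(1) aff_dim_nonempty_interior by blast
  then show "aff_dim (affine hull F) = aff_dim {x. v \<bullet> x = c}"
    using assms(2,3) by (simp add: facet_of_def)
qed (auto simp: affine_hyperplane)

lemma hyperplane_subset_imp_parallel:
  fixes v w :: "'a::euclidean_space"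
  assumes "v \<noteq> 0" "c > 0" "{x. v \<bullet> x = c} \<subseteq> {x. w \<bullet> x = d}"
  shows "w = (d / c) *\<^sub>R v"
proof -
  have *: "w \<bullet> y + ((c - v \<bullet> y) / (v \<bullet> v)) * (w \<bullet> v) = d" for y
  proof -
    have "v \<bullet> (y + ((c - v \<bullet> y) / (v \<bullet> v)) *\<^sub>R v) = c"
      using assms(1) by (simp add: inner_add_right)
    then have "w \<bullet> (y + ((c - v \<bullet> y) / (v \<bullet> v)) *\<^sub>R v) = d" using assms(3) by blast
    then show ?thesis by (simp add: inner_add_right)
  qed
  have dc: "d / c = (w \<bullet> v) / (v \<bullet> v)" using *[of 0] assms(2) by (simp add: field_simps)
  show ?thesis
  proof (rule vector_eq_rdot[THEN iffD1, rule_format])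
    fix y
    have "w \<bullet> y = (v \<bullet> y) * ((w \<bullet> v) / (v \<bullet> v))"
      using *[of y] *[of 0] by (simp add: diff_divide_distrib algebra_simps)
    then show "w \<bullet> y = ((d / c) *\<^sub>R v) \<bullet> y" by (simp add: dc)
  qed
qed

text \<open>Every normal of \<open>F\<close> is a positive multiple of \<open>v\<close>. The factor of a primitive normal is its pairing
  with \<open>u\<close>, hence a positive integer, and so equals one.\<close>

lemma outward_normal_eqI:
  fixes Q :: "(real ^ 'k::finite) set"
  assumes Q: "0 \<in> interior Q" and F: "F facet_of Q"
    and v: "v \<in> int_lattice" "u \<in> int_lattice" "u \<bullet> v = 1"
    and Fv: "Q \<subseteq> {x. v \<bullet> x \<le> c}" "F = Q \<inter> {x. v \<bullet> x = c}"
  shows "outward_normal Q F = v"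
  unfolding outward_normal_def
proof (rule the_equality)
  show "primitive_vector v \<and> (\<exists>c. Q \<subseteq> {x. v \<bullet> x \<le> c} \<and> F = Q \<inter> {x. v \<bullet> x = c})"
    using primitive_vector_if_unit_pairing[OF v] Fv by blast
next
  fix w assume w: "primitive_vector w \<and> (\<exists>d. Q \<subseteq> {x. w \<bullet> x \<le> d} \<and> F = Q \<inter> {x. w \<bullet> x = d})"
  then obtain d where d: "Q \<subseteq> {x. w \<bullet> x \<le> d}" "F = Q \<inter> {x. w \<bullet> x = d}" by blast
  have w0: "w \<noteq> 0" "w \<in> int_lattice" using w by (auto simp: primitive_vector_def)
  have v0: "v \<noteq> 0" using v(3) by auto
  have c: "c > 0" using hyperplane_level_pos[OF Q v0] Fv(1) by blast
  have d0: "d > 0" using hyperplane_level_pos[OF Q w0(1)] d(1) by blast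
  have ne: "interior Q \<noteq> {}" using Q by auto
  have "{x. v \<bullet> x = c} \<subseteq> {x. w \<bullet> x = d}"
    using facet_affine_hull[OF ne F v0, of c] facet_affine_hull[OF ne F w0(1), of d] Fv(2) d(2)
    by auto
  then have wv: "w = (d / c) *\<^sub>R v" by (rule hyperplane_subset_imp_parallel[OF v0 c])
  then have "u \<bullet> w = d / c" using v(3) by simp
  then obtain z where z: "d / c = real_of_int z"
    using int_lattice_inner[OF v(2) w0(2)] by (auto elim: Ints_cases)
  then have "z > 0" using c d0 by (metis divide_pos_pos of_int_0_less_iff)
  then have "w = real (nat z) *\<^sub>R v" using wv z by simp
  then have "nat z = 1" using w v(1) unfolding primitive_vector_def by blast
  then show "w = v" using \<open>w = real (nat z) *\<^sub>R v\<close> by simp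
qed

lemma lattice_polytope_face_has_lattice_point:
  fixes Q :: "(real ^ 'k::finite) set"
  assumes "lattice_polytope Q" "F face_of Q" "F \<noteq> {}"
  obtains u where "u \<in> F \<inter> int_lattice"
proof -
  obtain V where V: "finite V" "V \<subseteq> int_lattice" "Q = convex hull V"
    using assms(1) by (auto simp: lattice_polytope_def)
  have "polytope F"
    using face_of_polytope_polytope assms(2) V by (metis polytope_convex_hull)
  then obtain u where u: "u extreme_point_of F"
    using extreme_point_exists_convex[OF polytope_imp_compact polytope_imp_convex assms(3)] by metis
  then have "u extreme_point_of Q" using extreme_point_of_face[OF assms(2)] by blast
  then have "u \<in> V" using V(3) extreme_point_of_convex_hull by blast
  moreover have "u \<in> F" using u by (simp add: extreme_point_of_def)
  ultimately show ?thesis using V(2) that by blast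
qed

lemma lattice_polytope_imp_polytope: "lattice_polytope Q \<Longrightarrow> polytope Q"
  by (auto simp: lattice_polytope_def polytope_def)

text \<open>The normal \<open>v\<close> of \<open>\<sigma>\<close>, scaled to be one on \<open>\<sigma>\<close>, is an extreme point of the polar dual: the end
  points of a segment through \<open>v\<close> in the dual are at most one on \<open>\<sigma>\<close>, so they are equal to one on \<open>\<sigma>\<close>,
  and \<open>\<sigma>\<close> determines such a vector. Extreme points of a lattice polytope are lattice points. A lattice
  point \<open>u\<close> of \<open>\<sigma>\<close> then shows that \<open>v\<close> is primitive.\<close>

lemma reflexive_facet_normal:
  fixes \<Delta> :: "(real ^ 'k::finite) set"
  assumes r: "reflexive_polytope \<Delta>" and \<sigma>: "\<sigma> \<in> facets \<Delta>"
  obtains u where "outward_normal \<Delta> \<sigma> \<in> int_lattice"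
    and "\<And>m. m \<in> \<Delta> \<Longrightarrow> m \<bullet> outward_normal \<Delta> \<sigma> \<le> 1"
    and "\<sigma> = \<Delta> \<inter> {m. m \<bullet> outward_normal \<Delta> \<sigma> = 1}"
    and "u \<in> \<sigma>" "u \<in> int_lattice" "u \<bullet> outward_normal \<Delta> \<sigma> = 1"
proof -
  have \<Delta>: "lattice_polytope \<Delta>" "0 \<in> interior \<Delta>" "lattice_polytope (polar_dual \<Delta>)"
    using r by (auto simp: reflexive_polytope_def)
  have F: "\<sigma> facet_of \<Delta>" using \<sigma> by (simp add: facets_def)
  obtain a c where a: "a \<noteq> 0" "\<Delta> \<subseteq> {x. a \<bullet> x \<le> c}" "\<sigma> = \<Delta> \<inter> {x. a \<bullet> x = c}"
    using facet_of_polyhedron[OF polytope_imp_polyhedron[OF lattice_polytope_imp_polytope[OF \<Delta>(1)]] F] .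
  have c: "c > 0" using hyperplane_level_pos[OF \<Delta>(2) a(1)] a(2) by blast
  define v where "v = (1 / c) *\<^sub>R a"
  have le: "m \<bullet> v \<le> 1" if "m \<in> \<Delta>" for m
    using a(2) that c by (auto simp: v_def inner_commute)
  have \<sigma>_eq: "\<sigma> = \<Delta> \<inter> {m. m \<bullet> v = 1}"
    unfolding a(3) using c by (auto simp: v_def inner_commute)
  have v0: "v \<noteq> 0" using a(1) c by (simp add: v_def)
  have ah: "affine hull \<sigma> = {m. v \<bullet> m = 1}"
    by (rule facet_affine_hull[OF _ F v0]) (use \<Delta>(2) \<sigma>_eq in \<open>auto simp: inner_commute\<close>)
  have unique: "w = v" if "\<sigma> \<subseteq> {m. w \<bullet> m = 1}" for w
  proof -
    have "affine hull \<sigma> \<subseteq> {m. w \<bullet> m = 1}"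
      by (rule hull_minimal[where S=affine]) (use that affine_hyperplane in auto)
    then have "w = (1 / 1) *\<^sub>R v" unfolding ah
      by (intro hyperplane_subset_imp_parallel[OF v0]) auto
    then show ?thesis by simp
  qed
  have "v extreme_point_of polar_dual \<Delta>"
    unfolding extreme_point_of_def
  proof (intro conjI ballI)
    show "v \<in> polar_dual \<Delta>" using le by (simp add: polar_dual_def)
  next
    fix p q assume pq: "p \<in> polar_dual \<Delta>" "q \<in> polar_dual \<Delta>"
    show "v \<notin> open_segment p q"
    proof
      assume "v \<in> open_segment p q"
      then obtain t where t: "p \<noteq> q" "0 < t" "t < 1" "v = (1 - t) *\<^sub>R p + t *\<^sub>R q"
        by (auto simp: in_segment)
      have "p \<bullet> m = 1 \<and> q \<bullet> m = 1" if m: "m \<in> \<sigma>" for m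
      proof -
        have pm: "p \<bullet> m \<le> 1" "q \<bullet> m \<le> 1"
          using pq m \<sigma>_eq by (auto simp: polar_dual_def inner_commute)
        have e: "(1 - t) * (p \<bullet> m) + t * (q \<bullet> m) = 1"
          using m \<sigma>_eq t(4) by (auto simp: inner_add_right inner_commute[of _ m])
        have "(1 - t) * (1 - p \<bullet> m) + t * (1 - q \<bullet> m) = 0" using e by (simp add: algebra_simps)
        moreover have "(1 - t) * (1 - p \<bullet> m) \<ge> 0" "t * (1 - q \<bullet> m) \<ge> 0" using pm t by auto
        ultimately have "(1 - t) * (1 - p \<bullet> m) = 0" "t * (1 - q \<bullet> m) = 0" by linarith+
        then show ?thesis using t by simp
      qed
      then have "p = v" "q = v" by (auto intro!: unique)
      then show False using t(1) by simp
    qed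
  qed
  then have v: "v \<in> int_lattice"
  proof -
    assume *: "v extreme_point_of polar_dual \<Delta>"
    obtain V where "V \<subseteq> int_lattice" "polar_dual \<Delta> = convex hull V"
      using \<Delta>(3) by (auto simp: lattice_polytope_def)
    then show ?thesis using * extreme_point_of_convex_hull[of v V] by auto
  qed
  obtain u where u: "u \<in> \<sigma> \<inter> int_lattice"
    using lattice_polytope_face_has_lattice_point[OF \<Delta>(1), of \<sigma>] F by (auto simp: facet_of_def)
  have uv: "u \<bullet> v = 1" using u \<sigma>_eq by auto
  have "outward_normal \<Delta> \<sigma> = v"
    by (rule outward_normal_eqI[OF \<Delta>(2) F v _ uv, of 1])
      (use u le \<sigma>_eq in \<open>auto simp: inner_commute\<close>)
  then show ?thesis using that[of u] v le \<sigma>_eq u uv by auto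
qed

definition lin_comb :: "('d::finite \<Rightarrow> real ^ 'k::finite) \<Rightarrow> real ^ 'd \<Rightarrow> real ^ 'k" where
  "lin_comb c y = (\<Sum>i\<in>UNIV. y $ i *\<^sub>R c i)"

lemma linear_lin_comb: "linear (lin_comb c)"
  by (rule linearI) (auto simp: lin_comb_def scaleR_add_left sum.distrib scaleR_sum_right)

lemma lin_comb_inner: "lin_comb c y \<bullet> n = y \<bullet> (\<chi> i. c i \<bullet> n)"
  by (simp add: lin_comb_def inner_sum_left inner_vec_def[of y])

text \<open>The integral vectors \<open>v\<^sub>i e\<^sub>j - v\<^sub>j e\<^sub>i\<close> are combinations of the basis, so whatever is orthogonal to the
  basis is proportional to \<open>v\<close>. Hence the basis spans the orthogonal complement of \<open>v\<close> over the reals,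
  and it has as many members as this space has dimensions.\<close>

lemma int_basis_normal_space:
  fixes c :: "'d::finite \<Rightarrow> real ^ 'k::finite"
  assumes card: "CARD('k) = CARD('d) + 1"
    and v: "v \<in> int_lattice" "u \<bullet> v = 1"
    and c: "int_basis {m \<in> int_lattice. m \<bullet> v = 0} c"
  shows "inj (lin_comb c)"
    and "range (lin_comb c) = {x. x \<bullet> v = 0}"
    and "\<And>y. (\<And>i. c i \<bullet> y = 0) \<Longrightarrow> y = (u \<bullet> y) *\<^sub>R v"
proof -
  have cv: "c i \<bullet> v = 0" for i using c by (auto simp: int_basis_def)
  have v0: "v \<noteq> 0" using v(2) by auto
  show perp: "y = (u \<bullet> y) *\<^sub>R v" if y: "\<And>i. c i \<bullet> y = 0" for y
  proof -
    have swap: "v $ i * y $ j = v $ j * y $ i" for i j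
    proof -
      let ?w = "v $ i *\<^sub>R axis j 1 - v $ j *\<^sub>R axis i 1 :: real ^ 'k"
      have "?w \<in> int_lattice"
        using v(1) by (auto simp: int_lattice_def axis_def)
      moreover have "?w \<bullet> v = 0"
        by (simp add: inner_diff_left inner_axis' mult.commute)
      ultimately obtain z :: "'d \<Rightarrow> int" where "?w = (\<Sum>l\<in>UNIV. of_int (z l) *\<^sub>R c l)"
        using c unfolding int_basis_def by blast
      then have "?w \<bullet> y = 0" using y by (simp add: inner_sum_left)
      then show ?thesis by (simp add: inner_diff_left inner_axis')
    qed
    show ?thesis
    proof (rule vec_eq_iff[THEN iffD2, rule_format])
      fix j
      have "y $ j = (\<Sum>i\<in>UNIV. u $ i * v $ i) * y $ j"
        using v(2) by (simp add: inner_vec_def)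
      also have "\<dots> = (\<Sum>i\<in>UNIV. u $ i * y $ i) * v $ j"
        unfolding sum_distrib_right
        by (intro sum.cong refl) (use swap in \<open>metis mult.assoc mult.commute\<close>)
      finally show "y $ j = ((u \<bullet> y) *\<^sub>R v) $ j" by (simp add: inner_vec_def)
    qed
  qed
  have sub: "range c \<subseteq> {x. v \<bullet> x = 0}" using cv by (auto simp: inner_commute)
  have span: "{x. v \<bullet> x = 0} \<subseteq> span (range c)"
  proof
    fix x assume x: "x \<in> {x. v \<bullet> x = 0}"
    obtain s y where sy: "s \<in> span (range c)" "\<And>w. w \<in> span (range c) \<Longrightarrow> orthogonal y w" "x = s + y"
      using orthogonal_subspace_decomp_exists[of "range c" x] by metis
    have "c i \<bullet> y = 0" for i
      using sy(2)[of "c i"] by (simp add: span_base orthogonal_def inner_commute)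
    then have y: "y = (u \<bullet> y) *\<^sub>R v" by (rule perp)
    have "v \<bullet> s = 0"
      using span_minimal[OF sub subspace_hyperplane] sy(1) by auto
    then have "v \<bullet> y = 0" using x sy(3) by (simp add: inner_add_right)
    then have "(u \<bullet> y) * (v \<bullet> v) = 0" by (subst (asm) y) simp
    then have "y = 0" using y v0 by simp
    then show "x \<in> span (range c)" using sy by simp
  qed
  have dim: "dim {x :: real ^ 'k. v \<bullet> x = 0} = CARD('d)"
    using dim_hyperplane[OF v0] card by simp
  have le: "card (range c) \<le> CARD('d)" by (rule card_image_le) simp
  moreover have "CARD('d) \<le> card (range c)"
    using dim_le_card[OF span] dim by simp
  ultimately have cd: "card (range c) = CARD('d)" by simp
  then have inj: "inj c" by (intro eq_card_imp_inj_on) auto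
  have ind: "independent (range c)"
    by (rule card_le_dim_spanning[OF sub span]) (use dim cd in auto)
  show "inj (lin_comb c)"
  proof (rule linear_injective_0[OF linear_lin_comb, THEN iffD2], intro allI impI)
    fix y assume y: "lin_comb c y = 0"
    have "(\<Sum>x\<in>range c. (y $ inv c x) *\<^sub>R x) = 0"
      using y inj by (simp add: lin_comb_def sum.reindex)
    then have "\<forall>x\<in>range c. y $ inv c x = 0"
      using ind unfolding independent_explicit by auto
    then show "y = 0" using inj by (auto simp: vec_eq_iff)
  qed
  show "range (lin_comb c) = {x. x \<bullet> v = 0}"
  proof
    show "range (lin_comb c) \<subseteq> {x. x \<bullet> v = 0}"
      using cv by (auto simp: lin_comb_inner zero_vec_def[symmetric])
    show "{x. x \<bullet> v = 0} \<subseteq> range (lin_comb c)"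
    proof
      fix x assume "x \<in> {x. x \<bullet> v = 0}"
      then have "x \<in> span (range c)" using span by (auto simp: inner_commute)
      then obtain w where "x = (\<Sum>a\<in>range c. w a *\<^sub>R a)"
        unfolding span_finite[of "range c", simplified] by auto
      then have "x = lin_comb c (\<chi> i. w (c i))"
        using inj by (simp add: lin_comb_def sum.reindex)
      then show "x \<in> range (lin_comb c)" by blast
    qed
  qed
qed

text \<open>The parametrisation is a homeomorphism onto the hyperplane of \<open>F\<close>, so it pulls the relative boundary
  of \<open>F\<close> back into the frontier of a convex set.\<close>

lemma negligible_relative_boundary_preimage:
  fixes c :: "'d::finite \<Rightarrow> real ^ 'k::finite"
  assumes inj: "inj (lin_comb c)" and rng: "range (lin_comb c) = {x. x \<bullet> v = 0}"
    and F: "convex F" "F \<subseteq> {x. x \<bullet> v = r}" and m: "m \<bullet> v = r"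
  shows "negligible {y. m + lin_comb c y \<in> F - rel_interior F}"
proof -
  let ?C = "{y. m + lin_comb c y \<in> F}"
  have "?C = lin_comb c -` ((\<lambda>x. m + x) -` F)" by auto
  moreover have "convex ((\<lambda>x. m + x) -` F)"
  proof -
    have "(\<lambda>x. m + x) -` F = (\<lambda>x. - m + x) ` F" by (auto simp: image_iff algebra_simps)
    then show ?thesis using convex_translation[OF F(1)] by simp
  qed
  ultimately have cC: "convex ?C" using convex_linear_vimage[OF linear_lin_comb] by metis
  have "affine {x. x \<bullet> v = r}" using affine_hyperplane[of v r] by (simp add: inner_commute)
  then have hull: "affine hull F \<subseteq> {x. x \<bullet> v = r}" using F(2) by (rule hull_minimal[rotated])
  obtain B where B: "B > 0" "\<And>x. B * norm x \<le> norm (lin_comb c x)"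
    using linear_inj_bounded_below_pos[OF linear_lin_comb inj] by metis
  have "{y. m + lin_comb c y \<in> F - rel_interior F} \<subseteq> frontier ?C"
  proof
    fix y assume y: "y \<in> {y. m + lin_comb c y \<in> F - rel_interior F}"
    have "y \<notin> interior ?C"
    proof
      assume "y \<in> interior ?C"
      then obtain e where e: "e > 0" "ball y e \<subseteq> ?C" using mem_interior by blast
      have "ball (m + lin_comb c y) (B * e) \<inter> affine hull F \<subseteq> F"
      proof
        fix x assume x: "x \<in> ball (m + lin_comb c y) (B * e) \<inter> affine hull F"
        then have "(x - m) \<bullet> v = 0" using hull m by (auto simp: inner_diff_left)
        then obtain z where z: "x - m = lin_comb c z" using rng by blast
        have "lin_comb c (y - z) = (m + lin_comb c y) - x"
          using z by (simp add: linear_diff[OF linear_lin_comb] algebra_simps)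
        then have "B * norm (y - z) < B * e"
          using B(2)[of "y - z"] x by (auto simp: dist_norm)
        then have "z \<in> ball y e" using B(1) by (simp add: dist_norm)
        then have "m + lin_comb c z \<in> F" using e by blast
        then show "x \<in> F" using z by (metis add.commute diff_add_cancel)
      qed
      then have "m + lin_comb c y \<in> rel_interior F"
        unfolding mem_rel_interior_ball using y B(1) e(1) by (auto intro!: exI[of _ "B * e"])
      then show False using y by simp
    qed
    moreover have "y \<in> ?C" using y by simp
    ultimately show "y \<in> frontier ?C" using closure_subset[of ?C] unfolding frontier_def by blast
  qed
  then show ?thesis using negligible_convex_frontier[OF cC] negligible_subset by blast
qed

section \<open>The boundary of the dual polytope\<close>

locale reflexive_height =
  fixes \<Delta> :: "(real ^ 'k::finite) set" and h :: "real ^ 'k \<Rightarrow> int"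
  assumes reflexive: "reflexive_polytope \<Delta>" and height: "height_function \<Delta> h"
begin

abbreviation "A \<equiv> frontier \<Delta>"
abbreviation "P \<equiv> height_dual \<Delta> h"
abbreviation "B \<equiv> frontier P"

text \<open>The inequality of \<open>m = 0\<close> reads \<open>0 \<le> 0\<close> and says nothing about \<open>n\<close>; it is left out so that a point of
  the polytope is interior exactly if no inequality is active.\<close>

definition active :: "real ^ 'k \<Rightarrow> (real ^ 'k) set" where
  "active n = {m \<in> \<Delta> \<inter> int_lattice. m \<noteq> 0 \<and> m \<bullet> n = of_int (h m)}"

lemma polytope_Delta: "polytope \<Delta>"
  using reflexive lattice_polytope_imp_polytope by (auto simp: reflexive_polytope_def)

lemma zero_interior_Delta: "0 \<in> interior \<Delta>"
  using reflexive by (auto simp: reflexive_polytope_def)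

lemma finite_lattice_points: "finite (\<Delta> \<inter> int_lattice)"
  by (rule finite_bounded_int_lattice[OF polytope_imp_bounded[OF polytope_Delta]])

lemma finite_active: "finite (active n)"
  by (rule finite_subset[OF _ finite_lattice_points]) (auto simp: active_def)

lemma height_zero: "h 0 = 0"
  using height by (auto simp: height_function_def)

lemma height_pos: "m \<in> \<Delta> \<Longrightarrow> m \<in> int_lattice \<Longrightarrow> m \<noteq> 0 \<Longrightarrow> 0 < h m"
  using height by (auto simp: height_function_def)

lemma mem_P: "n \<in> P \<longleftrightarrow> (\<forall>m\<in>\<Delta> \<inter> int_lattice. m \<noteq> 0 \<longrightarrow> m \<bullet> n \<le> of_int (h m))"
  using height_zero by (auto simp: height_dual_def) (metis IntI inner_zero_left of_int_0 order_refl)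

lemma open_strict_constraints:
  "open {x. \<forall>m\<in>\<Delta> \<inter> int_lattice - S. m \<bullet> x < of_int (h m)}"
proof -
  have "{x. \<forall>m\<in>\<Delta> \<inter> int_lattice - S. m \<bullet> x < of_int (h m)} =
      (\<Inter>m\<in>\<Delta> \<inter> int_lattice - S. {x. m \<bullet> x < of_int (h m)})" by auto
  then show ?thesis
    using finite_lattice_points by (auto intro!: open_INT open_halfspace_lt)
qed

text \<open>A linear functional that is bounded above on the vertices of \<open>\<Delta>\<close> is bounded on \<open>\<Delta>\<close>, which contains a ball
  around the origin.\<close>

lemma bounded_P: "bounded P"
proof -
  obtain e where e: "e > 0" "cball 0 e \<subseteq> \<Delta>"
    using zero_interior_Delta mem_interior_cball by blast
  obtain V where V: "finite V" "V \<subseteq> int_lattice" "\<Delta> = convex hull V"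
    using reflexive by (auto simp: reflexive_polytope_def lattice_polytope_def)
  define K where "K = Max (insert 0 (of_int ` h ` V)) + (0::real)"
  have "norm n \<le> K / e" if n: "n \<in> P" for n
  proof -
    have "V \<subseteq> {m. n \<bullet> m \<le> K}"
    proof
      fix m assume m: "m \<in> V"
      then have "m \<in> \<Delta>" using V(3) hull_inc by metis
      then have "n \<bullet> m \<le> of_int (h m)"
        using n m V(2) by (auto simp: height_dual_def inner_commute)
      also have "\<dots> \<le> K" using m V(1) by (auto simp: K_def intro!: Max_ge)
      finally show "m \<in> {m. n \<bullet> m \<le> K}" by simp
    qed
    then have \<Delta>: "\<Delta> \<subseteq> {m. n \<bullet> m \<le> K}"
      unfolding V(3) by (rule hull_minimal) (rule convex_halfspace_le)
    show ?thesis
    proof (cases "n = 0")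
      case False
      have "(e / norm n) *\<^sub>R n \<in> cball 0 e" using False e(1) by simp
      then have "n \<bullet> ((e / norm n) *\<^sub>R n) \<le> K" using e(2) \<Delta> by blast
      then have "e * norm n \<le> K" using False by (simp add: dot_square_norm power2_eq_square)
      then show ?thesis using e(1) by (simp add: field_simps)
    next
      case True
      have "K \<ge> 0" unfolding K_def using V(1) by simp
      then show ?thesis using True e(1) by simp
    qed
  qed
  then show ?thesis by (auto simp: bounded_iff)
qed

lemma polytope_P: "polytope P"
proof -
  have "P = (\<Inter>m\<in>\<Delta> \<inter> int_lattice. {n. m \<bullet> n \<le> of_int (h m)})"
    by (auto simp: height_dual_def)
  moreover have "polyhedron \<dots>"
    using finite_lattice_points by (auto simp: polyhedron_halfspace_le)
  ultimately show ?thesis using bounded_P by (simp add: polytope_eq_bounded_polyhedron)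
qed

lemma compact_P: "compact P" and convex_P: "convex P" and closed_P: "closed P"
  using polytope_P polytope_imp_compact polytope_imp_convex polytope_imp_closed by auto

lemma compact_A: "compact A" and compact_B: "compact B"
  using compact_frontier polytope_imp_compact[OF polytope_Delta] compact_P by auto

lemma B_subset_P: "B \<subseteq> P"
  using closed_P frontier_subset_closed by blast

lemma A_subset_Delta: "A \<subseteq> \<Delta>"
  using polytope_imp_closed[OF polytope_Delta] frontier_subset_closed by blast

lemma strictly_feasible_interior:
  assumes "\<forall>m\<in>\<Delta> \<inter> int_lattice - {0}. m \<bullet> x < of_int (h m)"
  shows "x \<in> interior P"
proof (rule interiorI[OF open_strict_constraints[of "{0}"]])
  show "{x. \<forall>m\<in>\<Delta> \<inter> int_lattice - {0}. m \<bullet> x < of_int (h m)} \<subseteq> P"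
    by (force simp: mem_P)
qed (use assms in auto)

lemma zero_interior_P: "0 \<in> interior P"
  by (rule strictly_feasible_interior) (auto intro: height_pos)

lemma mem_B: "n \<in> B \<longleftrightarrow> n \<in> P \<and> active n \<noteq> {}"
proof -
  have "n \<notin> interior P" if m: "m \<in> active n" for m
  proof
    assume "n \<in> interior P"
    then obtain e where e: "e > 0" "cball n e \<subseteq> P" using mem_interior_cball by blast
    have m0: "m \<noteq> 0" using m by (simp add: active_def)
    have "n + (e / norm m) *\<^sub>R m \<in> cball n e" using e(1) m0 by (simp add: dist_norm)
    then have "m \<bullet> (n + (e / norm m) *\<^sub>R m) \<le> of_int (h m)"
      using e(2) m by (auto simp: active_def height_dual_def)
    moreover have "(e / norm m) * (m \<bullet> m) > 0" using e(1) m0 by simp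
    ultimately show False using m by (simp add: active_def inner_add_right)
  qed
  moreover have "n \<in> interior P" if "n \<in> P" "active n = {}"
    by (rule strictly_feasible_interior)
      (use that in \<open>force simp: active_def mem_P order_le_less\<close>)
  ultimately show ?thesis
    using closed_P by (auto simp: frontier_def)
qed

lemma eventually_ray_in_P:
  assumes n: "n \<in> P" and w: "\<And>m. m \<in> active n \<Longrightarrow> m \<bullet> w \<le> 0"
  shows "\<forall>\<^sub>F e in at_right 0. n + e *\<^sub>R w \<in> P"
proof -
  have "\<forall>\<^sub>F e in at_right 0. \<forall>m\<in>\<Delta> \<inter> int_lattice. m \<noteq> 0 \<longrightarrow> m \<bullet> (n + e *\<^sub>R w) \<le> of_int (h m)"
  proof (rule eventually_ball_finite[OF finite_lattice_points], rule ballI)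
    fix m assume m: "m \<in> \<Delta> \<inter> int_lattice"
    show "\<forall>\<^sub>F e in at_right 0. m \<noteq> 0 \<longrightarrow> m \<bullet> (n + e *\<^sub>R w) \<le> of_int (h m)"
    proof (cases "m \<in> active n \<or> m = 0")
      case True
      have "\<forall>\<^sub>F e in at_right (0::real). e > 0" by (rule eventually_at_right_less)
      then show ?thesis
      proof eventually_elim
        case (elim e)
        show ?case
          using True w[of m] elim by (auto simp: active_def inner_add_right mult_nonneg_nonpos)
      qed
    next
      case False
      then have "m \<bullet> n < of_int (h m)" using m n by (force simp: active_def mem_P order_le_less)
      moreover have "((\<lambda>e. m \<bullet> (n + e *\<^sub>R w)) \<longlongrightarrow> m \<bullet> (n + 0 *\<^sub>R w)) (at_right 0)"
        by (intro tendsto_intros)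
      ultimately have "\<forall>\<^sub>F e in at_right 0. m \<bullet> (n + e *\<^sub>R w) < of_int (h m)"
        using order_tendstoD(2) by force
      then show ?thesis by eventually_elim auto
    qed
  qed
  then show ?thesis by eventually_elim (auto simp: mem_P)
qed

text \<open>For short times the ray obeys all inequalities, and it stays on the boundary because the inequality
  of \<open>m0\<close> remains an equality.\<close>

lemma eventually_ray_in_open:
  assumes U: "openin (top_of_set B) U" "n \<in> U"
    and w: "\<And>m. m \<in> active n \<Longrightarrow> m \<bullet> w \<le> 0" and m0: "m0 \<in> active n" "m0 \<bullet> w = 0"
  shows "\<forall>\<^sub>F e in at_right 0. n + e *\<^sub>R w \<in> U"
proof -
  obtain T where T: "open T" "U = B \<inter> T" using U(1) by (auto simp: openin_open)
  have "((\<lambda>e. n + e *\<^sub>R w) \<longlongrightarrow> n + 0 *\<^sub>R w) (at_right 0)" by (intro tendsto_intros)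
  then have "\<forall>\<^sub>F e in at_right 0. n + e *\<^sub>R w \<in> T"
    using T U(2) by (intro topological_tendstoD) auto
  moreover have "\<forall>\<^sub>F e in at_right 0. n + e *\<^sub>R w \<in> P"
    using eventually_ray_in_P[OF _ w] U(2) T B_subset_P by blast
  ultimately show ?thesis
  proof eventually_elim
    case (elim e)
    have "m0 \<in> active (n + e *\<^sub>R w)" using m0 by (simp add: active_def inner_add_right)
    then show ?case using elim T(2) mem_B by blast
  qed
qed

lemma active_face:
  assumes "m \<in> active n"
  shows "(P \<inter> {x. m \<bullet> x = of_int (h m)}) face_of P"
  by (rule face_of_Int_supporting_hyperplane_le[OF convex_P])
    (use assms in \<open>auto simp: active_def height_dual_def\<close>)

text \<open>The points where the inequality of \<open>m\<close> is an equality form a face. It meets the relative interior of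
  the facet \<open>\<tau>\<close>, so it contains \<open>\<tau>\<close>.\<close>

lemma facet_of_rel_interior_active:
  assumes \<tau>: "\<tau> \<in> facets P" and n: "n \<in> rel_interior \<tau>" and m: "m \<in> active n"
  shows "affine hull \<tau> = {x. m \<bullet> x = of_int (h m)}"
    and "\<tau> = P \<inter> {x. m \<bullet> x = of_int (h m)}"
proof -
  have F: "\<tau> facet_of P" using \<tau> by (simp add: facets_def)
  have sub: "\<tau> \<subseteq> P \<inter> {x. m \<bullet> x = of_int (h m)}"
  proof (rule subset_of_face_of[OF active_face[OF m]])
    show "\<tau> \<subseteq> P" using F facet_of_imp_subset by blast
    then show "P \<inter> {x. m \<bullet> x = of_int (h m)} \<inter> rel_interior \<tau> \<noteq> {}"
      using n m rel_interior_subset by (fastforce simp: active_def)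
  qed
  show hull: "affine hull \<tau> = {x. m \<bullet> x = of_int (h m)}"
    by (rule facet_affine_hull[OF _ F]) (use zero_interior_P m sub in \<open>auto simp: active_def\<close>)
  show "\<tau> = P \<inter> {x. m \<bullet> x = of_int (h m)}"
    using face_of_imp_eq_affine_Int[OF convex_P facet_of_imp_face_of[OF F]] hull by auto
qed

lemma rel_interior_facet_subset_B:
  assumes "\<tau> \<in> facets P"
  shows "rel_interior \<tau> \<subseteq> B"
proof -
  have F: "\<tau> facet_of P" using assms by (simp add: facets_def)
  then have "\<tau> \<noteq> P" by (auto simp: facet_of_def)
  then have "\<tau> \<inter> interior P = {}"
    using face_of_disjoint_interior facet_of_imp_face_of[OF F] by blast
  then show ?thesis
    using rel_interior_subset facet_of_imp_subset[OF F] closed_P by (fastforce simp: frontier_def)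
qed

text \<open>An inequality that is active at a boundary point close to \<open>n\<close> is active at \<open>n\<close> as well, and so its
  hyperplane is the affine hull of \<open>\<tau>\<close>.\<close>

lemma openin_rel_interior_facet:
  assumes \<tau>: "\<tau> \<in> facets P"
  shows "openin (top_of_set B) (rel_interior \<tau>)"
proof (rule openin_subopen[THEN iffD2], intro ballI)
  fix n assume n: "n \<in> rel_interior \<tau>"
  obtain T where T: "open T" "rel_interior \<tau> = affine hull \<tau> \<inter> T"
    using openin_rel_interior[of \<tau>] by (auto simp: openin_open)
  let ?S = "{x. \<forall>m\<in>\<Delta> \<inter> int_lattice - ({0} \<union> active n). m \<bullet> x < of_int (h m)}"
  have nB: "n \<in> B" using n rel_interior_facet_subset_B[OF \<tau>] by blast
  have "n \<in> ?S" using nB B_subset_P by (force simp: active_def mem_P order_le_less)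
  then have "n \<in> B \<inter> (T \<inter> ?S)" using n T(2) nB by blast
  moreover have "B \<inter> (T \<inter> ?S) \<subseteq> rel_interior \<tau>"
  proof
    fix x assume x: "x \<in> B \<inter> (T \<inter> ?S)"
    then obtain m where m: "m \<in> active x" using mem_B by blast
    then have mn: "m \<in> active n" using x by (force simp: active_def)
    then have "x \<in> affine hull \<tau>"
      using facet_of_rel_interior_active(1)[OF \<tau> n mn] m by (simp add: active_def)
    then show "x \<in> rel_interior \<tau>" using T(2) x by blast
  qed
  moreover have "openin (top_of_set B) (B \<inter> (T \<inter> ?S))"
    using T(1) open_strict_constraints by (intro openin_open_Int open_Int)
  ultimately show "\<exists>T. openin (top_of_set B) T \<and> n \<in> T \<and> T \<subseteq> rel_interior \<tau>" by blast
qed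

lemma closed_lower_skeleton: "closed (lower_skeleton \<Delta> h)"
proof -
  have "openin (top_of_set B) (\<Union>\<tau>\<in>facets P. rel_interior \<tau>)"
    using openin_rel_interior_facet by (intro openin_Union) auto
  then have "closedin (top_of_set B) (lower_skeleton \<Delta> h)"
    unfolding lower_skeleton_def by (intro closedin_diff) auto
  then show ?thesis using closedin_closed_trans frontier_closed by metis
qed

text \<open>If only one inequality were active at \<open>n\<close>, the polytope would be a half space near \<open>n\<close>, and \<open>n\<close> would
  be in the relative interior of a facet.\<close>

lemma lower_skeleton_two_active:
  assumes n: "n \<in> lower_skeleton \<Delta> h"
  obtains m1 m2 where "m1 \<in> active n" "m2 \<in> active n" "m1 \<noteq> m2"
proof (rule ccontr)
  assume no: "\<not> thesis"
  have nB: "n \<in> B" and nint: "\<And>\<tau>. \<tau> \<in> facets P \<Longrightarrow> n \<notin> rel_interior \<tau>"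
    using n by (auto simp: lower_skeleton_def)
  obtain m where m: "m \<in> active n" using nB mem_B by blast
  have single: "active n = {m}" using no that m by blast
  let ?H = "{x. m \<bullet> x = of_int (h m)}"
  let ?S = "{x. \<forall>m'\<in>\<Delta> \<inter> int_lattice - {0, m}. m' \<bullet> x < of_int (h m')}"
  have m0: "m \<noteq> 0" using m by (simp add: active_def)
  have nS: "n \<in> ?H \<inter> ?S"
    using nB B_subset_P m single by (force simp: active_def mem_P order_le_less)
  have S: "?H \<inter> ?S \<subseteq> P" by (force simp: mem_P)
  have oS: "open ?S" by (rule open_strict_constraints)
  have "?H = affine hull (?H \<inter> ?S)"
    using affine_hull_convex_Int_open[OF convex_hyperplane oS, of m "of_int (h m)"] nS
      affine_hull_eq[THEN iffD2, OF affine_hyperplane, of m "of_int (h m)"] by auto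
  also have "\<dots> \<subseteq> affine hull (P \<inter> ?H)" using S by (intro hull_mono) auto
  finally have hull: "affine hull (P \<inter> ?H) = ?H"
    using hull_minimal[of "P \<inter> ?H" ?H affine] affine_hyperplane[of m "of_int (h m)"] by auto
  have "aff_dim (P \<inter> ?H) = aff_dim ?H"
    using hull aff_dim_affine_hull[of "P \<inter> ?H"] by simp
  also have "\<dots> = aff_dim P - 1"
  proof -
    have "aff_dim P = DIM(real ^ 'k)"
      by (rule aff_dim_nonempty_interior) (use zero_interior_P in auto)
    then show ?thesis using m0 by simp
  qed
  finally have "P \<inter> ?H \<in> facets P"
    using active_face[OF m] nS S by (auto simp: facets_def facet_of_def)
  moreover have "n \<in> rel_interior (P \<inter> ?H)"
    unfolding mem_rel_interior hull using oS nS S by (intro exI[of _ ?S]) auto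
  ultimately show False using nint by blast
qed

end

section \<open>The chart of a facet\<close>

locale chart_bases = reflexive_height \<Delta> h
  for \<Delta> :: "(real ^ 'k::finite) set" and h :: "real ^ 'k \<Rightarrow> int" +
  fixes b :: "(real ^ 'k) set \<Rightarrow> 'd::finite \<Rightarrow> real ^ 'k"
  assumes card: "CARD('k) = CARD('d) + 1"
    and bases: "facet_bases \<Delta> b"

text \<open>The chart domain \<open>C\<close> is a graph over \<open>D\<close> in the direction \<open>v\<close>, which \<open>\<beta>\<close> contracts: the functionals
  of points of \<open>\<sigma>\<close> grow with slope one along \<open>v\<close>, those of the other lattice points do not grow. The map \<open>L\<close> is the
  adjoint of \<open>\<beta>\<close>.\<close>

locale facet_chart = chart_bases \<Delta> h b
  for \<Delta> :: "(real ^ 'k::finite) set" and h :: "real ^ 'k \<Rightarrow> int"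
    and b :: "(real ^ 'k) set \<Rightarrow> 'd::finite \<Rightarrow> real ^ 'k" +
  fixes \<sigma> :: "(real ^ 'k) set"
  assumes facet: "\<sigma> \<in> facets \<Delta>"
begin

abbreviation "v \<equiv> outward_normal \<Delta> \<sigma>"
abbreviation "C \<equiv> chart_domain \<Delta> h \<sigma>"
abbreviation "\<beta> \<equiv> beta b \<sigma>"
abbreviation "\<beta>i \<equiv> beta_inv \<Delta> h b \<sigma>"
abbreviation "D \<equiv> \<beta> ` C"
abbreviation "L \<equiv> lin_comb (b \<sigma>)"

lemma v_lattice: "v \<in> int_lattice"
  and inner_v_le: "m \<in> \<Delta> \<Longrightarrow> m \<bullet> v \<le> 1"
  and sigma_eq: "\<sigma> = \<Delta> \<inter> {m. m \<bullet> v = 1}"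
  by (metis reflexive_facet_normal[OF reflexive facet])+

lemma sigma_inner_v: "m \<in> \<sigma> \<Longrightarrow> m \<bullet> v = 1"
  using sigma_eq by auto

lemma sigma_subset: "\<sigma> \<subseteq> \<Delta>"
  using sigma_eq by auto

lemma ex_lattice_sigma: "\<exists>u\<in>\<sigma>. u \<in> int_lattice"
  by (metis reflexive_facet_normal[OF reflexive facet])

lemma lattice_inner_v_nonpos:
  assumes "m \<in> \<Delta> \<inter> int_lattice" "m \<notin> \<sigma>"
  shows "m \<bullet> v \<le> 0"
proof -
  obtain z where z: "m \<bullet> v = of_int z"
    using int_lattice_inner[OF _ v_lattice] assms(1) by (auto elim: Ints_cases)
  have "m \<bullet> v \<noteq> 1" using assms sigma_eq by auto
  then have "z \<noteq> 1" using z by auto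
  then have "z \<le> 0" using z inner_v_le[of m] assms(1) by auto
  then show ?thesis using z by simp
qed

lemma inj_L: "inj L"
  and range_L: "range L = {x. x \<bullet> v = 0}"
  and perp_basis: "(\<And>i. b \<sigma> i \<bullet> y = 0) \<Longrightarrow> \<exists>s. y = s *\<^sub>R v"
proof -
  obtain u where "u \<in> \<sigma>" using ex_lattice_sigma by blast
  then have u: "u \<bullet> v = 1" by (rule sigma_inner_v)
  have c: "int_basis {m \<in> int_lattice. m \<bullet> v = 0} (b \<sigma>)"
    using bases facet by (simp add: facet_bases_def)
  show "inj L" "range L = {x. x \<bullet> v = 0}"
    by (rule int_basis_normal_space[OF card v_lattice u c])+
  show "(\<And>i. b \<sigma> i \<bullet> y = 0) \<Longrightarrow> \<exists>s. y = s *\<^sub>R v"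
    using int_basis_normal_space(3)[OF card v_lattice u c, of y] by blast
qed

lemma L_inner: "L y \<bullet> n = y \<bullet> \<beta> n"
  by (simp add: lin_comb_inner beta_def)

lemma L_inner_v: "L y \<bullet> v = 0"
  using range_L by auto

lemma linear_beta: "linear \<beta>"
  by (rule linearI) (auto simp: beta_def vec_eq_iff inner_add_right)

lemma beta_add_v: "\<beta> (n + s *\<^sub>R v) = \<beta> n"
proof -
  have "b \<sigma> i \<bullet> v = 0" for i
    using bases facet by (auto simp: facet_bases_def int_basis_def)
  then show ?thesis by (simp add: beta_def vec_eq_iff inner_add_right)
qed

lemma beta_eq_fibre:
  assumes "\<beta> n = \<beta> n'"
  obtains s where "n' = n + s *\<^sub>R v"
proof -
  have "b \<sigma> i \<bullet> (n' - n) = 0" for i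
    using assms by (auto simp: beta_def vec_eq_iff inner_diff_right)
  then obtain s where "n' - n = s *\<^sub>R v" using perp_basis by blast
  then show ?thesis using that[of s] by (metis add.commute diff_add_cancel)
qed

lemma sigma_lattice_active:
  assumes "m \<in> \<sigma> \<inter> int_lattice" "m \<bullet> n = of_int (h m)"
  shows "m \<in> active n"
  using assms sigma_inner_v[of m] sigma_subset by (auto simp: active_def)

lemma mem_C: "n \<in> C \<longleftrightarrow> n \<in> P \<and> active n \<inter> \<sigma> \<noteq> {}"
  unfolding chart_domain_def tau_def
  using sigma_lattice_active by (auto simp: active_def)

lemma C_subset_B: "C \<subseteq> B"
  using mem_C mem_B by blast

lemma compact_C: "compact C"
proof -
  have "C = P \<inter> (\<Union>m\<in>\<sigma> \<inter> int_lattice. {n. m \<bullet> n = of_int (h m)})"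
    by (auto simp: chart_domain_def tau_def)
  moreover have "finite (\<sigma> \<inter> int_lattice)"
    using finite_lattice_points sigma_subset by (meson Int_mono finite_subset order_refl)
  ultimately show ?thesis
    using compact_P by (auto intro!: compact_Int_closed closed_UN closed_hyperplane)
qed

text \<open>Points with the same image differ by a multiple of \<open>v\<close>, and one cannot move up from \<open>C\<close> along \<open>v\<close>
  without violating an active inequality from \<open>\<sigma>\<close>.\<close>

lemma inj_on_beta: "inj_on \<beta> C"
proof -
  have nonneg: "s \<le> 0" if n: "n \<in> C" and n': "n + s *\<^sub>R v \<in> C" for n s
  proof -
    obtain m where m: "m \<in> active n" "m \<in> \<sigma>" using n mem_C by blast
    have "m \<bullet> (n + s *\<^sub>R v) \<le> of_int (h m)" using n' mem_C m by (auto simp: active_def mem_P)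
    then show ?thesis using m sigma_inner_v[of m] by (simp add: active_def inner_add_right)
  qed
  show ?thesis
  proof (rule inj_onI)
    fix n n' assume n: "n \<in> C" "n' \<in> C" and eq: "\<beta> n = \<beta> n'"
    obtain s where s: "n' = n + s *\<^sub>R v" using beta_eq_fibre[OF eq] .
    have "n = n' + (- s) *\<^sub>R v" using s by simp
    then have "s = 0" using nonneg[of n s] nonneg[of n' "- s"] n s by auto
    then show "n = n'" using s by simp
  qed
qed

lemma beta_inv_beta: "n \<in> C \<Longrightarrow> \<beta>i (\<beta> n) = n"
  unfolding beta_inv_def by (rule inv_into_f_f[OF inj_on_beta])

lemma beta_inv_mem: "y \<in> D \<Longrightarrow> \<beta>i y \<in> C"
  using beta_inv_beta by auto

lemma beta_beta_inv: "y \<in> D \<Longrightarrow> \<beta> (\<beta>i y) = y"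
  using beta_inv_beta by auto

lemma continuous_beta: "continuous_on S \<beta>"
  using linear_beta linear_continuous_on linear_conv_bounded_linear by blast

lemma compact_D: "compact D"
  by (rule compact_continuous_image[OF continuous_beta compact_C])

lemma continuous_beta_inv: "continuous_on D \<beta>i"
  by (rule continuous_on_inv[OF continuous_beta compact_C]) (simp add: beta_inv_beta)

text \<open>Move along \<open>v\<close> until the first inequality from \<open>\<sigma>\<close> becomes active.\<close>

lemma lift_to_C:
  assumes "n \<in> P"
  obtains s where "s \<ge> 0" "n + s *\<^sub>R v \<in> C"
proof -
  let ?S = "\<sigma> \<inter> int_lattice"
  have fin: "finite ?S"
    using finite_lattice_points sigma_subset by (meson Int_mono finite_subset order_refl)
  have ne: "?S \<noteq> {}" using ex_lattice_sigma by blast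
  define s where "s = Min ((\<lambda>m. of_int (h m) - m \<bullet> n) ` ?S)"
  have le: "s \<le> of_int (h m) - m \<bullet> n" if "m \<in> ?S" for m
    unfolding s_def using fin that by (intro Min_le) auto
  have "s \<in> (\<lambda>m. of_int (h m) - m \<bullet> n) ` ?S"
    unfolding s_def using fin ne by (intro Min_in) auto
  then obtain m where m: "m \<in> ?S" "s = of_int (h m) - m \<bullet> n" by blast
  have s0: "s \<ge> 0"
    using m assms sigma_subset by (auto simp: height_dual_def)
  have "n + s *\<^sub>R v \<in> P"
    unfolding mem_P
  proof (intro ballI impI)
    fix m' assume m': "m' \<in> \<Delta> \<inter> int_lattice" "m' \<noteq> 0"
    show "m' \<bullet> (n + s *\<^sub>R v) \<le> of_int (h m')"
    proof (cases "m' \<in> \<sigma>")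
      case True
      then show ?thesis using le[of m'] m' sigma_inner_v[of m'] by (simp add: inner_add_right)
    next
      case False
      then have "s * (m' \<bullet> v) \<le> 0"
        using lattice_inner_v_nonpos[OF m'(1)] s0 by (simp add: mult_nonneg_nonpos)
      then show ?thesis using assms m' by (fastforce simp: inner_add_right mem_P)
    qed
  qed
  moreover have "m \<bullet> (n + s *\<^sub>R v) = of_int (h m)"
    using m sigma_inner_v[of m] by (simp add: inner_add_right)
  ultimately have "n + s *\<^sub>R v \<in> C"
    using m mem_C sigma_lattice_active by blast
  then show ?thesis using that s0 by blast
qed

text \<open>This says that \<open>D\<close> is convex and that the height of the graph \<open>C\<close> over \<open>D\<close> is a concave function.\<close>

lemma segment_lift:
  assumes "y0 \<in> D" "y1 \<in> D" "0 \<le> t" "t \<le> 1"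
  obtains s where "s \<ge> 0" "(1 - t) *\<^sub>R y0 + t *\<^sub>R y1 \<in> D"
    "\<beta>i ((1 - t) *\<^sub>R y0 + t *\<^sub>R y1) = (1 - t) *\<^sub>R \<beta>i y0 + t *\<^sub>R \<beta>i y1 + s *\<^sub>R v"
proof -
  let ?n = "(1 - t) *\<^sub>R \<beta>i y0 + t *\<^sub>R \<beta>i y1"
  have "?n \<in> P"
    using convexD_alt[OF convex_P _ _ assms(3,4)] beta_inv_mem assms C_subset_B B_subset_P by blast
  then obtain s where s: "s \<ge> 0" "?n + s *\<^sub>R v \<in> C" using lift_to_C by blast
  have "\<beta> (?n + s *\<^sub>R v) = (1 - t) *\<^sub>R y0 + t *\<^sub>R y1"
    unfolding beta_add_v
    by (simp add: linear_add[OF linear_beta] linear_scale[OF linear_beta] beta_beta_inv assms)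
  then show ?thesis using that[of s] s beta_inv_beta[OF s(2)] by (metis imageI)
qed

text \<open>Suppose that an inequality from outside \<open>\<sigma>\<close> is active at \<open>n\<close>. Going down along \<open>v\<close> makes all
  inequalities from \<open>\<sigma>\<close> strict but does not decrease this one. A suitable contraction towards the
  origin brings one back to the boundary, at a point where no inequality from \<open>\<sigma>\<close> is active.\<close>

lemma active_subset_sigma:
  assumes U: "openin (top_of_set B) U" "U \<subseteq> C" and n: "n \<in> U"
  shows "active n \<subseteq> \<sigma>"
proof (rule ccontr)
  assume "\<not> active n \<subseteq> \<sigma>"
  then obtain m where m: "m \<in> active n" "m \<notin> \<sigma>" by blast
  have hpos: "0 < real_of_int (h m')" if "m' \<in> active n" for m'
    using height_pos that by (auto simp: active_def)
  let ?r = "\<lambda>m'. - (m' \<bullet> v) / of_int (h m')"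
  \<comment> \<open>The least rate of contraction that makes up for the motion along \<open>- v\<close> in all active inequalities.\<close>
  define c where "c = Max (?r ` active n)"
  have fin: "finite (active n)" by (rule finite_active)
  have cge: "?r m' \<le> c" if "m' \<in> active n" for m'
    unfolding c_def using fin that by (intro Max_ge) auto
  have "c \<in> ?r ` active n" unfolding c_def using fin m by (intro Max_in) auto
  then obtain m0 where m0: "m0 \<in> active n" "c = ?r m0" by blast
  have "m \<bullet> v \<le> 0" using m by (intro lattice_inner_v_nonpos) (auto simp: active_def)
  then have "0 \<le> ?r m" using hpos[OF m(1)] by (simp add: divide_nonpos_pos)
  then have c0: "c \<ge> 0" using cge[OF m(1)] by linarith
  let ?w = "- v - c *\<^sub>R n"
  have inner_w: "m' \<bullet> ?w = of_int (h m') * (?r m' - c)" if "m' \<in> active n" for m'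
    using hpos[OF that] that by (simp add: inner_diff_right active_def field_simps)
  have "\<forall>\<^sub>F e in at_right 0. n + e *\<^sub>R ?w \<in> U"
  proof (rule eventually_ray_in_open[OF U(1) n _ m0(1)])
    show "m' \<bullet> ?w \<le> 0" if "m' \<in> active n" for m'
      unfolding inner_w[OF that] using cge[OF that] hpos[OF that]
      by (simp add: mult_le_0_iff)
    show "m0 \<bullet> ?w = 0" unfolding inner_w[OF m0(1)] using m0(2) by simp
  qed
  moreover have "\<forall>\<^sub>F e in at_right 0. e * c < (1::real)"
  proof -
    have "((\<lambda>e. e * c) \<longlongrightarrow> 0 * c) (at_right 0)" by (intro tendsto_intros)
    from order_tendstoD(2)[OF this, of 1] show ?thesis by simp
  qed
  moreover have "\<forall>\<^sub>F e in at_right (0::real). 0 < e" by (rule eventually_at_right_less)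
  ultimately have "\<forall>\<^sub>F e in at_right (0::real). n + e *\<^sub>R ?w \<in> U \<and> e * c < 1 \<and> 0 < e"
    by (intro eventually_conj)
  then obtain e where e: "n + e *\<^sub>R ?w \<in> U" "e * c < 1" "0 < e"
    using eventually_happens'[OF trivial_limit_at_right_real] by blast
  obtain m' where m': "m' \<in> active (n + e *\<^sub>R ?w)" "m' \<in> \<sigma>" using e(1) U(2) mem_C by blast
  have "m' \<bullet> n \<le> of_int (h m')" using n U(2) mem_C m'(1) by (auto simp: active_def mem_P)
  then have "(1 - e * c) * (m' \<bullet> n) \<le> (1 - e * c) * of_int (h m')"
    using e by (intro mult_left_mono) auto
  moreover have "(1 - e * c) * of_int (h m') \<le> of_int (h m')"
    using e c0 height_pos[of m'] m'(1) by (auto simp: active_def mult_le_cancel_right1)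
  moreover have "m' \<bullet> (n + e *\<^sub>R ?w) = (1 - e * c) * (m' \<bullet> n) - e"
    using sigma_inner_v[OF m'(2)] by (simp add: inner_add_right inner_diff_right algebra_simps)
  moreover have "m' \<bullet> (n + e *\<^sub>R ?w) = of_int (h m')" using m'(1) by (simp add: active_def)
  ultimately show False using e(3) by linarith
qed

lemma outward_normal_mem_sigma:
  assumes U: "openin (top_of_set B) U" "U \<subseteq> C" and n: "n \<in> U"
    and \<tau>: "\<tau> \<in> facets P" "n \<in> rel_interior \<tau>"
  shows "outward_normal P \<tau> \<in> active n" "outward_normal P \<tau> \<in> \<sigma>"
proof -
  obtain m where m: "m \<in> active n" using rel_interior_facet_subset_B[OF \<tau>(1)] \<tau>(2) mem_B by blast
  then have ms: "m \<in> \<sigma>" using active_subset_sigma[OF U n] by blast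
  have "outward_normal P \<tau> = m"
  proof (rule outward_normal_eqI[OF zero_interior_P _ _ v_lattice])
    show "\<tau> facet_of P" using \<tau>(1) by (simp add: facets_def)
    show "\<tau> = P \<inter> {x. m \<bullet> x = of_int (h m)}"
      by (rule facet_of_rel_interior_active(2)[OF \<tau> m])
    show "P \<subseteq> {x. m \<bullet> x \<le> of_int (h m)}" using m by (auto simp: active_def height_dual_def)
  qed (use m ms sigma_inner_v in \<open>auto simp: active_def inner_commute\<close>)
  then show "outward_normal P \<tau> \<in> active n" "outward_normal P \<tau> \<in> \<sigma>" using m ms by auto
qed

end

section \<open>The lattice measure and relative boundaries of facets\<close>

context facet_chart
begin

lemma facet_subset_A: "\<sigma> \<subseteq> A"
proof -
  have F: "\<sigma> facet_of \<Delta>" using facet by (simp add: facets_def)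
  then have "\<sigma> \<noteq> \<Delta>" by (auto simp: facet_of_def)
  then have "\<sigma> \<inter> interior \<Delta> = {}"
    using face_of_disjoint_interior facet_of_imp_face_of[OF F] by blast
  then show ?thesis
    using sigma_subset closure_subset[of \<Delta>] by (auto simp: frontier_def)
qed

lemma closed_facet: "closed \<sigma>" and convex_facet: "convex \<sigma>"
proof -
  have "polytope \<sigma>"
    using face_of_polytope_polytope[OF polytope_Delta] facet by (auto simp: facets_def facet_of_def)
  then show "closed \<sigma>" "convex \<sigma>" by (auto simp: polytope_imp_closed polytope_imp_convex)
qed

text \<open>If \<open>\<sigma>\<close> met the relative interior of \<open>\<sigma>'\<close>, it would contain \<open>\<sigma>'\<close> as a proper face, although facets
  have the same dimension.\<close>

lemma facet_disjoint_rel_interior: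
  assumes "\<sigma>' \<in> facets \<Delta>" "\<sigma>' \<noteq> \<sigma>"
  shows "\<sigma> \<inter> rel_interior \<sigma>' = {}"
proof (rule ccontr)
  assume ne: "\<sigma> \<inter> rel_interior \<sigma>' \<noteq> {}"
  have F: "\<sigma> facet_of \<Delta>" "\<sigma>' facet_of \<Delta>" using facet assms(1) by (auto simp: facets_def)
  have sub: "\<sigma>' \<subseteq> \<sigma>"
    by (rule subset_of_face_of[OF facet_of_imp_face_of[OF F(1)] facet_of_imp_subset[OF F(2)] ne])
  have "\<sigma>' face_of \<sigma>"
    using face_of_face[OF facet_of_imp_face_of[OF F(1)]] facet_of_imp_face_of[OF F(2)] sub by blast
  then have "aff_dim \<sigma>' < aff_dim \<sigma>"
    using face_of_aff_dim_lt[OF convex_facet] assms(2) by blast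
  then show False using F by (simp add: facet_of_def)
qed

lemma facet_param_lin_comb: "facet_param b \<sigma> y = (SOME m. m \<in> \<sigma>) + L y"
  by (simp add: facet_param_def lin_comb_def)

lemma some_mem_facet: "(SOME m. m \<in> \<sigma>) \<in> \<sigma>"
  using ex_lattice_sigma someI_ex[of "\<lambda>m. m \<in> \<sigma>"] by blast

lemma bounded_facet_param_vimage:
  assumes "bounded S"
  shows "bounded (facet_param b \<sigma> -` S)"
proof -
  obtain c where c: "c > 0" "\<And>y. c * norm y \<le> norm (L y)"
    using linear_inj_bounded_below_pos[OF linear_lin_comb inj_L] by metis
  obtain K where K: "\<And>x. x \<in> S \<Longrightarrow> norm x \<le> K" using assms by (auto simp: bounded_iff)
  let ?m = "SOME m. m \<in> \<sigma>"
  have "norm y \<le> (K + norm ?m) / c" if "facet_param b \<sigma> y \<in> S" for y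
  proof -
    have "norm (L y) \<le> norm (?m + L y) + norm ?m"
      using norm_triangle_ineq4[of "?m + L y" ?m] by simp
    also have "\<dots> \<le> K + norm ?m" using K that by (simp add: facet_param_lin_comb)
    finally show ?thesis using c(1) c(2)[of y] by (simp add: pos_le_divide_eq mult.commute)
  qed
  then show ?thesis by (auto simp: bounded_iff)
qed

lemma negligible_facet_boundary_preimage:
  assumes "m \<in> \<sigma>"
  shows "negligible {y. m + L y \<in> \<sigma> - rel_interior \<sigma>}"
  by (rule negligible_relative_boundary_preimage[OF inj_L range_L convex_facet])
    (use assms sigma_inner_v in auto)

end

context chart_bases
begin

lemma facet_chartI: "\<sigma> \<in> facets \<Delta> \<Longrightarrow> facet_chart \<Delta> h b \<sigma>"
  by (intro facet_chart.intro facet_chart_axioms.intro chart_bases_axioms)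

lemma finite_mu_M: "emeasure (mu_M \<Delta> b) A < \<infinity>"
proof -
  have "emeasure (mu_M \<Delta> b) A =
      (\<Sum>\<sigma>\<in>facets \<Delta>. emeasure lborel (facet_param b \<sigma> -` (A \<inter> \<sigma>)))"
    using polytope_Delta by (intro emeasure_mu_M) (auto intro: borel_closed)
  also have "\<dots> < \<infinity>"
  proof -
    have "emeasure lborel (facet_param b \<sigma> -` (A \<inter> \<sigma>)) < \<infinity>" if "\<sigma> \<in> facets \<Delta>" for \<sigma>
      by (intro emeasure_bounded_finite facet_chart.bounded_facet_param_vimage[OF facet_chartI[OF that]])
        (use compact_A compact_imp_bounded bounded_Int in blast)
    moreover have "finite (facets \<Delta>)"
      using finite_polytope_facets[OF polytope_Delta] by (simp add: facets_def)
    ultimately show ?thesis by (simp add: ennreal_sum_less_top)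
  qed
  finally show ?thesis .
qed

text \<open>On another facet \<open>\<tau>\<close>, the set \<open>\<sigma> \<inter> \<tau>\<close> lies in the relative boundary of \<open>\<tau>\<close>, so each of the summands
  of \<open>mu_M\<close> is the volume of a null set.\<close>

lemma mu_M_facet_boundary:
  assumes \<sigma>: "\<sigma> \<in> facets \<Delta>"
  shows "\<sigma> - rel_interior \<sigma> \<in> null_sets (mu_M \<Delta> b)"
proof -
  interpret s: facet_chart \<Delta> h b \<sigma> by (rule facet_chartI[OF \<sigma>])
  let ?E = "\<sigma> - rel_interior \<sigma>"
  have "?E = rel_frontier \<sigma>" using s.closed_facet by (simp add: rel_frontier_def)
  then have cl: "closed ?E" using closed_rel_frontier by metis
  have E: "?E \<in> sets borel" "?E \<subseteq> A" using cl s.facet_subset_A by auto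
  have "emeasure lborel (facet_param b \<tau> -` (?E \<inter> \<tau>)) = 0" if \<tau>: "\<tau> \<in> facets \<Delta>" for \<tau>
  proof -
    interpret t: facet_chart \<Delta> h b \<tau> by (rule facet_chartI[OF \<tau>])
    have "?E \<inter> \<tau> \<subseteq> \<tau> - rel_interior \<tau>"
      using s.facet_disjoint_rel_interior[OF \<tau>] by blast
    then have "facet_param b \<tau> -` (?E \<inter> \<tau>) \<subseteq>
        {y. (SOME m. m \<in> \<tau>) + lin_comb (b \<tau>) y \<in> \<tau> - rel_interior \<tau>}"
      by (auto simp: t.facet_param_lin_comb)
    then have "negligible (facet_param b \<tau> -` (?E \<inter> \<tau>))"
      using t.negligible_facet_boundary_preimage[OF t.some_mem_facet] negligible_subset by blast
    moreover have "closed (facet_param b \<tau> -` (?E \<inter> \<tau>))"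
      unfolding facet_param_def
      by (intro closed_vimage closed_Int cl t.closed_facet continuous_intros)
    ultimately show ?thesis
      by (simp add: negligible_iff_emeasure0 borel_closed)
  qed
  then have "emeasure (mu_M \<Delta> b) ?E = 0"
    using emeasure_mu_M[OF polytope_Delta E, of b] by simp
  then show ?thesis using E by (simp add: null_sets_def sets_restrict_space_iff)
qed

end

section \<open>Transforms and contact points\<close>

text \<open>The supremum in a \<open>c\<close>-transform is attained. As a supremum of affine functions the transform is
  convex on the whole space, hence continuous.\<close>

lemma
  fixes S :: "(real ^ 'k::finite) set"
  assumes S: "compact S" "S \<noteq> {}" and f: "continuous_on S f"
  shows c_transform_upper: "y \<in> S \<Longrightarrow> x \<bullet> y - f y \<le> c_transform S f x"
    and c_transform_attained: "\<exists>y\<in>S. c_transform S f x = x \<bullet> y - f y"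
    and c_transform_le_iff: "c_transform S f x \<le> z \<longleftrightarrow> (\<forall>y\<in>S. x \<bullet> y - f y \<le> z)"
    and continuous_c_transform: "continuous_on T (c_transform S f)"
proof -
  have att: "\<exists>y\<in>S. \<forall>z\<in>S. x \<bullet> z - f z \<le> x \<bullet> y - f y" for x
    by (rule continuous_attains_sup[OF S]) (intro continuous_intros f)
  then have bdd: "bdd_above ((\<lambda>y. x \<bullet> y - f y) ` S)" for x by (auto simp: bdd_above_def)
  show upper: "x \<bullet> y - f y \<le> c_transform S f x" if "y \<in> S" for x y
    unfolding c_transform_def by (rule cSUP_upper[OF that bdd])
  show attained: "\<exists>y\<in>S. c_transform S f x = x \<bullet> y - f y" for x
  proof -
    obtain y where y: "y \<in> S" "\<forall>z\<in>S. x \<bullet> z - f z \<le> x \<bullet> y - f y" using att by blast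
    then have "c_transform S f x \<le> x \<bullet> y - f y"
      unfolding c_transform_def by (intro cSUP_least) (use S in auto)
    then show ?thesis using upper[OF y(1), of x] y(1) by (intro bexI[of _ y]) auto
  qed
  show "c_transform S f x \<le> z \<longleftrightarrow> (\<forall>y\<in>S. x \<bullet> y - f y \<le> z)" for x z
    using upper attained by (metis order_trans)
  have "convex_on UNIV (c_transform S f)"
  proof (rule convex_onI)
    fix t x x' assume t: "0 < t" "t < (1::real)"
    obtain y where y: "y \<in> S"
      "c_transform S f ((1 - t) *\<^sub>R x + t *\<^sub>R x') = ((1 - t) *\<^sub>R x + t *\<^sub>R x') \<bullet> y - f y"
      using attained by blast
    have "((1 - t) *\<^sub>R x + t *\<^sub>R x') \<bullet> y - f y = (1 - t) * (x \<bullet> y - f y) + t * (x' \<bullet> y - f y)"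
      by (simp add: inner_add_left algebra_simps)
    also have "\<dots> \<le> (1 - t) * c_transform S f x + t * c_transform S f x'"
      using upper[OF y(1)] t by (intro add_mono mult_left_mono) auto
    finally show "c_transform S f ((1 - t) *\<^sub>R x + t *\<^sub>R x') \<le>
        (1 - t) * c_transform S f x + t * c_transform S f x'" using y(2) by simp
  qed auto
  then show "continuous_on T (c_transform S f)"
    using convex_on_continuous[OF open_UNIV] continuous_on_subset by blast
qed

text \<open>The two properties of a Kantorovich potential that do not involve measures.\<close>

locale potential = reflexive_height \<Delta> h
  for \<Delta> :: "(real ^ 'k::finite) set" and h :: "real ^ 'k \<Rightarrow> int" +
  fixes \<Psi> :: "real ^ 'k \<Rightarrow> real"
  assumes convex_Psi: "convex_on UNIV \<Psi>"
    and Psi_extension: "\<And>n. \<Psi> n = (SUP m\<in>frontier \<Delta>. m \<bullet> n - c_transform (frontier (height_dual \<Delta> h)) \<Psi> m)"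
begin

abbreviation "\<Phi> \<equiv> c_transform B \<Psi>"

text \<open>These are the \<open>m \<in> A\<close> with \<open>n \<in> \<partial>\<^sup>c\<Psi>\<^sup>c(m)\<close>, see \<open>c_subgradient_iff_contact\<close>, written so that they make
  sense for \<open>n\<close> outside \<open>B\<close> too.\<close>

definition contacts :: "real ^ 'k \<Rightarrow> (real ^ 'k) set" where
  "contacts n = {m \<in> A. \<Psi> n = m \<bullet> n - \<Phi> m}"

lemma continuous_Psi: "continuous_on S \<Psi>"
  using convex_on_continuous[OF open_UNIV convex_Psi] continuous_on_subset by blast

lemma A_nonempty: "A \<noteq> {}" and B_nonempty: "B \<noteq> {}"
  using frontier_eq_empty[of \<Delta>] zero_interior_Delta frontier_eq_empty[of P] zero_interior_P
    polytope_imp_bounded[OF polytope_Delta] bounded_P not_bounded_UNIV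
  by fastforce+

lemma continuous_Phi: "continuous_on S \<Phi>"
  by (rule continuous_c_transform[OF compact_B B_nonempty continuous_Psi])

lemma Psi_eq_transform: "\<Psi> n = c_transform A \<Phi> n"
  using Psi_extension[of n] by (simp add: c_transform_def inner_commute)

lemma Psi_ge: "m \<in> A \<Longrightarrow> m \<bullet> n - \<Phi> m \<le> \<Psi> n"
  using c_transform_upper[OF compact_A A_nonempty continuous_Phi, of m n] Psi_eq_transform
  by (simp add: inner_commute)

lemma contacts_nonempty: "contacts n \<noteq> {}"
  using c_transform_attained[OF compact_A A_nonempty continuous_Phi, of n] Psi_eq_transform
  by (auto simp: contacts_def inner_commute)

lemma Psi_ge_contact: "m \<in> contacts n \<Longrightarrow> \<Psi> x \<ge> \<Psi> n + m \<bullet> (x - n)"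
  using Psi_ge[of m x] by (auto simp: contacts_def inner_diff_right)

lemma c_subgradient_iff_contact:
  assumes "m \<in> A"
  shows "n \<in> c_subgradient \<Delta> h \<Psi> m \<longleftrightarrow> n \<in> B \<and> m \<in> contacts n"
proof -
  have "(\<forall>m'\<in>A. \<Phi> m' \<ge> \<Phi> m + (m' - m) \<bullet> n) \<longleftrightarrow> c_transform A \<Phi> n \<le> m \<bullet> n - \<Phi> m"
    unfolding c_transform_le_iff[OF compact_A A_nonempty continuous_Phi]
    by (intro ball_cong refl) (auto simp: inner_diff_left inner_commute[of n])
  also have "\<dots> \<longleftrightarrow> m \<in> contacts n"
    using Psi_ge[OF assms, of n] assms Psi_eq_transform[of n] by (auto simp: contacts_def)
  finally show ?thesis by (auto simp: c_subgradient_def Let_def)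
qed

lemma mem_potential_charts:
  "n \<in> potential_charts \<Delta> h \<Psi> \<sigma> \<longleftrightarrow> n \<in> B \<and> contacts n \<subseteq> rel_interior \<sigma>"
  using c_subgradient_iff_contact unfolding potential_charts_def by (auto simp: contacts_def)

end

section \<open>Mass of the target measure against mass of the contact points\<close>

lemma integrable_continuous_on_compact_space:
  fixes f :: "'a::{t2_space, second_countable_topology} \<Rightarrow> real"
  assumes "finite_measure M" "sets M = sets (restrict_space borel S)" "compact S" "continuous_on S f"
  shows "integrable M f"
proof -
  interpret finite_measure M by fact
  have sp: "space M = S"
    using sets_eq_imp_space_eq[OF assms(2)] by (simp add: space_restrict_space)
  obtain K where K: "\<And>x. x \<in> S \<Longrightarrow> norm (f x) \<le> K"
    using compact_imp_bounded[OF compact_continuous_image[OF assms(4,3)]] by (auto simp: bounded_iff)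
  show ?thesis
  proof (rule integrable_const_bound)
    show "AE x in M. norm (f x) \<le> K" using K sp by (intro AE_I2) auto
    show "f \<in> borel_measurable M"
      using borel_measurable_continuous_on_restrict[OF assms(4)]
      by (simp add: measurable_cong_sets[OF assms(2) refl])
  qed
qed

locale kantorovich = chart_bases \<Delta> h b + potential \<Delta> h \<Psi>
  for \<Delta> :: "(real ^ 'k::finite) set" and h :: "real ^ 'k \<Rightarrow> int"
    and b :: "(real ^ 'k) set \<Rightarrow> 'd::finite \<Rightarrow> real ^ 'k"
    and \<Psi> :: "real ^ 'k \<Rightarrow> real" +
  fixes \<nu> :: "(real ^ 'k) measure"
  assumes sets_nu: "sets \<nu> = sets (restrict_space borel (frontier (height_dual \<Delta> h)))"
    and mass_nu: "emeasure \<nu> (frontier (height_dual \<Delta> h)) = emeasure (mu_M \<Delta> b) (frontier \<Delta>)"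
    and maximal: "\<And>\<Psi>'. c_convex_on (frontier \<Delta>) (frontier (height_dual \<Delta> h)) \<Psi>' \<Longrightarrow>
      kantorovich_functional \<Delta> h b \<nu> \<Psi>' \<le> kantorovich_functional \<Delta> h b \<nu> \<Psi>"
begin

abbreviation "\<mu> \<equiv> mu_M \<Delta> b"

lemma finite_measure_mu: "finite_measure \<mu>"
  using finite_mu_M by (intro finite_measureI) simp

lemma space_nu: "space \<nu> = B"
  using sets_eq_imp_space_eq[OF sets_nu] by (simp add: space_restrict_space)

lemma finite_measure_nu: "finite_measure \<nu>"
  using finite_mu_M mass_nu by (intro finite_measureI) (simp add: space_nu)

lemma sets_nu_iff: "E \<in> sets \<nu> \<longleftrightarrow> E \<in> sets borel \<and> E \<subseteq> B"
  unfolding sets_nu by (subst sets_restrict_space_iff) (auto intro: borel_closed)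

lemma integrable_mu: "continuous_on UNIV f \<Longrightarrow> integrable \<mu> f" for f :: "real ^ 'k \<Rightarrow> real"
  by (rule integrable_continuous_on_compact_space[OF finite_measure_mu sets_mu_M compact_A])
    (auto intro: continuous_on_subset)

lemma integrable_nu: "continuous_on UNIV f \<Longrightarrow> integrable \<nu> f" for f :: "real ^ 'k \<Rightarrow> real"
  by (rule integrable_continuous_on_compact_space[OF finite_measure_nu sets_nu compact_B])
    (auto intro: continuous_on_subset)

text \<open>Compare the maximiser \<open>\<Psi>\<close> with the \<open>c\<close>-convex function \<open>\<Psi>'\<close> obtained from \<open>g = \<Psi> - \<epsilon> \<eta>\<close> by two
  transforms. The second integral of the functional gains at least \<open>\<epsilon>\<close> times the integral of \<open>\<eta>\<close>, as
  \<open>\<Psi>' \<le> g\<close>. The first one loses at most \<open>\<epsilon>\<close> at a point \<open>m\<close>, and it loses nothing unless \<open>m\<close> is within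
  \<open>\<epsilon>\<close> of being a contact point of some \<open>n\<close> with \<open>\<eta> n > 0\<close>.\<close>

lemma perturbation_bound:
  assumes \<eta>: "continuous_on UNIV \<eta>" "\<And>n. 0 \<le> \<eta> n" "\<And>n. \<eta> n \<le> (1::real)" and \<epsilon>: "\<epsilon> > 0"
    and S: "S \<in> sets \<mu>" "\<And>m n. m \<in> A \<Longrightarrow> n \<in> B \<Longrightarrow> \<eta> n > 0 \<Longrightarrow> \<Phi> m - \<epsilon> \<le> m \<bullet> n - \<Psi> n \<Longrightarrow> m \<in> S"
  shows "(LINT n|\<nu>. \<eta> n) \<le> measure \<mu> S"
proof -
  interpret mu: finite_measure \<mu> by (rule finite_measure_mu)
  define g where "g n = \<Psi> n - \<epsilon> * \<eta> n" for n
  define \<phi> where "\<phi> = c_transform B g"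
  define \<Psi>' where "\<Psi>' = c_transform A \<phi>"
  have cg: "continuous_on T g" for T
    unfolding g_def
    by (intro continuous_intros continuous_Psi continuous_on_subset[OF \<eta>(1)]) auto
  have c\<phi>: "continuous_on T \<phi>" for T
    unfolding \<phi>_def by (rule continuous_c_transform[OF compact_B B_nonempty cg])
  have c\<Psi>': "continuous_on T \<Psi>'" for T
    unfolding \<Psi>'_def by (rule continuous_c_transform[OF compact_A A_nonempty c\<phi>])
  have cc: "continuous_on T (c_transform B \<Psi>')" for T
    by (rule continuous_c_transform[OF compact_B B_nonempty c\<Psi>'])
  have le_g: "\<Psi>' n \<le> g n" if "n \<in> B" for n
    unfolding \<Psi>'_def c_transform_le_iff[OF compact_A A_nonempty c\<phi>]
  proof
    fix m assume "m \<in> A"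
    show "n \<bullet> m - \<phi> m \<le> g n"
      using c_transform_upper[OF compact_B B_nonempty cg that, of m]
      by (simp add: \<phi>_def inner_commute)
  qed
  have le_\<phi>: "c_transform B \<Psi>' m \<le> \<phi> m" if "m \<in> A" for m
    unfolding c_transform_le_iff[OF compact_B B_nonempty c\<Psi>']
  proof
    fix n assume "n \<in> B"
    show "m \<bullet> n - \<Psi>' n \<le> \<phi> m"
      using c_transform_upper[OF compact_A A_nonempty c\<phi> that, of n]
      by (simp add: \<Psi>'_def inner_commute)
  qed
  have "c_convex_on A B \<Psi>'"
    unfolding c_convex_on_def \<Psi>'_def using c\<phi> by blast
  from maximal[OF this]
  have "(LINT m|\<mu>. \<Phi> m) + (LINT n|\<nu>. \<Psi> n) \<le> (LINT m|\<mu>. c_transform B \<Psi>' m) + (LINT n|\<nu>. \<Psi>' n)"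
    by (simp add: kantorovich_functional_def)
  also have "(LINT m|\<mu>. c_transform B \<Psi>' m) \<le> (LINT m|\<mu>. \<phi> m)"
    by (intro integral_mono integrable_mu cc c\<phi>) (use le_\<phi> in simp)
  also have "(LINT n|\<nu>. \<Psi>' n) \<le> (LINT n|\<nu>. g n)"
    by (intro integral_mono integrable_nu c\<Psi>' cg) (use le_g space_nu in simp)
  also have "(LINT n|\<nu>. g n) = (LINT n|\<nu>. \<Psi> n) - \<epsilon> * (LINT n|\<nu>. \<eta> n)"
    unfolding g_def using integrable_nu[OF continuous_Psi] integrable_nu[OF \<eta>(1)] by simp
  finally have "\<epsilon> * (LINT n|\<nu>. \<eta> n) \<le> (LINT m|\<mu>. \<phi> m) - (LINT m|\<mu>. \<Phi> m)" by simp
  also have "\<dots> = (LINT m|\<mu>. \<phi> m - \<Phi> m)"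
    by (rule Bochner_Integration.integral_diff[symmetric]) (intro integrable_mu c\<phi> continuous_Phi)+
  also have "\<dots> \<le> (LINT m|\<mu>. \<epsilon> * indicator S m)"
  proof (intro integral_mono)
    show "integrable \<mu> (\<lambda>m. \<phi> m - \<Phi> m)"
      by (intro integrable_mu continuous_on_diff c\<phi> continuous_Phi)
    show "integrable \<mu> (\<lambda>m. \<epsilon> * indicator S m)"
      using mu.emeasure_finite[of S]
      by (intro integrable_mult_right integrable_real_indicator S(1)) (simp add: less_top[symmetric])
    fix m assume "m \<in> space \<mu>"
    then have m: "m \<in> A" by simp
    obtain n where n: "n \<in> B" "\<phi> m = m \<bullet> n - g n"
      unfolding \<phi>_def using c_transform_attained[OF compact_B B_nonempty cg] by blast
    have up: "m \<bullet> n - \<Psi> n \<le> \<Phi> m"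
      by (rule c_transform_upper[OF compact_B B_nonempty continuous_Psi n(1)])
    have e1: "\<epsilon> * \<eta> n \<le> \<epsilon>" using \<epsilon> \<eta>(3)[of n] by simp
    show "\<phi> m - \<Phi> m \<le> \<epsilon> * indicator S m"
    proof (cases "m \<in> S")
      case True
      then show ?thesis using n(2) up e1 by (simp add: g_def)
    next
      case False
      then have "\<eta> n = 0 \<or> m \<bullet> n - \<Psi> n < \<Phi> m - \<epsilon>"
        using S(2)[OF m n(1)] \<eta>(2)[of n] by linarith
      then show ?thesis using False n(2) up e1 by (auto simp: g_def)
    qed
  qed
  also have "\<dots> = \<epsilon> * measure \<mu> S" using S(1) sets.sets_into_space[OF S(1)] by (simp add: Int_absorb2)
  finally show ?thesis using \<epsilon> by simp
qed

text \<open>Apply the perturbation bound to functions \<open>\<eta>\<close> that are one on \<open>K\<close> and supported in shrinking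
  neighbourhoods of \<open>K\<close>, with \<open>\<epsilon>\<close> tending to zero. The sets \<open>S j\<close> of almost-contact points decrease, and
  by compactness their intersection consists of contact points of \<open>K\<close>.\<close>

lemma null_if_contacts_null:
  assumes K: "compact K" "K \<subseteq> B"
    and Z: "Z \<in> null_sets \<mu>" "\<And>n. n \<in> K \<Longrightarrow> contacts n \<subseteq> Z"
  shows "emeasure \<nu> K = 0"
proof (cases "K = {}")
  case False
  interpret mu: finite_measure \<mu> by (rule finite_measure_mu)
  interpret nu: finite_measure \<nu> by (rule finite_measure_nu)
  define r where "r j = inverse (real (Suc j))" for j
  have r: "r j > 0" for j by (simp add: r_def)
  define F where "F m j = {n \<in> B. infdist n K \<le> r j \<and> \<Phi> m - r j \<le> m \<bullet> n - \<Psi> n}" for m j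
  define S where "S j = {m \<in> A. F m j \<noteq> {}}" for j
  have anti: "r j \<le> r i" if "i \<le> j" for i j using that by (simp add: r_def field_simps)
  have F_anti: "F m j \<subseteq> F m i" if "i \<le> j" for m i j
    using anti[OF that] by (auto simp: F_def)
  have clF: "closed {n. infdist n K \<le> r j \<and> \<Phi> m - r j \<le> m \<bullet> n - \<Psi> n}" for m j
    by (intro closed_Collect_conj closed_Collect_le continuous_on_diff continuous_on_inner
        continuous_on_infdist continuous_on_const continuous_on_id continuous_Psi)
  have compF: "compact (F m j)" for m j
  proof -
    have "F m j = B \<inter> {n. infdist n K \<le> r j \<and> \<Phi> m - r j \<le> m \<bullet> n - \<Psi> n}"
      unfolding F_def by blast
    then show ?thesis using compact_Int_closed[OF compact_B clF] by simp
  qed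
  have clS: "closed (S j)" for j
  proof -
    let ?T = "{w. infdist (fst w) K \<le> r j \<and> \<Phi> (snd w) - r j \<le> snd w \<bullet> fst w - \<Psi> (fst w)}"
    have "closed ?T"
      by (intro closed_Collect_conj closed_Collect_le continuous_on_diff continuous_on_inner
          continuous_on_infdist continuous_on_const continuous_on_fst continuous_on_snd
          continuous_on_id continuous_on_compose2[OF continuous_Psi[of UNIV]]
          continuous_on_compose2[OF continuous_Phi[of UNIV]] subset_UNIV)
    then have T: "closed {m. \<exists>n. n \<in> B \<and> (n, m) \<in> ?T}"
      by (rule closed_compact_projection[OF compact_B])
    have "closed (A \<inter> {m. \<exists>n. n \<in> B \<and> (n, m) \<in> ?T})" by (rule closed_Int[OF frontier_closed T])
    moreover have "S j = A \<inter> {m. \<exists>n. n \<in> B \<and> (n, m) \<in> ?T}" unfolding S_def F_def by auto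
    ultimately show ?thesis by simp
  qed
  have Sm: "S j \<in> sets \<mu>" for j
    using clS by (auto simp: sets_restrict_space_iff S_def intro: borel_closed)
  have le: "measure \<nu> K \<le> measure \<mu> (S j)" for j
  proof -
    define \<eta> where "\<eta> n = max 0 (1 - infdist n K / r j)" for n
    have c\<eta>: "continuous_on UNIV \<eta>" unfolding \<eta>_def
      by (intro continuous_intros) (use r in \<open>simp add: less_imp_neq[THEN not_sym]\<close>)
    have "measure \<nu> K = (LINT n|\<nu>. indicator K n)"
      using K space_nu by (simp add: Int_absorb2)
    also have "\<dots> \<le> (LINT n|\<nu>. \<eta> n)"
    proof (rule integral_mono)
      show "integrable \<nu> \<eta>" by (rule integrable_nu[OF c\<eta>])
      have "K \<in> sets \<nu>" using K by (simp add: sets_nu_iff compact_imp_closed borel_closed)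
      then show "integrable \<nu> (indicator K :: _ \<Rightarrow> real)"
        using nu.emeasure_finite[of K] by (intro integrable_real_indicator) (simp_all add: less_top[symmetric])
      show "indicator K n \<le> \<eta> n" for n by (cases "n \<in> K") (auto simp: \<eta>_def)
    qed
    also have "\<dots> \<le> measure \<mu> (S j)"
    proof (rule perturbation_bound[OF c\<eta> _ _ r Sm])
      show "0 \<le> \<eta> n" "\<eta> n \<le> 1" for n
        using r[of j] infdist_nonneg[of n K] by (auto simp: \<eta>_def)
      fix m n assume mn: "m \<in> A" "n \<in> B" "\<eta> n > 0" "\<Phi> m - r j \<le> m \<bullet> n - \<Psi> n"
      then have "infdist n K / r j < 1" by (simp add: \<eta>_def less_max_iff_disj)
      then have "infdist n K \<le> r j" using r[of j] by (simp add: pos_divide_less_eq)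
      then show "m \<in> S j" using mn by (auto simp: S_def F_def)
    qed
    finally show ?thesis .
  qed
  have "(\<Inter>j. S j) \<subseteq> Z"
  proof
    fix m assume m: "m \<in> (\<Inter>j. S j)"
    then have mA: "m \<in> A" by (auto simp: S_def)
    have "\<Inter>(range (F m)) \<noteq> {}"
      by (rule compact_nest[OF compF _ F_anti]) (use m in \<open>auto simp: S_def\<close>)
    then obtain n where n: "\<And>j. n \<in> F m j" by blast
    have lim: "r \<longlonglongrightarrow> 0" unfolding r_def by (rule LIMSEQ_inverse_real_of_nat)
    have "infdist n K \<le> 0"
      by (rule LIMSEQ_le_const[OF lim]) (use n in \<open>auto simp: F_def\<close>)
    then have nK: "n \<in> K"
      using in_closed_iff_infdist_zero[OF compact_imp_closed[OF K(1)] False] infdist_nonneg[of n K]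
      by (metis order_antisym)
    have "\<Phi> m - (m \<bullet> n - \<Psi> n) \<le> 0"
    proof (rule LIMSEQ_le_const[OF lim], intro exI allI impI)
      fix j :: nat
      show "\<Phi> m - (m \<bullet> n - \<Psi> n) \<le> r j" using n[of j] by (simp add: F_def)
    qed
    then have "\<Psi> n \<le> m \<bullet> n - \<Phi> m" by simp
    then have "m \<in> contacts n" using Psi_ge[OF mA, of n] mA by (auto simp: contacts_def)
    then show "m \<in> Z" using Z(2)[OF nK] by blast
  qed
  then have "measure \<mu> (\<Inter>j. S j) \<le> measure \<mu> Z"
    using Z(1) by (intro mu.finite_measure_mono) auto
  then have zero: "measure \<mu> (\<Inter>j. S j) \<le> 0" using Z(1) by (simp add: measure_def null_setsD1)
  have "decseq S" unfolding decseq_def using F_anti by (fastforce simp: S_def)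
  then have "(\<lambda>j. measure \<mu> (S j)) \<longlonglongrightarrow> measure \<mu> (\<Inter>j. S j)"
    using Sm by (intro mu.finite_Lim_measure_decseq) auto
  then have "measure \<nu> K \<le> measure \<mu> (\<Inter>j. S j)"
    by (rule LIMSEQ_le_const) (use le in blast)
  then have "measure \<nu> K = 0" using zero measure_nonneg[of \<nu> K] by linarith
  then show ?thesis using nu.emeasure_eq_measure[of K] by simp
qed simp

end

section \<open>The potential in a chart\<close>

locale facet_potential = facet_chart \<Delta> h b \<sigma> + potential \<Delta> h \<Psi>
  for \<Delta> :: "(real ^ 'k::finite) set" and h :: "real ^ 'k \<Rightarrow> int"
    and b :: "(real ^ 'k) set \<Rightarrow> 'd::finite \<Rightarrow> real ^ 'k" and \<sigma> :: "(real ^ 'k) set"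
    and \<Psi> :: "real ^ 'k \<Rightarrow> real"
begin

definition chart_fun :: "real ^ 'k \<Rightarrow> real ^ 'd \<Rightarrow> real" where
  "chart_fun m y = \<Psi> (\<beta>i y) - m \<bullet> \<beta>i y"

text \<open>\<open>\<Psi>\<close> is a supremum of affine functions with slopes in \<open>\<Delta>\<close>, which are at most one along \<open>v\<close>.\<close>

lemma Psi_add_v: "s \<ge> 0 \<Longrightarrow> \<Psi> (x + s *\<^sub>R v) \<le> \<Psi> x + s"
proof -
  assume s: "s \<ge> 0"
  obtain m where m: "m \<in> contacts (x + s *\<^sub>R v)" using contacts_nonempty by blast
  then have mA: "m \<in> A" by (simp add: contacts_def)
  then have "s * (m \<bullet> v) \<le> s" using inner_v_le A_subset_Delta s by (simp add: mult_left_le subsetD)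
  then show ?thesis using Psi_ge[OF mA, of x] m by (simp add: contacts_def inner_add_right)
qed

lemma continuous_chart_fun: "continuous_on D (chart_fun m)"
  unfolding chart_fun_def
  by (intro continuous_intros continuous_beta_inv continuous_on_compose2[OF continuous_Psi[of UNIV]]) auto

text \<open>Over a convex combination of points of \<open>D\<close> the graph \<open>C\<close> lies higher, by some \<open>s \<ge> 0\<close> along \<open>v\<close>, than
  the combination of the points of \<open>C\<close>. There \<open>\<Psi>\<close> grows by at most \<open>s\<close> and \<open>m\<close> grows by \<open>s\<close>, so that the
  difference can only decrease.\<close>

lemma chart_fun_convex:
  assumes m: "m \<in> \<sigma>" and y: "y0 \<in> D" "y1 \<in> D" "0 \<le> t" "t \<le> 1"
  shows "(1 - t) *\<^sub>R y0 + t *\<^sub>R y1 \<in> D"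
    and "chart_fun m ((1 - t) *\<^sub>R y0 + t *\<^sub>R y1) \<le> (1 - t) * chart_fun m y0 + t * chart_fun m y1"
proof -
  obtain s where s: "s \<ge> 0" "(1 - t) *\<^sub>R y0 + t *\<^sub>R y1 \<in> D"
    "\<beta>i ((1 - t) *\<^sub>R y0 + t *\<^sub>R y1) = (1 - t) *\<^sub>R \<beta>i y0 + t *\<^sub>R \<beta>i y1 + s *\<^sub>R v"
    using segment_lift[OF y] .
  show "(1 - t) *\<^sub>R y0 + t *\<^sub>R y1 \<in> D" by (rule s(2))
  let ?n = "(1 - t) *\<^sub>R \<beta>i y0 + t *\<^sub>R \<beta>i y1"
  have "chart_fun m ((1 - t) *\<^sub>R y0 + t *\<^sub>R y1) = \<Psi> (?n + s *\<^sub>R v) - m \<bullet> ?n - s"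
    unfolding chart_fun_def s(3) using sigma_inner_v[OF m] by (simp add: inner_add_right)
  also have "\<dots> \<le> \<Psi> ?n - m \<bullet> ?n" using Psi_add_v[OF s(1), of ?n] by simp
  also have "\<dots> \<le> ((1 - t) * \<Psi> (\<beta>i y0) + t * \<Psi> (\<beta>i y1)) - m \<bullet> ?n"
    using convex_onD[OF convex_Psi y(3,4), of "\<beta>i y0" "\<beta>i y1"] by simp
  also have "\<dots> = (1 - t) * chart_fun m y0 + t * chart_fun m y1"
    by (simp add: chart_fun_def inner_add_right algebra_simps)
  finally show "chart_fun m ((1 - t) *\<^sub>R y0 + t *\<^sub>R y1) \<le>
      (1 - t) * chart_fun m y0 + t * chart_fun m y1" .
qed

text \<open>Convexity of the chart function on \<open>D\<close>, used on the segment from \<open>y\<close> to \<open>z\<close>.\<close>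

lemma local_subgradient_global:
  assumes m: "m \<in> \<sigma>" and y: "y \<in> D"
    and loc: "\<forall>\<^sub>F z in at y within D. chart_fun m z \<ge> chart_fun m y + p \<bullet> (z - y)"
  shows "y \<in> contact_set D (chart_fun m) p"
  unfolding contact_set_def
proof (intro CollectI conjI ballI)
  fix z assume z: "z \<in> D"
  show "chart_fun m y + p \<bullet> (z - y) \<le> chart_fun m z"
  proof (cases "z = y")
    case False
    let ?g = "\<lambda>t::real. (1 - t) *\<^sub>R y + t *\<^sub>R z"
    have "(?g \<longlongrightarrow> (1 - 0) *\<^sub>R y + 0 *\<^sub>R z) (at_right 0)" by (intro tendsto_intros)
    moreover have ev: "\<forall>\<^sub>F t in at_right (0::real). 0 < t \<and> t < 1"
      using eventually_at_right_real[of 0 1] by simp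
    moreover have "?g t \<noteq> y" if "0 < t" for t
    proof
      assume "?g t = y"
      then have "t *\<^sub>R (z - y) = 0" by (simp add: algebra_simps)
      then show False using False that by simp
    qed
    moreover have "?g t \<in> D" if "0 < t" "t < 1" for t
      using chart_fun_convex(1)[OF m y z, of t] that by simp
    ultimately have "filterlim ?g (at y within D) (at_right 0)"
      unfolding filterlim_at by (auto elim!: eventually_mono)
    then have "\<forall>\<^sub>F t in at_right 0. chart_fun m (?g t) \<ge> chart_fun m y + p \<bullet> (?g t - y)"
      using eventually_compose_filterlim[OF loc] by simp
    then have "\<forall>\<^sub>F t in at_right 0. chart_fun m (?g t) \<ge> chart_fun m y + p \<bullet> (?g t - y) \<and> 0 < t \<and> t < 1"
      using ev by eventually_elim auto
    then obtain t where t: "chart_fun m (?g t) \<ge> chart_fun m y + p \<bullet> (?g t - y)" "0 < t" "t < 1"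
      using eventually_happens'[OF trivial_limit_at_right_real] by blast
    have "?g t - y = t *\<^sub>R (z - y)" by (simp add: algebra_simps)
    then have "chart_fun m y + t * (p \<bullet> (z - y)) \<le> (1 - t) * chart_fun m y + t * chart_fun m z"
      using t chart_fun_convex(2)[OF m y z, of t] by simp
    then have "t * (chart_fun m y + p \<bullet> (z - y)) \<le> t * chart_fun m z" by (simp add: algebra_simps)
    then show ?thesis using t(2) by simp
  qed simp
qed (rule y)

text \<open>The boundary \<open>B\<close> runs straight from \<open>n\<close> in those directions \<open>w\<close> in which the maximum \<open>\<mu>(w)\<close> of the
  active functionals vanishes. Since active functionals are one on \<open>v\<close>, every \<open>w\<close> becomes such a
  direction after subtracting \<open>\<mu>(w) v\<close>. The assumed inequality then reads
  \<open>(r - m0) \<bullet> w + (1 - r \<bullet> v) \<mu>(w) \<le> q \<bullet> w\<close> for all \<open>w\<close>. Adding it for \<open>w\<close> and \<open>-w\<close> cancels the linear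
  terms, while \<open>\<mu>(w) + \<mu>(-w) > 0\<close> for \<open>w = m1 - m2\<close>; this is the kink. So \<open>r \<bullet> v = 1\<close>, and an
  inequality between linear functions is left, which must be an equality.\<close>

lemma kink_slopes_eq:
  assumes m12: "m1 \<in> active n" "m2 \<in> active n" "m1 \<noteq> m2" and act: "active n \<subseteq> \<sigma>"
    and q: "q \<bullet> v = 0" and r: "r \<bullet> v \<le> 1" and m0: "m0 \<in> \<sigma>"
    and le: "\<And>w m'. (\<And>m. m \<in> active n \<Longrightarrow> m \<bullet> w \<le> 0) \<Longrightarrow> m' \<in> active n \<Longrightarrow> m' \<bullet> w = 0 \<Longrightarrow>
      (r - m0) \<bullet> w \<le> q \<bullet> w"
  shows "r = q + m0"
proof -
  define \<mu> where "\<mu> w = Max ((\<lambda>m. m \<bullet> w) ` active n)" for w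
  have mu_ge: "m \<bullet> w \<le> \<mu> w" if "m \<in> active n" for m w
    unfolding \<mu>_def using finite_active that by (intro Max_ge) auto
  have av: "m \<bullet> v = 1" if "m \<in> active n" for m using act sigma_inner_v that by blast
  have general: "(r - m0) \<bullet> w + (1 - r \<bullet> v) * \<mu> w \<le> q \<bullet> w" for w
  proof -
    have "\<mu> w \<in> (\<lambda>m. m \<bullet> w) ` active n"
      unfolding \<mu>_def using finite_active m12 by (intro Max_in) auto
    then obtain m' where m': "m' \<in> active n" "\<mu> w = m' \<bullet> w" by blast
    have "(r - m0) \<bullet> (w - \<mu> w *\<^sub>R v) \<le> q \<bullet> (w - \<mu> w *\<^sub>R v)"
    proof (rule le[OF _ m'(1)])
      show "m \<bullet> (w - \<mu> w *\<^sub>R v) \<le> 0" if "m \<in> active n" for m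
        using mu_ge[OF that, of w] av[OF that] by (simp add: inner_diff_right)
      show "m' \<bullet> (w - \<mu> w *\<^sub>R v) = 0" using av[OF m'(1)] m'(2) by (simp add: inner_diff_right)
    qed
    then show ?thesis
      using q sigma_inner_v[OF m0] by (simp add: inner_diff_right inner_diff_left algebra_simps)
  qed
  let ?w = "m1 - m2"
  have "\<mu> ?w + \<mu> (- ?w) \<ge> m1 \<bullet> ?w + m2 \<bullet> (- ?w)" using mu_ge m12 by (intro add_mono) auto
  moreover have "m1 \<bullet> ?w + m2 \<bullet> (- ?w) = ?w \<bullet> ?w" by (simp add: inner_diff_left inner_diff_right)
  moreover have "?w \<bullet> ?w > 0" using m12 by simp
  ultimately have pos: "\<mu> ?w + \<mu> (- ?w) > 0" by linarith
  have "(1 - r \<bullet> v) * (\<mu> ?w + \<mu> (- ?w)) \<le> 0"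
    using add_mono[OF general[of ?w] general[of "- ?w"]] by (simp add: algebra_simps)
  then have "1 - r \<bullet> v \<le> 0" using pos by (simp add: mult_le_0_iff)
  then have "r \<bullet> v = 1" using r by simp
  then have "(r - m0) \<bullet> (r - m0 - q) \<le> q \<bullet> (r - m0 - q)" using general by simp
  then have "(r - m0 - q) \<bullet> (r - m0 - q) \<le> 0" by (simp add: inner_diff_left)
  then have "r - m0 - q = 0" by (metis inner_eq_zero_iff inner_ge_zero order_antisym)
  then show ?thesis by (simp add: algebra_simps)
qed

text \<open>Let \<open>q\<close> be the gradient of the chart function, pulled back to a vector orthogonal to \<open>v\<close>. A contact
  point \<open>m\<close> gives a function with slope \<open>m\<close> that touches \<open>\<Psi>\<close> from below, and a subgradient \<open>p\<close> gives one
  with slope \<open>m1 + L p\<close>. In the straight directions of \<open>B\<close> neither slope can exceed that of the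
  derivative, so both are equal to \<open>q + m0\<close> by \<open>kink_slopes_eq\<close>.\<close>

lemma differentiable_imp_unique_contact:
  assumes U: "openin (top_of_set B) U" "U \<subseteq> C" and n: "n \<in> U" "n \<in> lower_skeleton \<Delta> h"
    and m0: "m0 \<in> \<sigma>" and diff: "chart_fun m0 differentiable (at (\<beta> n) within \<beta> ` U)"
  obtains m where "contacts n = {m}" "m \<in> \<sigma>"
    "\<And>m1 p. m1 \<in> \<sigma> \<Longrightarrow> \<beta> n \<in> contact_set D (chart_fun m1) p \<Longrightarrow> m1 + L p = m"
proof -
  obtain m1 m2 where m12: "m1 \<in> active n" "m2 \<in> active n" "m1 \<noteq> m2"
    using lower_skeleton_two_active[OF n(2)] .
  have act: "active n \<subseteq> \<sigma>" by (rule active_subset_sigma[OF U n(1)])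
  obtain f' where f': "(chart_fun m0 has_derivative f') (at (\<beta> n) within \<beta> ` U)"
    using diff by (auto simp: differentiable_def)
  have lin: "linear f'" using f' has_derivative_linear by blast
  define g where "g = adjoint f' 1"
  have g: "f' z = z \<bullet> g" for z unfolding g_def using adjoint_works[OF lin, of z 1] by simp
  define q where "q = L g"
  have q: "q \<bullet> w = f' (\<beta> w)" for w by (simp add: q_def L_inner g) (simp add: inner_commute)
  have q0: "q \<bullet> v = 0" by (simp add: q_def L_inner_v)
  have slope: "a \<le> q \<bullet> w"
    if w: "\<And>m. m \<in> active n \<Longrightarrow> m \<bullet> w \<le> 0" "m' \<in> active n" "m' \<bullet> w = 0"
    and low: "\<And>e. e > 0 \<Longrightarrow> n + e *\<^sub>R w \<in> U \<Longrightarrow>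
      chart_fun m0 (\<beta> (n + e *\<^sub>R w)) \<ge> chart_fun m0 (\<beta> n) + e * a" for a w m'
  proof (rule ccontr)
    assume "\<not> a \<le> q \<bullet> w"
    then have lt: "a - q \<bullet> w > 0" by simp
    define \<epsilon> where "\<epsilon> = (a - q \<bullet> w) / (norm (\<beta> w) + 1)"
    have np: "norm (\<beta> w) + 1 > 0" by (simp add: add_nonneg_pos)
    have "\<epsilon> * (norm (\<beta> w) + 1) = a - q \<bullet> w" using np by (simp add: \<epsilon>_def)
    moreover have "\<epsilon> > 0" using lt np by (simp add: \<epsilon>_def)
    ultimately have eps: "\<epsilon> > 0" "\<epsilon> * norm (\<beta> w) < a - q \<bullet> w"
      by (auto simp: distrib_left)
    obtain d where d: "d > 0" "\<And>y. y \<in> \<beta> ` U \<Longrightarrow> norm (y - \<beta> n) < d \<Longrightarrow>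
        norm (chart_fun m0 y - chart_fun m0 (\<beta> n) - f' (y - \<beta> n)) \<le> \<epsilon> * norm (y - \<beta> n)"
      using f' eps(1) unfolding has_derivative_within_alt by blast
    have b: "\<beta> (n + e *\<^sub>R w) - \<beta> n = e *\<^sub>R \<beta> w" for e
      by (simp add: linear_add[OF linear_beta] linear_scale[OF linear_beta])
    have "((\<lambda>e. e * norm (\<beta> w)) \<longlongrightarrow> 0 * norm (\<beta> w)) (at_right 0)" by (intro tendsto_intros)
    from order_tendstoD(2)[OF this, of d]
    have "\<forall>\<^sub>F e in at_right 0. e * norm (\<beta> w) < d" using d(1) by simp
    then have "\<forall>\<^sub>F e in at_right 0. e * norm (\<beta> w) < d \<and> n + e *\<^sub>R w \<in> U \<and> e > 0"
      using eventually_ray_in_open[OF U(1) n(1) w] eventually_at_right_less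
      by (intro eventually_conj) auto
    then obtain e where e: "e * norm (\<beta> w) < d" "n + e *\<^sub>R w \<in> U" "e > 0"
      using eventually_happens'[OF trivial_limit_at_right_real] by blast
    have "\<bar>chart_fun m0 (\<beta> (n + e *\<^sub>R w)) - chart_fun m0 (\<beta> n) - e * (q \<bullet> w)\<bar> \<le> \<epsilon> * (e * norm (\<beta> w))"
      using d(2)[of "\<beta> (n + e *\<^sub>R w)"] e unfolding b by (simp add: q linear_scale[OF lin])
    moreover have "chart_fun m0 (\<beta> (n + e *\<^sub>R w)) \<ge> chart_fun m0 (\<beta> n) + e * a"
      using low e by blast
    ultimately have "e * (a - q \<bullet> w) \<le> e * (\<epsilon> * norm (\<beta> w))" by (simp add: algebra_simps abs_le_iff)
    then show False using eps(2) e(3) by simp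
  qed
  have cf: "chart_fun m' (\<beta> x) = \<Psi> x - m' \<bullet> x" if "x \<in> U" for m' x
    using that U(2) beta_inv_beta by (auto simp: chart_fun_def)
  have uniq: "m = q + m0" if m: "m \<in> contacts n" for m
  proof (rule kink_slopes_eq[OF m12 act q0 _ m0])
    show "m \<bullet> v \<le> 1" using m inner_v_le A_subset_Delta by (auto simp: contacts_def)
    show "(m - m0) \<bullet> w \<le> q \<bullet> w"
      if w: "\<And>m. m \<in> active n \<Longrightarrow> m \<bullet> w \<le> 0" "m' \<in> active n" "m' \<bullet> w = 0" for w m'
    proof (rule slope[OF w])
      fix e :: real assume e: "e > 0" "n + e *\<^sub>R w \<in> U"
      show "chart_fun m0 (\<beta> (n + e *\<^sub>R w)) \<ge> chart_fun m0 (\<beta> n) + e * ((m - m0) \<bullet> w)"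
        unfolding cf[OF e(2)] cf[OF n(1)] using Psi_ge_contact[OF m, of "n + e *\<^sub>R w"]
        by (simp add: inner_add_right inner_diff_left algebra_simps)
    qed
  qed
  have gr: "m1 + L p = q + m0" if m1: "m1 \<in> \<sigma>" and p: "\<beta> n \<in> contact_set D (chart_fun m1) p" for m1 p
  proof (rule kink_slopes_eq[OF m12 act q0 _ m0])
    show "(m1 + L p) \<bullet> v \<le> 1" using sigma_inner_v[OF m1] L_inner_v by (simp add: inner_add_left)
    show "(m1 + L p - m0) \<bullet> w \<le> q \<bullet> w"
      if w: "\<And>m. m \<in> active n \<Longrightarrow> m \<bullet> w \<le> 0" "m' \<in> active n" "m' \<bullet> w = 0" for w m'
    proof (rule slope[OF w])
      fix e :: real assume e: "e > 0" "n + e *\<^sub>R w \<in> U"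
      have "\<beta> (n + e *\<^sub>R w) \<in> D" using e(2) U(2) by blast
      then have "chart_fun m1 (\<beta> n) + p \<bullet> (\<beta> (n + e *\<^sub>R w) - \<beta> n) \<le> chart_fun m1 (\<beta> (n + e *\<^sub>R w))"
        using p unfolding contact_set_def by blast
      moreover have "p \<bullet> (\<beta> (n + e *\<^sub>R w) - \<beta> n) = e * (L p \<bullet> w)"
        by (simp add: L_inner linear_add[OF linear_beta] linear_scale[OF linear_beta])
      ultimately have *: "\<Psi> n - m1 \<bullet> n + e * (L p \<bullet> w) \<le>
          \<Psi> (n + e *\<^sub>R w) - m1 \<bullet> (n + e *\<^sub>R w)"
        unfolding cf[OF e(2)] cf[OF n(1)] by linarith
      show "chart_fun m0 (\<beta> (n + e *\<^sub>R w)) \<ge>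
          chart_fun m0 (\<beta> n) + e * ((m1 + L p - m0) \<bullet> w)"
        unfolding cf[OF e(2)] cf[OF n(1)] using *
        by (simp add: inner_add_right inner_add_left inner_diff_left algebra_simps)
    qed
  qed
  obtain m where m: "m \<in> contacts n" using contacts_nonempty by blast
  have single: "contacts n = {q + m0}" using m uniq by blast
  have "q + m0 \<in> \<Delta>" using m uniq[OF m] A_subset_Delta by (auto simp: contacts_def)
  then have "q + m0 \<in> \<sigma>" by (subst sigma_eq) (simp add: inner_add_left q0 sigma_inner_v[OF m0])
  from that[OF single this gr] show ?thesis .
qed

end

section \<open>The Monge-Ampere equation in a chart\<close>

context facet_potential
begin

abbreviation subgradient_mass :: "real ^ 'k \<Rightarrow> (real ^ 'k) set \<Rightarrow> ennreal" where
  "subgradient_mass m E \<equiv> emeasure lebesgue (subgradient_image D (chart_fun m) (\<beta> ` E))"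

lemma borel_beta_image:
  assumes "E \<in> sets borel" "E \<subseteq> C"
  shows "\<beta> ` E \<in> sets borel"
proof -
  have "\<beta> ` E = \<beta>i -` E \<inter> D"
    using assms(2) beta_inv_beta by (force simp: image_iff)
  moreover have "\<beta>i -` E \<inter> space (restrict_space borel D) \<in> sets (restrict_space borel D)"
    using borel_measurable_continuous_on_restrict[OF continuous_beta_inv] assms(1)
    by (rule measurable_sets)
  ultimately have "\<beta> ` E \<in> sets (restrict_space borel D)" by (simp add: space_restrict_space)
  moreover have "D \<in> sets borel" using compact_D compact_imp_closed by (intro borel_closed)
  ultimately show ?thesis by (simp add: sets_restrict_space_iff)
qed

lemma subgradient_mass_additive:
  assumes E: "E \<in> sets borel" "E \<subseteq> C" and F: "F \<in> sets borel" "F \<subseteq> C" and disj: "E \<inter> F = {}"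
  shows "subgradient_mass m (E \<union> F) = subgradient_mass m E + subgradient_mass m F"
proof (cases "C = {}")
  case False
  then have "D \<noteq> {}" by simp
  from subgradient_image_distr[OF compact_D this continuous_chart_fun, of m]
  obtain x :: "real ^ 'd \<Rightarrow> real ^ 'd" where x: "x \<in> lebesgue \<rightarrow>\<^sub>M borel"
    "\<And>Y. Y \<in> sets borel \<Longrightarrow> Y \<subseteq> D \<Longrightarrow>
      subgradient_image D (chart_fun m) Y \<in> sets lebesgue \<and>
      emeasure lebesgue (subgradient_image D (chart_fun m) Y) = emeasure (distr lebesgue borel x) Y"
    by blast
  have mass: "subgradient_mass m X = emeasure (distr lebesgue borel x) (\<beta> ` X)" "\<beta> ` X \<in> sets borel"
    if "X \<in> sets borel" "X \<subseteq> C" for X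
    using x(2)[OF borel_beta_image[OF that]] borel_beta_image[OF that] that(2) by (auto intro: image_mono)
  have "\<beta> ` E \<inter> \<beta> ` F = {}"
    using inj_on_image_Int[OF inj_on_beta E(2) F(2)] disj by simp
  then have "emeasure (distr lebesgue borel x) (\<beta> ` E \<union> \<beta> ` F) =
      emeasure (distr lebesgue borel x) (\<beta> ` E) + emeasure (distr lebesgue borel x) (\<beta> ` F)"
    using mass(2)[OF E] mass(2)[OF F] by (intro plus_emeasure[symmetric]) auto
  then show ?thesis using mass(1)[OF E] mass(1)[OF F] mass(1)[of "E \<union> F"] E F by (simp add: image_Un)
qed (use E F in \<open>simp add: subgradient_image_def\<close>)

text \<open>Asking for the equation on every measurable subset of \<open>Q\<close> is what lets it pass to unions, see
  \<open>solves_on_Un\<close>.\<close>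

definition solves_on :: "(real ^ 'k) measure \<Rightarrow> real ^ 'k \<Rightarrow> (real ^ 'k) set \<Rightarrow> bool" where
  "solves_on \<nu> m Q \<longleftrightarrow> Q \<in> sets \<nu> \<and> Q \<subseteq> C \<and> (\<forall>E\<in>sets \<nu>. E \<subseteq> Q \<longrightarrow> subgradient_mass m E = emeasure \<nu> E)"

lemma solves_on_Un:
  assumes \<nu>: "\<And>E. E \<in> sets \<nu> \<Longrightarrow> E \<in> sets borel"
    and Q: "solves_on \<nu> m Q1" "solves_on \<nu> m Q2"
  shows "solves_on \<nu> m (Q1 \<union> Q2)"
  unfolding solves_on_def
proof (intro conjI ballI impI)
  show "Q1 \<union> Q2 \<in> sets \<nu>" "Q1 \<union> Q2 \<subseteq> C" using Q by (auto simp: solves_on_def)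
  fix E assume E: "E \<in> sets \<nu>" "E \<subseteq> Q1 \<union> Q2"
  have s: "E \<inter> Q1 \<in> sets \<nu>" "E - Q1 \<in> sets \<nu>" using E Q by (auto simp: solves_on_def)
  have sub: "E \<inter> Q1 \<subseteq> C" "E - Q1 \<subseteq> C" using E Q by (auto simp: solves_on_def)
  have split: "E = (E \<inter> Q1) \<union> (E - Q1)" by blast
  have "subgradient_mass m E = subgradient_mass m ((E \<inter> Q1) \<union> (E - Q1))" using split by simp
  also have "\<dots> = subgradient_mass m (E \<inter> Q1) + subgradient_mass m (E - Q1)"
    by (rule subgradient_mass_additive) (use s sub \<nu> in auto)
  also have "\<dots> = emeasure \<nu> (E \<inter> Q1) + emeasure \<nu> (E - Q1)"
    using Q s E(2) unfolding solves_on_def by (metis Diff_subset_conv Int_lower2)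
  also have "\<dots> = emeasure \<nu> ((E \<inter> Q1) \<union> (E - Q1))"
    by (rule plus_emeasure) (use s in auto)
  also have "\<dots> = emeasure \<nu> E" using split by simp
  finally show "subgradient_mass m E = emeasure \<nu> E" .
qed

lemma solves_on_empty: "solves_on \<nu> m {}"
  by (simp add: solves_on_def subgradient_image_def)

lemma solves_on_UN:
  assumes "\<And>E. E \<in> sets \<nu> \<Longrightarrow> E \<in> sets borel" "finite I" "\<And>i. i \<in> I \<Longrightarrow> solves_on \<nu> m (Q i)"
  shows "solves_on \<nu> m (\<Union>i\<in>I. Q i)"
  using assms(2,3)
  by (induction I rule: finite_induct) (auto intro: solves_on_empty solves_on_Un[OF assms(1)])

lemma solves_on_subset:
  "solves_on \<nu> m Q \<Longrightarrow> Q' \<in> sets \<nu> \<Longrightarrow> Q' \<subseteq> Q \<Longrightarrow> solves_on \<nu> m Q'"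
  by (auto simp: solves_on_def)

text \<open>On \<open>\<tau>\<close> the linear function of \<open>m\<close> differs by a constant from an affine function of the coordinates
  \<open>\<beta>\<close>, as \<open>m\<close> minus the normal of \<open>\<tau>\<close> is orthogonal to \<open>v\<close>. The two subgradient images therefore agree up
  to a translation, provided that subgradients relative to \<open>D\<close> and to the image of \<open>\<tau>\<close> are the same; this
  is \<open>local_subgradient_global\<close>, since the relative interior of \<open>\<tau>\<close> is open in \<open>B\<close>.\<close>

lemma chart_subgradient_on_facet:
  assumes U: "openin (top_of_set B) U" "U \<subseteq> C" and \<tau>: "\<tau> \<in> facets P"
    and E: "E \<subseteq> rel_interior \<tau>" "E \<subseteq> U" and m: "m \<in> \<sigma>"
  shows "subgradient_mass m E = emeasure lebesgue
    (subgradient_image (\<beta> ` rel_interior \<tau>) (\<lambda>y. \<Psi> (\<beta>i y)) (\<beta> ` E))"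
proof (cases "E = {}")
  case False
  then obtain n0 where n0: "n0 \<in> E" by blast
  define m\<tau> where "m\<tau> = outward_normal P \<tau>"
  have mt: "m\<tau> \<in> active n0" "m\<tau> \<in> \<sigma>"
    unfolding m\<tau>_def using outward_normal_mem_sigma[OF U _ \<tau>] n0 E by blast+
  have \<tau>eq: "\<tau> = P \<inter> {x. m\<tau> \<bullet> x = of_int (h m\<tau>)}"
    by (rule facet_of_rel_interior_active(2)[OF \<tau> _ mt(1)]) (use n0 E in blast)
  have lat: "m\<tau> \<in> int_lattice" using mt(1) by (simp add: active_def)
  have \<tau>C: "rel_interior \<tau> \<subseteq> C"
  proof
    fix x assume "x \<in> rel_interior \<tau>"
    then have x: "x \<in> P" "m\<tau> \<bullet> x = of_int (h m\<tau>)" using rel_interior_subset \<tau>eq by blast+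
    then show "x \<in> C" using mem_C sigma_lattice_active mt(2) lat by blast
  qed
  have "(m - m\<tau>) \<bullet> v = 0" using sigma_inner_v m mt(2) by (simp add: inner_diff_left)
  then obtain c where c: "m - m\<tau> = L c" using range_L by blast
  have shift: "m \<bullet> (x - n) = c \<bullet> (\<beta> x - \<beta> n)" if "x \<in> rel_interior \<tau>" "n \<in> rel_interior \<tau>" for x n
  proof -
    have "m\<tau> \<bullet> y = of_int (h m\<tau>)" if "y \<in> rel_interior \<tau>" for y
      using subsetD[OF rel_interior_subset that] by (subst (asm) \<tau>eq) simp
    then have "m\<tau> \<bullet> x = m\<tau> \<bullet> n" using that by simp
    moreover have "m = m\<tau> + L c" using c by (simp add: algebra_simps)
    ultimately show ?thesis
      by (simp add: inner_add_left inner_diff_right L_inner)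
  qed
  have cf: "chart_fun m (\<beta> x) = \<Psi> x - m \<bullet> x" "\<Psi> (\<beta>i (\<beta> x)) = \<Psi> x" if "x \<in> C" for x
    using that beta_inv_beta by (auto simp: chart_fun_def)
  have iff: "p \<in> subgradient_image D (chart_fun m) (\<beta> ` E) \<longleftrightarrow>
      c + p \<in> subgradient_image (\<beta> ` rel_interior \<tau>) (\<lambda>y. \<Psi> (\<beta>i y)) (\<beta> ` E)" for p
  proof
    assume "p \<in> subgradient_image D (chart_fun m) (\<beta> ` E)"
    then obtain n where n: "n \<in> E"
      "\<forall>z\<in>D. chart_fun m (\<beta> n) + p \<bullet> (z - \<beta> n) \<le> chart_fun m z"
      unfolding subgradient_image_def by blast
    have nt: "n \<in> rel_interior \<tau>" using n(1) E by blast
    have "\<Psi> (\<beta>i (\<beta> n)) + (c + p) \<bullet> (\<beta> x - \<beta> n) \<le> \<Psi> (\<beta>i (\<beta> x))" if x: "x \<in> rel_interior \<tau>" for x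
    proof -
      have "chart_fun m (\<beta> n) + p \<bullet> (\<beta> x - \<beta> n) \<le> chart_fun m (\<beta> x)"
        using n(2) x \<tau>C by blast
      then show ?thesis
        using cf[OF subsetD[OF \<tau>C x]] cf[OF subsetD[OF \<tau>C nt]] shift[OF x nt]
        by (simp add: inner_add_left inner_diff_right)
    qed
    then show "c + p \<in> subgradient_image (\<beta> ` rel_interior \<tau>) (\<lambda>y. \<Psi> (\<beta>i y)) (\<beta> ` E)"
      unfolding subgradient_image_def using n(1) by blast
  next
    assume "c + p \<in> subgradient_image (\<beta> ` rel_interior \<tau>) (\<lambda>y. \<Psi> (\<beta>i y)) (\<beta> ` E)"
    then obtain n where n: "n \<in> E" "\<forall>z\<in>\<beta> ` rel_interior \<tau>.
        \<Psi> (\<beta>i (\<beta> n)) + (c + p) \<bullet> (z - \<beta> n) \<le> \<Psi> (\<beta>i z)"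
      unfolding subgradient_image_def by blast
    have nt: "n \<in> rel_interior \<tau>" using n(1) E by blast
    have nD: "\<beta> n \<in> D" using nt \<tau>C by blast
    obtain T where T: "open T" "rel_interior \<tau> = B \<inter> T"
      using openin_rel_interior_facet[OF \<tau>] by (auto simp: openin_open)
    have "(\<beta>i \<longlongrightarrow> \<beta>i (\<beta> n)) (at (\<beta> n) within D)"
      using continuous_beta_inv nD by (auto simp: continuous_on_def)
    then have "\<forall>\<^sub>F z in at (\<beta> n) within D. \<beta>i z \<in> T"
      using T nt \<tau>C beta_inv_beta by (intro topological_tendstoD) auto
    moreover have "\<forall>\<^sub>F z in at (\<beta> n) within D. z \<in> D" by (auto simp: eventually_at_filter)
    ultimately have "\<forall>\<^sub>F z in at (\<beta> n) within D.
        chart_fun m z \<ge> chart_fun m (\<beta> n) + p \<bullet> (z - \<beta> n)"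
    proof eventually_elim
      case (elim z)
      define x where "x = \<beta>i z"
      have x: "x \<in> rel_interior \<tau>" "z = \<beta> x"
        using elim T(2) beta_inv_mem C_subset_B beta_beta_inv by (auto simp: x_def)
      have "\<Psi> (\<beta>i (\<beta> n)) + (c + p) \<bullet> (\<beta> x - \<beta> n) \<le> \<Psi> (\<beta>i (\<beta> x))"
        using n(2) x(1) by blast
      then show ?case
        using cf[OF subsetD[OF \<tau>C x(1)]] cf[OF subsetD[OF \<tau>C nt]] shift[OF x(1) nt] x(2)
        by (simp add: inner_add_left inner_diff_right)
    qed
    then have "\<beta> n \<in> contact_set D (chart_fun m) p"
      by (rule local_subgradient_global[OF m nD])
    then show "p \<in> subgradient_image D (chart_fun m) (\<beta> ` E)"
      unfolding subgradient_image_def contact_set_def using n(1) by blast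
  qed
  have eq: "subgradient_image (\<beta> ` rel_interior \<tau>) (\<lambda>y. \<Psi> (\<beta>i y)) (\<beta> ` E) =
      (\<lambda>p. c + 1 *\<^sub>R p) ` subgradient_image D (chart_fun m) (\<beta> ` E)"
    (is "?R = ?h ` ?G")
  proof (intro set_eqI iffI)
    fix q assume "q \<in> ?R"
    then have "q - c \<in> ?G" using iff[of "q - c"] by simp
    then show "q \<in> ?h ` ?G" by (intro image_eqI[of _ _ "q - c"]) simp_all
  next
    fix q assume "q \<in> ?h ` ?G"
    then obtain p where "q = c + p" "p \<in> ?G" by auto
    then show "q \<in> ?R" using iff by simp
  qed
  show ?thesis
    unfolding eq using emeasure_lebesgue_affine[of 1 c "subgradient_image D (chart_fun m) (\<beta> ` E)"]
    by (simp add: add.commute)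
qed (simp add: subgradient_image_def)

text \<open>At a singular point of \<open>\<Psi>\<close> the single contact point is in \<open>\<sigma>\<close> but not in its relative interior, and
  every subgradient of the chart function is a coordinate vector of this contact point.\<close>

lemma subgradient_image_null_if_boundary_contact:
  assumes U: "openin (top_of_set B) U" "U \<subseteq> C"
    and diff: "\<And>n. n \<in> U \<Longrightarrow> \<exists>m0\<in>\<sigma>. chart_fun m0 differentiable (at (\<beta> n) within \<beta> ` U)"
    and E: "E \<subseteq> U \<inter> lower_skeleton \<Delta> h" "E \<inter> potential_charts \<Delta> h \<Psi> \<sigma> = {}" and m: "m \<in> \<sigma>"
  shows "subgradient_mass m E = 0" and "n \<in> E \<Longrightarrow> contacts n \<subseteq> \<sigma> - rel_interior \<sigma>"
proof -
  have contact: "\<exists>m'. contacts n = {m'} \<and> m' \<in> \<sigma> - rel_interior \<sigma> \<and>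
      (\<forall>p. \<beta> n \<in> contact_set D (chart_fun m) p \<longrightarrow> m + L p = m')" if n: "n \<in> E" for n
  proof -
    have nU: "n \<in> U" "n \<in> lower_skeleton \<Delta> h" using n E by auto
    obtain m0 where m0: "m0 \<in> \<sigma>" "chart_fun m0 differentiable (at (\<beta> n) within \<beta> ` U)"
      using diff[OF nU(1)] by blast
    obtain m' where m': "contacts n = {m'}" "m' \<in> \<sigma>"
      "\<And>m1 p. m1 \<in> \<sigma> \<Longrightarrow> \<beta> n \<in> contact_set D (chart_fun m1) p \<Longrightarrow> m1 + L p = m'"
      by (rule differentiable_imp_unique_contact[OF U nU m0]) (rule that, assumption, assumption, blast)
    have "n \<notin> potential_charts \<Delta> h \<Psi> \<sigma>" using n E(2) by blast
    moreover have "n \<in> B" using nU(1) U(2) C_subset_B by blast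
    ultimately have "\<not> contacts n \<subseteq> rel_interior \<sigma>" by (simp add: mem_potential_charts)
    then have "m' \<notin> rel_interior \<sigma>" by (simp add: m'(1))
    then have "m' \<in> \<sigma> - rel_interior \<sigma>" using m'(2) by blast
    moreover have "\<forall>p. \<beta> n \<in> contact_set D (chart_fun m) p \<longrightarrow> m + L p = m'"
      using m'(3)[OF m] by (intro allI impI)
    ultimately show ?thesis using m'(1) by (intro exI conjI)
  qed
  then show "n \<in> E \<Longrightarrow> contacts n \<subseteq> \<sigma> - rel_interior \<sigma>" by fastforce
  have ED: "\<beta> ` E \<subseteq> D" using E U(2) by blast
  have "subgradient_image D (chart_fun m) (\<beta> ` E) \<subseteq> {p. m + L p \<in> \<sigma> - rel_interior \<sigma>}"
  proof
    fix p assume "p \<in> subgradient_image D (chart_fun m) (\<beta> ` E)"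
    then obtain n where "n \<in> E" "\<beta> n \<in> contact_set D (chart_fun m) p"
      unfolding subgradient_image_eq_contact[OF ED] by blast
    then show "p \<in> {p. m + L p \<in> \<sigma> - rel_interior \<sigma>}" using contact[of n] by auto
  qed
  then have "negligible (subgradient_image D (chart_fun m) (\<beta> ` E))"
    using negligible_facet_boundary_preimage[OF m] negligible_subset by blast
  then show "subgradient_mass m E = 0" by (simp add: negligible_iff_null_sets null_setsD1)
qed

lemma skeleton_avoids_other_charts:
  assumes U: "openin (top_of_set B) U" "U \<subseteq> C"
    and diff: "\<And>n. n \<in> U \<Longrightarrow> \<exists>m0\<in>\<sigma>. chart_fun m0 differentiable (at (\<beta> n) within \<beta> ` U)"
    and n: "n \<in> U" "n \<in> lower_skeleton \<Delta> h" and \<sigma>': "\<sigma>' \<in> facets \<Delta>" "\<sigma>' \<noteq> \<sigma>"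
  shows "n \<notin> potential_charts \<Delta> h \<Psi> \<sigma>'"
proof -
  obtain m0 where m0: "m0 \<in> \<sigma>" "chart_fun m0 differentiable (at (\<beta> n) within \<beta> ` U)"
    using diff[OF n(1)] by blast
  obtain m' where m': "contacts n = {m'}" "m' \<in> \<sigma>"
    by (rule differentiable_imp_unique_contact[OF U n m0])
  then have "m' \<notin> rel_interior \<sigma>'" using facet_disjoint_rel_interior[OF \<sigma>'] by blast
  then show ?thesis by (simp add: mem_potential_charts m'(1))
qed

end

section \<open>Nonsmoothness on charts that resolve singular points\<close>

theorem lemma15:
  fixes \<Delta> :: "(real ^ 'k::finite) set" and h :: "real ^ 'k \<Rightarrow> int"
    and b :: "(real ^ 'k) set \<Rightarrow> 'd::finite \<Rightarrow> real ^ 'k"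
    and \<nu> :: "(real ^ 'k) measure" and \<Psi> :: "real ^ 'k \<Rightarrow> real"
    and U' :: "(real ^ 'k) set \<Rightarrow> (real ^ 'k) set"
  assumes "CARD('k) = CARD('d) + 1"
    and "reflexive_polytope \<Delta>" and "height_function \<Delta> h"
    and "facet_bases \<Delta> b"
    and "sets \<nu> = sets (restrict_space borel (frontier (height_dual \<Delta> h)))"
    and "emeasure \<nu> (frontier (height_dual \<Delta> h)) = emeasure (mu_M \<Delta> b) (frontier \<Delta>)"
    and "kantorovich_potential \<Delta> h b \<nu> \<Psi>"
    and "chart_collection \<Delta> h (potential_charts \<Delta> h \<Psi>)"
    and "monge_ampere \<Delta> h b \<nu> \<Psi> (potential_charts \<Delta> h \<Psi>)"
    and "minimal_singular_set \<Delta> h b \<nu> \<Psi> (potential_charts \<Delta> h \<Psi>)"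
    and "chart_collection \<Delta> h U'"
    and "\<not> singular_set \<Delta> h (potential_charts \<Delta> h \<Psi>) \<subseteq> singular_set \<Delta> h U'"
  shows "\<exists>\<sigma>\<in>facets \<Delta>. \<exists>n\<in>U' \<sigma>. \<forall>m\<^sub>0\<in>\<sigma>.
    \<not> (\<lambda>y. \<Psi> (beta_inv \<Delta> h b \<sigma> y) - m\<^sub>0 \<bullet> beta_inv \<Delta> h b \<sigma> y)
        differentiable (at (beta b \<sigma> n) within beta b \<sigma> ` U' \<sigma>)"
proof (rule ccontr)
  assume "\<not> ?thesis"
  then have smooth: "\<exists>m0\<in>\<sigma>. (\<lambda>y. \<Psi> (beta_inv \<Delta> h b \<sigma> y) - m0 \<bullet> beta_inv \<Delta> h b \<sigma> y)
        differentiable (at (beta b \<sigma> n) within beta b \<sigma> ` U' \<sigma>)"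
    if "\<sigma> \<in> facets \<Delta>" "n \<in> U' \<sigma>" for \<sigma> n
    using that by blast
  interpret kantorovich \<Delta> h b \<Psi> \<nu>
    by unfold_locales
      (use assms in \<open>auto simp: kantorovich_potential_def Let_def P_class_def\<close>)
  let ?U = "potential_charts \<Delta> h \<Psi>"
  let ?S = "singular_set \<Delta> h ?U"
  obtain x where x: "x \<in> ?S" "x \<notin> singular_set \<Delta> h U'" using assms(12) by blast
  have xl: "x \<in> lower_skeleton \<Delta> h" using x(1) by (simp add: singular_set_def)
  then obtain \<sigma> where \<sigma>: "\<sigma> \<in> facets \<Delta>" "x \<in> U' \<sigma>" using x(2) by (auto simp: singular_set_def)
  interpret facet_potential \<Delta> h b \<sigma> \<Psi>
    by unfold_locales (rule \<sigma>(1))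
  have U': "openin (top_of_set B) (U' \<sigma>)" "U' \<sigma> \<subseteq> C"
    using assms(11) \<sigma>(1) by (auto simp: chart_collection_def)
  have diff: "\<exists>m0\<in>\<sigma>. chart_fun m0 differentiable (at (\<beta> n) within \<beta> ` U' \<sigma>)" if "n \<in> U' \<sigma>" for n
    using smooth[OF \<sigma>(1) that] unfolding chart_fun_def[abs_def] .
  \<comment> \<open>A closed ball, because its removal from the other charts must leave them open.\<close>
  obtain r where r: "r > 0" "B \<inter> cball x r \<subseteq> U' \<sigma>"
    using U'(1) \<sigma>(2) unfolding openin_contains_cball by (auto simp: Int_commute)
  define U'' where "U'' \<tau> = (if \<tau> = \<sigma> then ?U \<sigma> \<union> (B \<inter> ball x r) else ?U \<tau> - cball x r)" for \<tau>
  have openU: "openin (top_of_set B) (?U \<tau>)" "?U \<tau> \<subseteq> chart_domain \<Delta> h \<tau>" if "\<tau> \<in> facets \<Delta>" for \<tau>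
    using assms(8) that by (auto simp: chart_collection_def)
  have xB: "x \<in> B" using xl by (simp add: lower_skeleton_def)

  have coll: "chart_collection \<Delta> h U''"
    unfolding chart_collection_def
  proof (intro conjI ballI)
    fix \<tau> assume \<tau>: "\<tau> \<in> facets \<Delta>"
    have "openin (top_of_set B) (B \<inter> ball x r)" "openin (top_of_set B) (B \<inter> - cball x r)"
      by (auto intro!: openin_open_Int)
    then have "openin (top_of_set B) (?U \<sigma> \<union> (B \<inter> ball x r))"
      "openin (top_of_set B) (?U \<tau> \<inter> (B \<inter> - cball x r))"
      using openU(1)[OF \<tau>] openU(1)[OF \<sigma>(1)] by (blast intro: openin_Un openin_Int)+
    moreover have "?U \<tau> \<inter> (B \<inter> - cball x r) = ?U \<tau> - cball x r"
      using openU(1)[OF \<tau>] openin_imp_subset by blast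
    ultimately show "openin (top_of_set B) (U'' \<tau>)" by (simp add: U''_def)
    show "U'' \<tau> \<subseteq> chart_domain \<Delta> h \<tau>"
      using openU(2)[OF \<tau>] r U'(2) ball_subset_cball[of x r] by (auto simp: U''_def)
  next
    have disj: "?U \<tau> \<inter> ?U \<tau>' = {}" if "\<tau> \<in> facets \<Delta>" "\<tau>' \<in> facets \<Delta>" "\<tau> \<noteq> \<tau>'" for \<tau> \<tau>'
      using assms(8) that unfolding chart_collection_def disjoint_family_on_def by blast
    have avoid: "U'' \<sigma> \<inter> U'' \<tau> = {}" if "\<tau> \<in> facets \<Delta>" "\<tau> \<noteq> \<sigma>" for \<tau>
      using disj[OF \<sigma>(1) that(1)] that(2) ball_subset_cball[of x r] unfolding U''_def by auto
    show "disjoint_family_on U'' (facets \<Delta>)"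
      unfolding disjoint_family_on_def
    proof (intro ballI impI)
      fix \<tau> \<tau>' assume t: "\<tau> \<in> facets \<Delta>" "\<tau>' \<in> facets \<Delta>" "\<tau> \<noteq> \<tau>'"
      show "U'' \<tau> \<inter> U'' \<tau>' = {}"
      proof (cases "\<tau> = \<sigma> \<or> \<tau>' = \<sigma>")
        case True
        then show ?thesis using avoid t by blast
      next
        case False
        then show ?thesis using disj[OF t] by (auto simp: U''_def)
      qed
    qed
  qed
  have keep: "?U \<tau> \<inter> lower_skeleton \<Delta> h \<subseteq> U'' \<tau>" if \<tau>: "\<tau> \<in> facets \<Delta>" for \<tau>
  proof (cases "\<tau> = \<sigma>")
    case False
    show ?thesis
    proof
      fix n assume n: "n \<in> ?U \<tau> \<inter> lower_skeleton \<Delta> h"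
      then have "n \<in> B" by (simp add: lower_skeleton_def)
      then have "n \<notin> cball x r"
        using skeleton_avoids_other_charts[OF U' diff _ _ \<tau> False, of n] n r(2) by blast
      then show "n \<in> U'' \<tau>" using False n by (simp add: U''_def)
    qed
  qed (auto simp: U''_def)
  have ext: "extends_charts \<Delta> h U'' ?U"
    unfolding extends_charts_def
  proof (intro conjI ballI keep)
    show "singular_set \<Delta> h U'' \<subseteq> ?S"
      unfolding singular_set_def using keep by blast
  qed
  have "x \<notin> singular_set \<Delta> h U''"
    using xB \<sigma>(1) r(1) by (auto simp: singular_set_def U''_def intro!: bexI[of _ \<sigma>])
  then have proper: "singular_set \<Delta> h U'' \<subset> ?S"
    using ext x(1) unfolding extends_charts_def by blast
  have closed_sing: "closed (singular_set \<Delta> h V)" if V: "chart_collection \<Delta> h V" for V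
  proof -
    have "openin (top_of_set B) (\<Union>\<tau>\<in>facets \<Delta>. V \<tau>)"
      using V by (intro openin_Union) (auto simp: chart_collection_def)
    then obtain T where T: "open T" "(\<Union>\<tau>\<in>facets \<Delta>. V \<tau>) = B \<inter> T" by (auto simp: openin_open)
    have "singular_set \<Delta> h V = lower_skeleton \<Delta> h - T"
      unfolding singular_set_def T(2) by (auto simp: lower_skeleton_def)
    then show ?thesis using closed_Diff[OF closed_lower_skeleton T(1)] by simp
  qed
  have sb: "E \<in> sets borel" if "E \<in> sets \<nu>" for E using that sets_nu_iff by blast
  have open_sets: "V \<in> sets \<nu>" if V: "openin (top_of_set B) V" for V
  proof -
    obtain T where T: "open T" "V = B \<inter> T" using V by (auto simp: openin_open)
    have "B \<in> sets borel" using frontier_closed by (rule borel_closed)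
    then have "V \<in> sets borel" unfolding T(2) using T(1) by (intro sets.Int) auto
    then show ?thesis using sets_nu_iff T by blast
  qed
  have V_open: "openin (top_of_set B) (B \<inter> ball x r)" by (simp add: openin_open_Int)
  have VU: "B \<inter> ball x r \<subseteq> U' \<sigma>" using r(2) ball_subset_cball[of x r] by blast
  have solves: "solves_on \<nu> m (U'' \<sigma>)" if m: "m \<in> \<sigma>" for m
  proof -
    let ?K = "?S \<inter> cball x r"
    \<comment> \<open>The old chart, the open cells of the ball, and the singular points in the ball cover the new chart.\<close>
    let ?Q = "?U \<sigma> \<union> (\<Union>\<tau>\<in>facets P. rel_interior \<tau> \<inter> (B \<inter> ball x r)) \<union> ?K"
    have 1: "solves_on \<nu> m (?U \<sigma>)"
      unfolding solves_on_def
      using assms(9) openU[OF \<sigma>(1)] open_sets[OF openU(1)[OF \<sigma>(1)]] \<sigma>(1) m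
      unfolding monge_ampere_def chart_fun_def[abs_def] by blast
    have 2: "solves_on \<nu> m (rel_interior \<tau> \<inter> (B \<inter> ball x r))" if \<tau>: "\<tau> \<in> facets P" for \<tau>
      unfolding solves_on_def
    proof (intro conjI ballI impI)
      show "rel_interior \<tau> \<inter> (B \<inter> ball x r) \<in> sets \<nu>"
        using open_sets[OF openin_rel_interior_facet[OF \<tau>]] open_sets[OF V_open] by auto
      show "rel_interior \<tau> \<inter> (B \<inter> ball x r) \<subseteq> C" using VU U'(2) by blast
      fix E assume E: "E \<in> sets \<nu>" "E \<subseteq> rel_interior \<tau> \<inter> (B \<inter> ball x r)"
      show "subgradient_mass m E = emeasure \<nu> E"
      proof (cases "E = {}")
        case False
        then obtain n where n: "n \<in> E" by blast
        have "outward_normal P \<tau> \<in> \<sigma>"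
          using outward_normal_mem_sigma(2)[OF U' _ \<tau>, of n] n E(2) VU by blast
        moreover have "subgradient_mass m E = emeasure lebesgue
            (subgradient_image (\<beta> ` rel_interior \<tau>) (\<lambda>y. \<Psi> (\<beta>i y)) (\<beta> ` E))"
          by (rule chart_subgradient_on_facet[OF U' \<tau> _ _ m]) (use E(2) VU in auto)
        ultimately show ?thesis
          using assms(9) \<tau> \<sigma>(1) E unfolding monge_ampere_def by simp
      qed (simp add: subgradient_image_def)
    qed
    have KB: "?K \<subseteq> B" by (auto simp: singular_set_def lower_skeleton_def)
    have K: "?K \<subseteq> U' \<sigma> \<inter> lower_skeleton \<Delta> h" "?K \<inter> ?U \<sigma> = {}"
      using KB r(2) \<sigma>(1) by (auto simp: singular_set_def)
    have cK: "compact ?K"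
      by (rule closed_Int_compact[OF closed_sing[OF assms(8)] compact_cball])
    have \<nu>K: "emeasure \<nu> ?K = 0"
      by (rule null_if_contacts_null[OF cK KB mu_M_facet_boundary[OF \<sigma>(1)]])
        (rule subgradient_image_null_if_boundary_contact(2)[OF U' diff K m])
    have 3: "solves_on \<nu> m ?K"
      unfolding solves_on_def
    proof (intro conjI ballI impI)
      show Ks: "?K \<in> sets \<nu>" using cK KB by (simp add: sets_nu_iff compact_imp_closed borel_closed)
      show "?K \<subseteq> C" using K(1) U'(2) by blast
      fix E assume E: "E \<in> sets \<nu>" "E \<subseteq> ?K"
      have "subgradient_mass m E = 0"
        by (rule subgradient_image_null_if_boundary_contact(1)[OF U' diff _ _ m]) (use E(2) K in blast)+
      moreover have "emeasure \<nu> E = 0" using emeasure_mono[OF E(2) Ks] \<nu>K by simp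
      ultimately show "subgradient_mass m E = emeasure \<nu> E" by simp
    qed
    have fin: "finite (facets P)" using finite_polytope_facets[OF polytope_P] by (simp add: facets_def)
    have Q: "solves_on \<nu> m ?Q"
      by (intro solves_on_Un[OF sb] 1 3 solves_on_UN[OF sb fin] 2)
    have "U'' \<sigma> \<subseteq> ?Q"
    proof
      fix n assume n: "n \<in> U'' \<sigma>"
      show "n \<in> ?Q"
      proof (cases "n \<in> ?U \<sigma> \<or> n \<in> (\<Union>\<tau>\<in>facets P. rel_interior \<tau>)")
        case False
        then have nV: "n \<in> B \<inter> ball x r" using n by (simp add: U''_def)
        then have nl: "n \<in> lower_skeleton \<Delta> h" using False by (simp add: lower_skeleton_def)
        have "n \<notin> ?U \<tau>" if \<tau>: "\<tau> \<in> facets \<Delta>" for \<tau>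
        proof (cases "\<tau> = \<sigma>")
          case True
          then show ?thesis using False by blast
        next
          case other: False
          show ?thesis
            by (rule skeleton_avoids_other_charts[OF U' diff _ nl \<tau> other]) (use nV VU in auto)
        qed
        then have "n \<in> ?S" using nl by (auto simp: singular_set_def)
        then show ?thesis using nV by auto
      next
        case True
        then show ?thesis using n by (auto simp: U''_def)
      qed
    qed
    moreover have "U'' \<sigma> \<in> sets \<nu>"
      using coll \<sigma>(1) open_sets by (auto simp: chart_collection_def)
    ultimately show ?thesis by (intro solves_on_subset[OF Q])
  qed
  have MA: "monge_ampere \<Delta> h b \<nu> \<Psi> U''"
    unfolding monge_ampere_def
  proof (intro conjI)
    show "\<forall>\<tau>\<in>facets P. \<forall>\<sigma>\<in>facets \<Delta>. outward_normal P \<tau> \<in> \<sigma> \<longrightarrow>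
        (\<forall>E\<in>sets \<nu>. E \<subseteq> rel_interior \<tau> \<longrightarrow>
           emeasure lebesgue (subgradient_image (beta b \<sigma> ` rel_interior \<tau>)
             (\<lambda>y. \<Psi> (beta_inv \<Delta> h b \<sigma> y)) (beta b \<sigma> ` E)) = emeasure \<nu> E)"
      using assms(9) unfolding monge_ampere_def by (rule conjunct1)
    show "\<forall>\<tau>\<in>facets \<Delta>. \<forall>m\<in>\<tau>. \<forall>E\<in>sets \<nu>. E \<subseteq> U'' \<tau> \<longrightarrow>
        emeasure lebesgue (subgradient_image (beta b \<tau> ` chart_domain \<Delta> h \<tau>)
          (\<lambda>y. \<Psi> (beta_inv \<Delta> h b \<tau> y) - m \<bullet> beta_inv \<Delta> h b \<tau> y) (beta b \<tau> ` E)) = emeasure \<nu> E"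
    proof (intro ballI impI)
      fix \<tau> m E assume \<tau>: "\<tau> \<in> facets \<Delta>" and m: "m \<in> \<tau>" and E: "E \<in> sets \<nu>" "E \<subseteq> U'' \<tau>"
      show "emeasure lebesgue (subgradient_image (beta b \<tau> ` chart_domain \<Delta> h \<tau>)
          (\<lambda>y. \<Psi> (beta_inv \<Delta> h b \<tau> y) - m \<bullet> beta_inv \<Delta> h b \<tau> y) (beta b \<tau> ` E)) = emeasure \<nu> E"
      proof (cases "\<tau> = \<sigma>")
        case True
        then show ?thesis
          using solves[of m] m E unfolding solves_on_def chart_fun_def[abs_def] by blast
      next
        case False
        then have "E \<subseteq> ?U \<tau>" using E(2) by (auto simp: U''_def)
        then show ?thesis using assms(9) \<tau> m E(1) unfolding monge_ampere_def by blast
      qed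
    qed
  qed
  show False
    using assms(10) closed_sing[OF coll] proper coll ext MA unfolding minimal_singular_set_def by blast
qed

end
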